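(* Let $G$ be a finitely generated group and $\mathcal{m}$ a probability measure on $G$ such that there exists $\delta>0$ with $\int(\mathrm{length}(g))^{1+\delta}\,d\mathcal{m}(g)<\infty$, and let $\rho:G\to\mathrm{SL}(2,\mathbb{M})$ be a homomorphism such that $\rho_{\mathsf{na}}(G)\le\mathrm{SL}(2,\mathbb{L})$ is elementary. Then $\chi(t)=(\log|t|^{-1})\,\chi_{\mathsf{na}}+O(1)$ as $t\to0$. If in addition $\mathcal{m}$ is symmetric, then $\chi_{\mathsf{na}}=0$.
   Context: $\mathrm{length}$ is word length for a fixed finite symmetric generating set. $\mathbb{M}$: holomorphic functions on $\mathbb{D}^*$ meromorphic at $0$; $\rho$ gives $\rho_t:G\to\mathrm{SL}(2,\mathbb{C})$. $\mathbb{L}=\mathbb{C}((t))$ with $|f|=\exp(-\mathrm{ord}_0f)$, $\rho_{\mathsf{na}}$ the induced representation into $\mathrm{SL}(2,\mathbb{L})$. A subgroup of $\mathrm{SL}(2,\mathbb{L})$ is non-elementary if its image in $\mathrm{PGL}(2,\mathbb{L})$ contains an element with $|\mathrm{tr}|>1$ (for an $\mathrm{SL}_2$-lift over an at most quadratic extension) and has no finite orbit on $\mathbb{P}^1(\mathbb{L})$; elementary means not non-elementary. $\mathcal{m}^n$ is the $n$-fold convolution; $\chi(t)=\lim_n\frac1n\int\log\|\rho_t(g)\|\,d\mathcal{m}^n(g)$ with any matrix norm on $\mathrm{SL}(2,\mathbb{C})$, and $\chi_{\mathsf{na}}=\lim_n\frac1n\int\log\|\rho_{\mathsf{na}}(g)\|_{\mathsf{na}}\,d\mathcal{m}^n(g)$,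 $\|\cdot\|_{\mathsf{na}}$ the max of $t$-adic absolute values of entries. Symmetric means $\mathcal{m}(\{g\})=\mathcal{m}(\{g^{-1}\})$. *)

theory Defs
  imports "HOL-Complex_Analysis.Complex_Analysis" "HOL-Probability.Probability"
    "HOL-Algebra.Group" "HOL-Algebra.Generated_Groups"
begin

definition punct_disk :: "complex set" where
  "punct_disk = ball 0 1 - {0}"

definition in_M :: "(complex \<Rightarrow> complex) \<Rightarrow> bool" where
  "in_M f \<longleftrightarrow> f holomorphic_on punct_disk \<and> f meromorphic_on {0}"

definition word_length :: "('g, 'b) monoid_scheme \<Rightarrow> 'g set \<Rightarrow> 'g \<Rightarrow> nat" where
  "word_length G S g =
     (LEAST n. \<exists>xs. length xs = n \<and> set xs \<subseteq> S \<and> foldr (\<otimes>\<^bsub>G\<^esub>) xs \<one>\<^bsub>G\<^esub> = g)"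

primrec conv_pow :: "('g, 'b) monoid_scheme \<Rightarrow> 'g pmf \<Rightarrow> nat \<Rightarrow> 'g pmf" where
  "conv_pow G m 0 = return_pmf \<one>\<^bsub>G\<^esub>"
| "conv_pow G m (Suc n) = bind_pmf (conv_pow G m n) (\<lambda>x. map_pmf (\<lambda>y. x \<otimes>\<^bsub>G\<^esub> y) m)"

definition rho_na :: "('g \<Rightarrow> complex \<Rightarrow> complex^2^2) \<Rightarrow> 'g \<Rightarrow> complex fls^2^2" where
  "rho_na \<rho> g = (\<chi> i j. laurent_expansion (\<lambda>t. \<rho> g t $ i $ j) 0)"

definition na_abs :: "complex fls \<Rightarrow> real" where
  "na_abs f = (if f = 0 then 0 else exp (- real_of_int (fls_subdegree f)))"

definition na_norm :: "complex fls^2^2 \<Rightarrow> real" where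
  "na_norm A = Max ((\<lambda>(i, j). na_abs (A $ i $ j)) ` UNIV)"

definition mtrace2 :: "complex fls^2^2 \<Rightarrow> complex fls" where
  "mtrace2 A = (\<Sum>i\<in>UNIV. A $ i $ i)"

definition proj_pt :: "complex fls^2 \<Rightarrow> (complex fls^2) set" where
  "proj_pt v = {c *s v | c. c \<noteq> 0}"

definition has_finite_orbit :: "(complex fls^2^2) set \<Rightarrow> bool" where
  "has_finite_orbit \<Gamma> \<longleftrightarrow> (\<exists>v. v \<noteq> 0 \<and> finite ((\<lambda>g. proj_pt (g *v v)) ` \<Gamma>))"

definition nonelementary :: "(complex fls^2^2) set \<Rightarrow> bool" where
  "nonelementary \<Gamma> \<longleftrightarrow> (\<exists>g\<in>\<Gamma>. na_abs (mtrace2 g) > 1) \<and> \<not> has_finite_orbit \<Gamma>"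

definition chi :: "('g, 'b) monoid_scheme \<Rightarrow> 'g pmf \<Rightarrow> ('g \<Rightarrow> complex \<Rightarrow> complex^2^2)
                   \<Rightarrow> complex \<Rightarrow> real" where
  "chi G m \<rho> t = lim (\<lambda>n. measure_pmf.expectation (conv_pow G m n) (\<lambda>g. ln (norm (\<rho> g t))) / real n)"

definition chi_na :: "('g, 'b) monoid_scheme \<Rightarrow> 'g pmf \<Rightarrow> ('g \<Rightarrow> complex \<Rightarrow> complex^2^2) \<Rightarrow> real" where
  "chi_na G m \<rho> = lim (\<lambda>n. measure_pmf.expectation (conv_pow G m n) (\<lambda>g. ln (na_norm (rho_na \<rho> g))) / real n)"

end

theory Submission
  imports Defs
begin

text \<open>If all traces of \<open>\<rho>\<^sub>n\<^sub>a(G)\<close> have absolute value at most 1, the identity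
  \<open>gh + hg = tr(g) h + tr(h) g + (tr(gh) - tr(g) tr(h))\<close> shows that the ordered products of the
  generators span the algebra generated by \<open>\<rho>(G)\<close> over the ring generated by finitely many traces,
  which are holomorphic at 0. Hence \<open>\<rho>\<^sub>n\<^sub>a(G)\<close> is bounded, while \<open>log \<parallel>\<rho>\<^sub>t(g)\<parallel>\<close> is at most linear in
  \<open>length(g)\<close> with a slope that does not depend on \<open>t\<close>.

  Otherwise some \<open>g\<close> is hyperbolic, and a finite orbit consists of fixed points of \<open>g\<close>, whose
  eigenvectors are convergent Laurent series. In the eigenbasis all of \<open>\<rho>(G)\<close> is triangular or
  monomial, both over \<open>\<complex>((t))\<close> and for each small \<open>t\<close>. The growth rate is then the absolute value of the
  mean of the additive cocycle given by the logarithm of the diagonal entry (and 0 if the walk swaps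
  the two eigenlines), by the weak law of large numbers. On generators the archimedean cocycle is
  \<open>log |t|\<^sup>-\<^sup>1\<close> times the non-archimedean one up to a bounded error, hence on all \<open>g\<close> up to \<open>O(length(g))\<close>.\<close>

text \<open>The obstacle is uniformity in \<open>t\<close>. An expansion at 0 controls one group
  element on a punctured disk whose radius depends on that element, and no disk need serve all of
  \<open>G\<close>. Information therefore passes between the fibers and \<open>rho_na\<close> only
  through finitely many quantities: traces of generators and of their pairwise products, multipliers
  of generators, and one change of basis. Everything else is propagated along words by algebra valid
  over any field.

  What cannot be made uniform is kept in terms that are constant along the walk. The norms of the
  ordered products and of the conjugating matrices may blow up as \<open>t\<close> tends to 0, but
  for a fixed \<open>t\<close> they shift the logarithm of the norm by a bounded amount, which
  disappears after division by n. This is why growth rates, and never norms, are compared between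
  the two sides.

  In the hyperbolic case the rate is an absolute value, hence not linear in the cocycle; the
  comparison survives because the factor \<open>ln (1 / cmod t)\<close> is nonnegative on the
  punctured disk and can be pulled out.\<close>

no_notation fps_nth (infixl \<open>$\<close> 75)

section \<open>Random walks and subadditive growth\<close>

text \<open>Fekete's lemma. The limit is the infimum of the quotients; the resulting bound by each
  single quotient is what turns an estimate at one fixed time \<open>k\<close> into an estimate of
  the growth rate.\<close>

lemma subadditive_quotient_converges:
  fixes a :: "nat \<Rightarrow> real"
  assumes sub: "\<And>m n. a (m + n) \<le> a m + a n" and nonneg: "\<And>n. 0 \<le> a n"
  obtains l where "(\<lambda>n. a n / real n) \<longlonglongrightarrow> l" "\<And>k. k > 0 \<Longrightarrow> l \<le> a k / real k"
proof -
  define l where "l = (INF k\<in>{0<..}. a k / real k)"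
  have bdd: "bdd_below ((\<lambda>k. a k / real k) ` {0<..})"
    by (rule bdd_belowI2[of _ 0]) (simp add: nonneg)
  have lower: "l \<le> a k / real k" if "k > 0" for k
    unfolding l_def by (rule cINF_lower[OF bdd]) (use that in simp)
  have mult: "a (q * k + r) \<le> real q * a k + a r" for q k r
  proof (induction q)
    case (Suc q)
    have "a (Suc q * k + r) = a (k + (q * k + r))" by (simp add: add.assoc)
    also have "\<dots> \<le> a k + a (q * k + r)" by (rule sub)
    finally show ?case using Suc by (simp add: algebra_simps)
  qed simp
  have "(\<lambda>n. a n / real n) \<longlonglongrightarrow> l"
  proof (rule LIMSEQ_I)
    fix e :: real assume "e > 0"
    have "\<exists>k\<in>{0<..}. a k / real k < l + e / 2"
      using cINF_less_iff[OF _ bdd, of "l + e/2"] \<open>e > 0\<close> unfolding l_def by auto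
    then obtain k where k: "k > 0" "a k / real k < l + e / 2" by auto
    \<comment> \<open>The sum is a convenient common bound for the finitely many possible remainder
      terms \<open>a (n mod k)\<close>.\<close>
    define B where "B = (\<Sum>r<k. a r)"
    have B: "a r \<le> B" if "r < k" for r
      unfolding B_def by (rule member_le_sum) (use that nonneg in auto)
    have "B \<ge> 0" unfolding B_def by (simp add: sum_nonneg nonneg)
    obtain N :: nat where N: "real N > 2 * B / e" using reals_Archimedean2 by blast
    show "\<exists>n0. \<forall>n\<ge>n0. norm (a n / real n - l) < e"
    proof (intro exI[of _ "Suc N"] allI impI)
      fix n assume n: "n \<ge> Suc N"
      hence n0: "real n > 0" by simp
      have "a n = a ((n div k) * k + n mod k)" by simp
      also have "\<dots> \<le> real (n div k) * a k + a (n mod k)" by (rule mult)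
      also have "\<dots> \<le> real (n div k) * a k + B" using B k by simp
      also have "real (n div k) * a k = (real (n div k) * real k) * (a k / real k)" using k by simp
      also have "\<dots> \<le> real n * (a k / real k)"
      proof (rule mult_right_mono)
        have "n div k * k \<le> n" by simp
        thus "real (n div k) * real k \<le> real n" by (metis of_nat_le_iff of_nat_mult)
      qed (simp add: nonneg)
      finally have "a n \<le> real n * (a k / real k) + B" by simp
      hence "a n / real n \<le> a k / real k + B / real n" using n0 by (simp add: field_simps)
      moreover have "B / real n < e / 2"
      proof -
        have "2 * B / e < real n" using N n by linarith
        thus ?thesis using \<open>e > 0\<close> n0 by (simp add: field_simps)
      qed
      ultimately have "a n / real n < l + e" using k by linarith
      moreover have "l \<le> a n / real n" using lower n by simp
      ultimately show "norm (a n / real n - l) < e" by simp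
    qed
  qed
  thus thesis using that lower by blast
qed

lemma integrable_pmf_bound:
  fixes f g :: "'a \<Rightarrow> real"
  assumes "integrable (measure_pmf p) g" "\<And>x. x \<in> set_pmf p \<Longrightarrow> \<bar>f x\<bar> \<le> g x"
  shows "integrable (measure_pmf p) f"
  by (rule Bochner_Integration.integrable_bound[OF assms(1)])
     (use assms(2) in \<open>force simp: AE_measure_pmf_iff\<close>)+

lemma integral_pmf_mono:
  fixes f g :: "'a \<Rightarrow> real"
  assumes "integrable (measure_pmf p) f" "integrable (measure_pmf p) g"
    "\<And>x. x \<in> set_pmf p \<Longrightarrow> f x \<le> g x"
  shows "measure_pmf.expectation p f \<le> measure_pmf.expectation p g"
  by (rule integral_mono_AE) (use assms in \<open>auto simp: AE_measure_pmf_iff\<close>)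

lemma integral_pmf_cong:
  fixes f g :: "'a \<Rightarrow> real"
  assumes "\<And>x. x \<in> set_pmf p \<Longrightarrow> f x = g x"
  shows "measure_pmf.expectation p f = measure_pmf.expectation p g"
  by (rule integral_cong_AE) (use assms in \<open>auto simp: AE_measure_pmf_iff\<close>)

lemma integrable_pair_pmf_fst:
  fixes f :: "'a \<Rightarrow> real"
  assumes "integrable (measure_pmf p) f"
  shows "integrable (measure_pmf (pair_pmf p q)) (\<lambda>x. f (fst x))"
  using assms integrable_map_pmf_eq[of fst "pair_pmf p q" f] by (simp add: map_fst_pair_pmf)

lemma integrable_pair_pmf_snd:
  fixes f :: "'b \<Rightarrow> real"
  assumes "integrable (measure_pmf q) f"
  shows "integrable (measure_pmf (pair_pmf p q)) (\<lambda>x. f (snd x))"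
  using assms integrable_map_pmf_eq[of snd "pair_pmf p q" f] by (simp add: map_snd_pair_pmf)

lemma expectation_pair_pmf_mult_nonneg:
  fixes f :: "'a \<Rightarrow> real" and g :: "'b \<Rightarrow> real"
  assumes f: "integrable (measure_pmf p) f" and g: "integrable (measure_pmf q) g"
    and "\<And>x. 0 \<le> f x" "\<And>y. 0 \<le> g y"
  shows "has_bochner_integral (measure_pmf (pair_pmf p q)) (\<lambda>z. f (fst z) * g (snd z))
           (measure_pmf.expectation p f * measure_pmf.expectation q g)"
proof (rule has_bochner_integral_nn_integral)
  have "(\<integral>\<^sup>+z. ennreal (f (fst z) * g (snd z)) \<partial>measure_pmf (pair_pmf p q))
      = (\<integral>\<^sup>+x. \<integral>\<^sup>+y. ennreal (f x) * ennreal (g y) \<partial>measure_pmf q \<partial>measure_pmf p)"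
    by (simp add: nn_integral_pair_pmf' ennreal_mult assms)
  also have "\<dots> = (\<integral>\<^sup>+x. ennreal (f x) \<partial>measure_pmf p) * (\<integral>\<^sup>+y. ennreal (g y) \<partial>measure_pmf q)"
    by (simp add: nn_integral_cmult nn_integral_multc)
  also have "\<dots> = ennreal (measure_pmf.expectation p f) * ennreal (measure_pmf.expectation q g)"
    using f g assms by (simp add: nn_integral_eq_integral)
  also have "\<dots> = ennreal (measure_pmf.expectation p f * measure_pmf.expectation q g)"
    by (simp add: ennreal_mult assms integral_nonneg)
  finally show "(\<integral>\<^sup>+z. ennreal (f (fst z) * g (snd z)) \<partial>measure_pmf (pair_pmf p q))
      = ennreal (measure_pmf.expectation p f * measure_pmf.expectation q g)" .
qed (use assms in \<open>auto intro!: mult_nonneg_nonneg integral_nonneg\<close>)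

text \<open>Splitting both factors into positive and negative parts reduces this to Tonelli. It
  expresses the independence of the next step from the past and gives integrability of the product
  along with its mean.\<close>

lemma expectation_pair_pmf_mult:
  fixes f :: "'a \<Rightarrow> real" and g :: "'b \<Rightarrow> real"
  assumes f: "integrable (measure_pmf p) f" and g: "integrable (measure_pmf q) g"
  shows "has_bochner_integral (measure_pmf (pair_pmf p q)) (\<lambda>z. f (fst z) * g (snd z))
           (measure_pmf.expectation p f * measure_pmf.expectation q g)"
proof -
  define fp where "fp = (\<lambda>x. max (f x) 0)"
  define fn where "fn = (\<lambda>x. max (- f x) 0)"
  define gp where "gp = (\<lambda>x. max (g x) 0)"
  define gn where "gn = (\<lambda>x. max (- g x) 0)"
  note defs = fp_def fn_def gp_def gn_def
  have i: "integrable (measure_pmf p) fp" "integrable (measure_pmf p) fn"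
    "integrable (measure_pmf q) gp" "integrable (measure_pmf q) gn"
    unfolding defs using f g by auto
  have nn: "0 \<le> fp x" "0 \<le> fn x" "0 \<le> gp y" "0 \<le> gn y" for x y unfolding defs by auto
  have fg: "f = (\<lambda>x. fp x - fn x)" "g = (\<lambda>y. gp y - gn y)" unfolding defs by auto
  have "has_bochner_integral (measure_pmf (pair_pmf p q))
     (\<lambda>z. ((fp (fst z) * gp (snd z)) - (fp (fst z) * gn (snd z)))
        - ((fn (fst z) * gp (snd z)) - (fn (fst z) * gn (snd z))))
     (((measure_pmf.expectation p fp * measure_pmf.expectation q gp)
      - (measure_pmf.expectation p fp * measure_pmf.expectation q gn))
      - ((measure_pmf.expectation p fn * measure_pmf.expectation q gp)
      - (measure_pmf.expectation p fn * measure_pmf.expectation q gn)))"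
    by (intro has_bochner_integral_diff expectation_pair_pmf_mult_nonneg i nn)
  thus ?thesis unfolding fg using i by (simp add: algebra_simps)
qed

section \<open>Random walks on a group with an integrable subadditive length\<close>

locale random_walk = group G for G (structure) +
  fixes m :: "'a pmf" and len :: "'a \<Rightarrow> real"
  assumes set_step: "set_pmf m \<subseteq> carrier G"
    and len_nonneg: "0 \<le> len x"
    and len_one: "len \<one> = 0"
    and len_mult: "x \<in> carrier G \<Longrightarrow> y \<in> carrier G \<Longrightarrow> len (x \<otimes> y) \<le> len x + len y"
    and integrable_len_step: "integrable (measure_pmf m) len"
begin

abbreviation walk :: "nat \<Rightarrow> 'a pmf" where "walk \<equiv> conv_pow G m"

lemma set_walk: "set_pmf (walk n) \<subseteq> carrier G"
  using set_step by (induction n) auto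

lemma in_walk: "x \<in> set_pmf (walk n) \<Longrightarrow> x \<in> carrier G"
  using set_walk by blast

lemma in_step: "x \<in> set_pmf m \<Longrightarrow> x \<in> carrier G"
  using set_step by blast

lemma walk_Suc: "walk (Suc n) = map_pmf (\<lambda>z. fst z \<otimes> snd z) (pair_pmf (walk n) m)"
  by (simp add: pair_pmf_def map_pmf_def bind_assoc_pmf bind_return_pmf)

text \<open>\<open>conv_pow\<close> appends one step on the right, so splitting at an arbitrary time
  is associativity of convolution. Associativity of the group law holds on the carrier only, hence
  the passage through the supports.\<close>

lemma walk_add: "walk (n + k) = map_pmf (\<lambda>z. fst z \<otimes> snd z) (pair_pmf (walk n) (walk k))"
proof (induction k)
  case 0
  have "map_pmf (\<lambda>x. x \<otimes> \<one>) (walk n) = map_pmf id (walk n)"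
    by (rule map_pmf_cong) (auto dest: in_walk)
  thus ?case by (simp add: pair_return_pmf2 map_pmf_comp)
next
  case (Suc k)
  have "walk (n + Suc k) = map_pmf (\<lambda>z. fst z \<otimes> snd z)
      (pair_pmf (map_pmf (\<lambda>z. fst z \<otimes> snd z) (pair_pmf (walk n) (walk k))) m)"
    using Suc by (simp add: walk_Suc del: conv_pow.simps)
  also have "\<dots> = bind_pmf (walk n) (\<lambda>x. bind_pmf (walk k) (\<lambda>y. bind_pmf m (\<lambda>z. return_pmf ((x \<otimes> y) \<otimes> z))))"
    by (simp add: pair_pmf_def map_pmf_def bind_assoc_pmf bind_return_pmf)
  also have "\<dots> = bind_pmf (walk n) (\<lambda>x. bind_pmf (walk k) (\<lambda>y. bind_pmf m (\<lambda>z. return_pmf (x \<otimes> (y \<otimes> z)))))"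
    by (intro bind_pmf_cong refl) (auto simp: m_assoc in_walk in_step)
  also have "\<dots> = map_pmf (\<lambda>z. fst z \<otimes> snd z) (pair_pmf (walk n) (walk (Suc k)))"
    by (simp add: pair_pmf_def map_pmf_def bind_assoc_pmf bind_return_pmf)
  finally show ?case .
qed

lemma integrable_walk_Suc:
  fixes u v :: "'a \<Rightarrow> real"
  assumes "integrable (measure_pmf (walk n)) v" "integrable (measure_pmf m) w"
    and "\<And>x y. x \<in> set_pmf (walk n) \<Longrightarrow> y \<in> set_pmf m \<Longrightarrow> \<bar>u (x \<otimes> y)\<bar> \<le> v x + w y"
  shows "integrable (measure_pmf (walk (Suc n))) u"
  unfolding walk_Suc integrable_map_pmf_eq
  by (rule integrable_pmf_bound[where g = "\<lambda>z. v (fst z) + w (snd z)"])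
     (use assms in \<open>auto intro!: Bochner_Integration.integrable_add integrable_pair_pmf_fst integrable_pair_pmf_snd\<close>)

lemma integrable_len: "integrable (measure_pmf (walk n)) len"
proof (induction n)
  case (Suc n)
  show ?case
    by (rule integrable_walk_Suc[OF Suc integrable_len_step])
       (use len_nonneg len_mult in_walk in_step in auto)
qed (simp add: integrable_measure_pmf_finite)

lemma integrable_linear_bound:
  fixes u :: "'a \<Rightarrow> real"
  assumes "\<And>x. x \<in> carrier G \<Longrightarrow> \<bar>u x\<bar> \<le> c + C * len x"
  shows "integrable (measure_pmf (walk n)) u"
  by (rule integrable_pmf_bound[where g = "\<lambda>x. c + C * len x"])
     (use assms in_walk integrable_len in auto)

lemma expectation_almost_subadditive:
  fixes u :: "'a \<Rightarrow> real"
  assumes int: "\<And>n. integrable (measure_pmf (walk n)) u"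
    and sub: "\<And>x y. x \<in> carrier G \<Longrightarrow> y \<in> carrier G \<Longrightarrow> u (x \<otimes> y) \<le> u x + u y + c"
  shows "measure_pmf.expectation (walk (n + k)) u
      \<le> measure_pmf.expectation (walk n) u + measure_pmf.expectation (walk k) u + c"
proof -
  let ?P = "pair_pmf (walk n) (walk k)"
  have i: "integrable (measure_pmf ?P) (\<lambda>z. u (fst z))" "integrable (measure_pmf ?P) (\<lambda>z. u (snd z))"
    by (intro integrable_pair_pmf_fst integrable_pair_pmf_snd int)+
  have "measure_pmf.expectation (walk (n + k)) u = measure_pmf.expectation ?P (\<lambda>z. u (fst z \<otimes> snd z))"
    by (simp add: walk_add)
  also have "\<dots> \<le> measure_pmf.expectation ?P (\<lambda>z. u (fst z) + u (snd z) + c)"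
  proof (rule integral_pmf_mono)
    show "integrable (measure_pmf ?P) (\<lambda>z. u (fst z \<otimes> snd z))"
      using int[of "n + k"] by (simp add: walk_add)
  qed (use i sub in_walk in auto)
  also have "\<dots> = measure_pmf.expectation (walk n) u + measure_pmf.expectation (walk k) u + c"
    using i by simp
  finally show ?thesis .
qed

text \<open>The shifted function \<open>u + c\<close> is nonnegative and exactly subadditive, so
  Fekete's lemma applies to its means, and \<open>c / real n\<close> tends to 0.\<close>

lemma subadditive_growth_converges:
  fixes u :: "'a \<Rightarrow> real"
  assumes int: "\<And>n. integrable (measure_pmf (walk n)) u"
    and sub: "\<And>x y. x \<in> carrier G \<Longrightarrow> y \<in> carrier G \<Longrightarrow> u (x \<otimes> y) \<le> u x + u y + c"
    and nonneg: "\<And>x. x \<in> carrier G \<Longrightarrow> 0 \<le> u x + c"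
  obtains l where "(\<lambda>n. measure_pmf.expectation (walk n) u / real n) \<longlonglongrightarrow> l"
    "\<And>k. k > 0 \<Longrightarrow> l \<le> (measure_pmf.expectation (walk k) u + c) / real k"
proof -
  define a where "a n = measure_pmf.expectation (walk n) u + c" for n
  have a: "a n = measure_pmf.expectation (walk n) (\<lambda>x. u x + c)" for n
    unfolding a_def using int by simp
  have "0 \<le> a n" for n
    unfolding a by (rule integral_nonneg_AE) (use nonneg in_walk in \<open>auto simp: AE_measure_pmf_iff\<close>)
  moreover have "a (n + k) \<le> a n + a k" for n k
    unfolding a_def using expectation_almost_subadditive[OF int sub, of n k] by simp
  ultimately obtain l where l: "(\<lambda>n. a n / real n) \<longlonglongrightarrow> l" "\<And>k. k > 0 \<Longrightarrow> l \<le> a k / real k"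
    using subadditive_quotient_converges by metis
  have "(\<lambda>n. a n / real n - c / real n) \<longlonglongrightarrow> l - 0"
    by (intro tendsto_diff l lim_const_over_n)
  hence "(\<lambda>n. measure_pmf.expectation (walk n) u / real n) \<longlonglongrightarrow> l"
    by (simp add: a_def add_divide_distrib)
  with l(2) show thesis using that unfolding a_def by blast
qed

lemma expectation_len_le:
  "measure_pmf.expectation (walk n) len \<le> real n * measure_pmf.expectation m len"
proof (induction n)
  case (Suc n)
  have "walk 1 = map_pmf (\<lambda>y. y) m"
    unfolding One_nat_def conv_pow.simps bind_return_pmf
    by (rule map_pmf_cong) (auto dest: in_step)
  hence "walk 1 = m" by simp
  thus ?case
    using expectation_almost_subadditive[of len 0 n 1] integrable_len len_mult Suc
    by (simp add: algebra_simps)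
qed (simp add: len_one)

text \<open>This absorbs every non-uniform constant of the proof: a change of norm, a change of
  basis, a rescaled off-diagonal entry, or a bounded coboundary.\<close>

lemma growth_bounded_difference:
  fixes u v :: "'a \<Rightarrow> real"
  assumes int: "\<And>n. integrable (measure_pmf (walk n)) u"
    and diff: "\<And>x. x \<in> carrier G \<Longrightarrow> \<bar>u x - v x\<bar> \<le> c"
    and lim: "(\<lambda>n. measure_pmf.expectation (walk n) u / real n) \<longlonglongrightarrow> l"
  shows "(\<lambda>n. measure_pmf.expectation (walk n) v / real n) \<longlonglongrightarrow> l"
proof -
  have iv: "integrable (measure_pmf (walk n)) v" for n
    by (rule integrable_pmf_bound[where g = "\<lambda>x. \<bar>u x\<bar> + c"])
       (use int[of n] in \<open>auto dest!: in_walk diff\<close>)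
  have "\<bar>measure_pmf.expectation (walk n) v - measure_pmf.expectation (walk n) u\<bar> \<le> c" for n
  proof -
    have "\<bar>measure_pmf.expectation (walk n) v - measure_pmf.expectation (walk n) u\<bar>
        = \<bar>measure_pmf.expectation (walk n) (\<lambda>x. v x - u x)\<bar>"
      using iv int by simp
    also have "\<dots> \<le> measure_pmf.expectation (walk n) (\<lambda>x. \<bar>v x - u x\<bar>)" by (rule integral_abs_bound)
    also have "\<dots> \<le> measure_pmf.expectation (walk n) (\<lambda>x. c)"
      by (rule integral_pmf_mono) (use iv int in \<open>auto dest!: in_walk diff\<close>)
    finally show ?thesis by simp
  qed
  hence "\<forall>\<^sub>F n in sequentially. norm (measure_pmf.expectation (walk n) v / real n
      - measure_pmf.expectation (walk n) u / real n) \<le> c / real n"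
    by (intro eventually_sequentiallyI[of 1]) (simp add: diff_divide_distrib[symmetric] divide_right_mono)
  from Lim_null_comparison[OF this lim_const_over_n]
  have "(\<lambda>n. (measure_pmf.expectation (walk n) v / real n - measure_pmf.expectation (walk n) u / real n)
      + measure_pmf.expectation (walk n) u / real n) \<longlonglongrightarrow> 0 + l"
    by (intro tendsto_add lim)
  thus ?thesis by simp
qed

end

section \<open>Weak law of large numbers for additive cocycles\<close>

text \<open>The linear term of the Taylor estimate for this smoothing of \<open>|x|\<close> vanishes on average for a
  centered step, so the weak law needs neither truncation nor second moments.\<close>

definition smooth_abs :: "real \<Rightarrow> real \<Rightarrow> real" where
  "smooth_abs T x = sqrt (T\<^sup>2 + x\<^sup>2)"

lemma smooth_abs_ge: "\<bar>x\<bar> \<le> smooth_abs T x"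
  unfolding smooth_abs_def by (rule real_le_rsqrt) simp

text \<open>With \<open>s = smooth_abs T a\<close>, the slope \<open>a / s\<close> is the derivative
  at \<open>a\<close>. The function is 1-Lipschitz, which costs \<open>2 * \<bar>b\<bar>\<close>
  including the linear term; the tangent bound for the square root at \<open>s\<^sup>2\<close>,
  together with \<open>s \<ge> T\<close>, gives the quadratic error. The minimum is useful because
  the first bound is integrable when \<open>b\<close> is, while the second tends to 0 as
  \<open>T\<close> grows.\<close>

lemma smooth_abs_taylor:
  assumes "T > 0"
  shows "smooth_abs T (a + b)
    \<le> smooth_abs T a + a / smooth_abs T a * b + min (2 * \<bar>b\<bar>) (b\<^sup>2 / (2 * T))"
proof -
  define s where "s = smooth_abs T a"
  have s: "s > 0" "s \<ge> T" "s\<^sup>2 = T\<^sup>2 + a\<^sup>2" "\<bar>a\<bar> \<le> s"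
    using assms smooth_abs_ge[of a T] unfolding s_def smooth_abs_def
    by (auto intro: add_pos_nonneg real_le_rsqrt)
  have "\<bar>a / s\<bar> \<le> 1" using s by (simp add: abs_divide)
  hence "\<bar>a / s * b\<bar> \<le> \<bar>b\<bar>" using mult_right_mono[of "\<bar>a / s\<bar>" 1 "\<bar>b\<bar>"] by (simp add: abs_mult)
  moreover have "smooth_abs T (a + b) \<le> s + \<bar>b\<bar>"
    unfolding smooth_abs_def
  proof (rule real_le_lsqrt)
    have "a * b \<le> s * \<bar>b\<bar>" using s mult_right_mono[of "\<bar>a\<bar>" s "\<bar>b\<bar>"]
      by (metis abs_ge_self abs_ge_zero abs_mult order_trans)
    thus "T\<^sup>2 + (a + b)\<^sup>2 \<le> (s + \<bar>b\<bar>)\<^sup>2" using s by (simp add: power2_sum)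
  qed (use s in simp)
  ultimately have 1: "smooth_abs T (a + b) \<le> s + a / s * b + 2 * \<bar>b\<bar>" by linarith
  have "smooth_abs T (a + b) \<le> s + (2 * a * b + b\<^sup>2) / (2 * s)"
    unfolding smooth_abs_def
  proof (rule real_le_lsqrt)
    have "s + (2 * a * b + b\<^sup>2) / (2 * s) = (s\<^sup>2 + (s\<^sup>2 + (2 * a * b + b\<^sup>2))) / (2 * s)"
      using s by (simp add: field_simps power2_eq_square)
    also have "s\<^sup>2 + (2 * a * b + b\<^sup>2) = T\<^sup>2 + (a + b)\<^sup>2" using s by (simp add: power2_sum)
    finally show "0 \<le> s + (2 * a * b + b\<^sup>2) / (2 * s)" using s by simp
    have "(s + (2 * a * b + b\<^sup>2) / (2 * s))\<^sup>2 = s\<^sup>2 + (2 * a * b + b\<^sup>2) + ((2 * a * b + b\<^sup>2) / (2 * s))\<^sup>2"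
      using s by (simp add: power2_sum)
    thus "T\<^sup>2 + (a + b)\<^sup>2 \<le> (s + (2 * a * b + b\<^sup>2) / (2 * s))\<^sup>2"
      using s by (simp add: power2_sum)
  qed
  also have "\<dots> = s + a / s * b + b\<^sup>2 / (2 * s)" using s by (simp add: field_simps)
  also have "b\<^sup>2 / (2 * s) \<le> b\<^sup>2 / (2 * T)"
    using s assms by (intro divide_left_mono) auto
  finally have "smooth_abs T (a + b) \<le> s + a / s * b + b\<^sup>2 / (2 * T)" by simp
  with 1 show ?thesis unfolding s_def by simp
qed

context random_walk
begin

text \<open>Along the walk \<open>F\<close> is a martingale: the sign \<open>\<sigma> x\<close>
  depends on the past only and the step is centered. So the mean of
  \<open>smooth_abs T (F n)\<close> increases by at most the mean Taylor error per step, and that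
  error is arbitrarily small for large \<open>T\<close>. \<open>F\<close> may depend on the time
  because one application subtracts n times the mean of the cocycle.\<close>

lemma centered_growth_zero:
  fixes F :: "nat \<Rightarrow> 'a \<Rightarrow> real" and h :: "'a \<Rightarrow> real"
  assumes h: "integrable (measure_pmf m) h" "measure_pmf.expectation m h = 0"
    and F0: "F 0 \<one> = 0"
    and FSuc: "\<And>n x y. x \<in> set_pmf (walk n) \<Longrightarrow> y \<in> set_pmf m \<Longrightarrow>
        F (Suc n) (x \<otimes> y) = F n x + \<sigma> x * h y"
    and \<sigma>: "\<And>x. x \<in> carrier G \<Longrightarrow> \<bar>\<sigma> x\<bar> = 1"
  shows "\<And>n. integrable (measure_pmf (walk n)) (F n)"
    and "(\<lambda>n. measure_pmf.expectation (walk n) (\<lambda>x. \<bar>F n x\<bar>) / real n) \<longlonglongrightarrow> 0"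
proof -
  have \<sigma>le: "\<bar>\<sigma> x * y\<bar> = \<bar>y\<bar>" if "x \<in> set_pmf (walk n)" for n x y
    using \<sigma>[OF in_walk[OF that]] by (simp add: abs_mult)
  show int: "integrable (measure_pmf (walk n)) (F n)" for n
  proof (induction n)
    case (Suc n)
    have "integrable (measure_pmf (walk n)) (\<lambda>x. \<bar>F n x\<bar>)" "integrable (measure_pmf m) (\<lambda>x. \<bar>h x\<bar>)"
      using Suc h by auto
    thus ?case
    proof (rule integrable_walk_Suc)
      fix x y assume "x \<in> set_pmf (walk n)" "y \<in> set_pmf m"
      thus "\<bar>F (Suc n) (x \<otimes> y)\<bar> \<le> \<bar>F n x\<bar> + \<bar>h y\<bar>"
        using FSuc \<sigma>le abs_triangle_ineq by metis
    qed
  qed (simp add: integrable_measure_pmf_finite)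
  define \<psi> where "\<psi> T y = min (2 * \<bar>h y\<bar>) ((h y)\<^sup>2 / (2 * T))" for T y
  have \<psi>_int: "integrable (measure_pmf m) (\<psi> T)" if "T > 0" for T
    by (rule integrable_pmf_bound[where g = "\<lambda>y. 2 * \<bar>h y\<bar>"]) (use h that in \<open>auto simp: \<psi>_def\<close>)
  have sa_int: "integrable (measure_pmf (walk n)) (\<lambda>x. smooth_abs T (F n x))" if "T > 0" for n T
  proof (rule integrable_pmf_bound)
    show "integrable (measure_pmf (walk n)) (\<lambda>x. T + \<bar>F n x\<bar>)" using int by simp
    fix x
    show "\<bar>smooth_abs T (F n x)\<bar> \<le> T + \<bar>F n x\<bar>"
      unfolding smooth_abs_def using that by (auto intro!: real_le_lsqrt simp: power2_sum)
  qed
  have step: "measure_pmf.expectation (walk n) (\<lambda>x. smooth_abs T (F n x))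
      \<le> T + real n * measure_pmf.expectation m (\<psi> T)" if T: "T > 0" for T n
  proof (induction n)
    case 0
    thus ?case using F0 T by (simp add: smooth_abs_def)
  next
    case (Suc n)
    let ?P = "pair_pmf (walk n) m"
    \<comment> \<open>Slope times sign, a function of the past bounded by 1; its product with the
      independent centered step has mean 0.\<close>
    define a where "a x = F n x / smooth_abs T (F n x) * \<sigma> x" for x
    have "\<bar>a x\<bar> \<le> 1" if "x \<in> set_pmf (walk n)" for x
    proof -
      have "smooth_abs T (F n x) > 0" using T unfolding smooth_abs_def by (simp add: add_pos_nonneg)
      thus ?thesis using \<sigma>[OF in_walk[OF that]] smooth_abs_ge[of "F n x" T]
        by (simp add: a_def abs_mult abs_divide)
    qed
    hence a: "integrable (measure_pmf (walk n)) a"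
      using integrable_pmf_bound[of "walk n" "\<lambda>_. 1" a] by simp
    have prod: "has_bochner_integral (measure_pmf ?P) (\<lambda>z. a (fst z) * h (snd z)) 0"
      using expectation_pair_pmf_mult[OF a h(1)] h(2) by simp
    note i = integrable_pair_pmf_fst[OF sa_int[OF T, of n], of m]
      integrable_pair_pmf_snd[OF \<psi>_int[OF T], of "walk n"] integrable.intros[OF prod]
    have "measure_pmf.expectation (walk (Suc n)) (\<lambda>x. smooth_abs T (F (Suc n) x))
        = measure_pmf.expectation ?P (\<lambda>z. smooth_abs T (F (Suc n) (fst z \<otimes> snd z)))"
      by (simp add: walk_Suc del: conv_pow.simps)
    also have "\<dots> \<le> measure_pmf.expectation ?P
        (\<lambda>z. smooth_abs T (F n (fst z)) + a (fst z) * h (snd z) + \<psi> T (snd z))"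
    proof (rule integral_pmf_mono)
      show "integrable (measure_pmf ?P) (\<lambda>z. smooth_abs T (F (Suc n) (fst z \<otimes> snd z)))"
        using sa_int[OF T, of "Suc n"] by (simp add: walk_Suc del: conv_pow.simps)
      show "integrable (measure_pmf ?P)
          (\<lambda>z. smooth_abs T (F n (fst z)) + a (fst z) * h (snd z) + \<psi> T (snd z))"
        using i by simp
      fix z assume "z \<in> set_pmf ?P"
      then obtain x y where z: "z = (x, y)" "x \<in> set_pmf (walk n)" "y \<in> set_pmf m" by auto
      have "\<bar>\<sigma> x * h y\<bar> = \<bar>h y\<bar>" using \<sigma>le z by blast
      moreover from this have "(\<sigma> x * h y)\<^sup>2 = (h y)\<^sup>2" by (metis power2_abs)
      ultimately show "smooth_abs T (F (Suc n) (fst z \<otimes> snd z))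
          \<le> smooth_abs T (F n (fst z)) + a (fst z) * h (snd z) + \<psi> T (snd z)"
        using smooth_abs_taylor[OF T, of "F n x" "\<sigma> x * h y"] FSuc z
        by (simp add: a_def \<psi>_def mult.assoc)
    qed
    also have "\<dots> = measure_pmf.expectation (walk n) (\<lambda>x. smooth_abs T (F n x))
        + measure_pmf.expectation m (\<psi> T)"
      using i has_bochner_integral_integral_eq[OF prod] 
      by (simp add: expectation_pair_pmf_fst[of "walk n" m "\<lambda>x. smooth_abs T (F n x)"])
    finally show ?case using Suc by (simp add: algebra_simps)
  qed
  \<comment> \<open>The mean Taylor error vanishes as \<open>T\<close> tends to infinity: pointwise
    by the quadratic bound, and dominated by the Lipschitz bound.\<close>
  have \<psi>_lim: "(\<lambda>k. measure_pmf.expectation m (\<psi> (real (Suc k)))) \<longlonglongrightarrow> measure_pmf.expectation m (\<lambda>_. 0)"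
  proof (rule integral_dominated_convergence[where w = "\<lambda>y. 2 * \<bar>h y\<bar>"])
    show "AE y in measure_pmf m. (\<lambda>k. \<psi> (real (Suc k)) y) \<longlonglongrightarrow> 0"
    proof (rule AE_I2)
      fix y
      have "(\<lambda>k. (h y)\<^sup>2 / 2 * (1 / real (Suc k))) \<longlonglongrightarrow> (h y)\<^sup>2 / 2 * 0"
        by (intro tendsto_mult tendsto_const LIMSEQ_Suc lim_1_over_n)
      hence "(\<lambda>k. (h y)\<^sup>2 / (2 * real (Suc k))) \<longlonglongrightarrow> 0" by simp
      from tendsto_min[OF tendsto_const this, of "2 * \<bar>h y\<bar>"]
      show "(\<lambda>k. \<psi> (real (Suc k)) y) \<longlonglongrightarrow> 0" unfolding \<psi>_def by simp
    qed
    show "AE y in measure_pmf m. norm (\<psi> (real (Suc k)) y) \<le> 2 * \<bar>h y\<bar>" for k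
      by (rule AE_I2) (simp add: \<psi>_def)
  qed (use h in auto)
  show "(\<lambda>n. measure_pmf.expectation (walk n) (\<lambda>x. \<bar>F n x\<bar>) / real n) \<longlonglongrightarrow> 0"
  proof (rule LIMSEQ_I)
    fix e :: real assume "e > 0"
    from order_tendstoD(2)[OF \<psi>_lim, of "e/2"] \<open>e > 0\<close>
    obtain k where k: "measure_pmf.expectation m (\<psi> (real (Suc k))) < e / 2"
      by (auto simp: eventually_sequentially)
    \<comment> \<open>\<open>T\<close> is fixed first, making the error per step less than
      \<open>e / 2\<close>; afterwards n must outgrow the initial value \<open>T\<close> of the
      smoothed function.\<close>
    define T where "T = real (Suc k)"
    have T: "T > 0" unfolding T_def by simp
    obtain N :: nat where N: "real N > 2 * T / e" using reals_Archimedean2 by blast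
    show "\<exists>n0. \<forall>n\<ge>n0. norm (measure_pmf.expectation (walk n) (\<lambda>x. \<bar>F n x\<bar>) / real n - 0) < e"
    proof (intro exI[of _ "Suc N"] allI impI)
      fix n assume n: "n \<ge> Suc N"
      hence n0: "real n > 0" by simp
      have "measure_pmf.expectation (walk n) (\<lambda>x. \<bar>F n x\<bar>)
          \<le> measure_pmf.expectation (walk n) (\<lambda>x. smooth_abs T (F n x))"
        by (rule integral_pmf_mono) (use int sa_int T smooth_abs_ge in auto)
      also have "\<dots> \<le> T + real n * measure_pmf.expectation m (\<psi> T)" by (rule step[OF T])
      also have "\<dots> \<le> T + real n * (e / 2)"
        using k n0 unfolding T_def[symmetric] by (intro add_left_mono mult_left_mono) auto
      also have "T < real n * (e / 2)"
      proof -
        have "2 * T / e < real n" using N n by linarith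
        thus ?thesis using \<open>e > 0\<close> by (simp add: field_simps)
      qed
      finally have "measure_pmf.expectation (walk n) (\<lambda>x. \<bar>F n x\<bar>) < real n * e" by (simp add: mult.commute)
      moreover have "measure_pmf.expectation (walk n) (\<lambda>x. \<bar>F n x\<bar>) \<ge> 0" by simp
      ultimately show "norm (measure_pmf.expectation (walk n) (\<lambda>x. \<bar>F n x\<bar>) / real n - 0) < e"
        using n0 by (simp add: field_simps)
    qed
  qed
qed

text \<open>The function \<open>f\<close> is a cocycle twisted by the sign character
  \<open>\<epsilon>\<close>. If all steps have sign 1, it is additive along the walk and the weak
  law gives the absolute value of the mean. If a step of sign -1 occurs, the mean can be removed by
  a bounded coboundary, so the rate is 0 whatever the mean of \<open>f\<close> is.\<close>

lemma cocycle_growth: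
  fixes f :: "'a \<Rightarrow> real"
  assumes \<epsilon>: "\<And>x. x \<in> carrier G \<Longrightarrow> \<epsilon> x = 1 \<or> \<epsilon> x = (-1::real)"
    and \<epsilon>_mult: "\<And>x y. x \<in> carrier G \<Longrightarrow> y \<in> carrier G \<Longrightarrow> \<epsilon> (x \<otimes> y) = \<epsilon> x * \<epsilon> y"
    and f_mult: "\<And>x y. x \<in> carrier G \<Longrightarrow> y \<in> carrier G \<Longrightarrow> f (x \<otimes> y) = f x + \<epsilon> x * f y"
    and int: "integrable (measure_pmf m) f"
  shows "\<And>n. integrable (measure_pmf (walk n)) f"
    and "(\<lambda>n. measure_pmf.expectation (walk n) (\<lambda>x. \<bar>f x\<bar>) / real n)
      \<longlonglongrightarrow> (if \<forall>x\<in>set_pmf m. \<epsilon> x = 1 then \<bar>measure_pmf.expectation m f\<bar> else 0)"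
proof -
  have "\<epsilon> \<one> * \<epsilon> \<one> = \<epsilon> \<one>" using \<epsilon>_mult[of \<one> \<one>] by simp
  hence \<epsilon>1: "\<epsilon> \<one> = 1" using \<epsilon>[of \<one>] by auto
  have f1: "f \<one> = 0" using f_mult[of \<one> \<one>] \<epsilon>1 by simp
  show ints: "integrable (measure_pmf (walk n)) f" for n
  proof (induction n)
    case (Suc n)
    have "integrable (measure_pmf (walk n)) (\<lambda>x. \<bar>f x\<bar>)" "integrable (measure_pmf m) (\<lambda>x. \<bar>f x\<bar>)"
      using Suc int by auto
    thus ?case
    proof (rule integrable_walk_Suc)
      fix x y assume "x \<in> set_pmf (walk n)" "y \<in> set_pmf m"
      hence "x \<in> carrier G" "y \<in> carrier G" using in_walk in_step by auto
      thus "\<bar>f (x \<otimes> y)\<bar> \<le> \<bar>f x\<bar> + \<bar>f y\<bar>" using f_mult[of x y] \<epsilon>[of x] by auto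
    qed
  qed (simp add: integrable_measure_pmf_finite)
  let ?\<mu> = "measure_pmf.expectation m f"
  show "(\<lambda>n. measure_pmf.expectation (walk n) (\<lambda>x. \<bar>f x\<bar>) / real n)
      \<longlonglongrightarrow> (if \<forall>x\<in>set_pmf m. \<epsilon> x = 1 then \<bar>?\<mu>\<bar> else 0)"
  proof (cases "\<forall>x\<in>set_pmf m. \<epsilon> x = 1")
    case True
    have walk1: "\<epsilon> x = 1" if "x \<in> set_pmf (walk n)" for n x
      using that
    proof (induction n arbitrary: x)
      case (Suc n)
      then obtain y z where "x = y \<otimes> z" "y \<in> set_pmf (walk n)" "z \<in> set_pmf m" by auto
      thus ?case using \<epsilon>_mult[of y z] in_walk[of y n] in_step[of z] Suc.IH[of y] True by simp
    qed (simp add: \<epsilon>1)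
    \<comment> \<open>Subtracting the expected displacement leaves increments
      \<open>f y - ?\<mu>\<close>, which are centered; all signs met along the walk are 1.\<close>
    define F where "F n x = f x - real n * ?\<mu>" for n :: nat and x
    have iF: "integrable (measure_pmf (walk n)) (F n)" for n
      unfolding F_def using ints by simp
    have lim: "(\<lambda>n. measure_pmf.expectation (walk n) (\<lambda>x. \<bar>F n x\<bar>) / real n) \<longlonglongrightarrow> 0"
    proof (rule centered_growth_zero(2)[where h = "\<lambda>y. f y - ?\<mu>" and \<sigma> = "\<lambda>_. 1"])
      fix n x y assume "x \<in> set_pmf (walk n)" "y \<in> set_pmf m"
      thus "F (Suc n) (x \<otimes> y) = F n x + 1 * (f y - ?\<mu>)"
        using f_mult[of x y] walk1[of x n] in_walk[of x n] in_step[of y] by (simp add: F_def algebra_simps)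
    qed (use int f1 in \<open>auto simp: F_def\<close>)
    have bound: "norm (measure_pmf.expectation (walk n) (\<lambda>x. \<bar>f x\<bar>) / real n - \<bar>?\<mu>\<bar>)
        \<le> measure_pmf.expectation (walk n) (\<lambda>x. \<bar>F n x\<bar>) / real n" if "n \<ge> 1" for n
    proof -
      have n: "real n > 0" using that by simp
      have "measure_pmf.expectation (walk n) (\<lambda>x. \<bar>f x\<bar>)
          \<le> measure_pmf.expectation (walk n) (\<lambda>x. \<bar>F n x\<bar> + real n * \<bar>?\<mu>\<bar>)"
      proof (rule integral_pmf_mono)
        show "\<bar>f x\<bar> \<le> \<bar>F n x\<bar> + real n * \<bar>?\<mu>\<bar>" for x
          using abs_triangle_ineq[of "F n x" "real n * ?\<mu>"] by (simp add: F_def abs_mult)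
      qed (use ints iF in auto)
      also have "\<dots> = measure_pmf.expectation (walk n) (\<lambda>x. \<bar>F n x\<bar>) + real n * \<bar>?\<mu>\<bar>"
        using iF by simp
      finally have 1: "measure_pmf.expectation (walk n) (\<lambda>x. \<bar>f x\<bar>)
          \<le> measure_pmf.expectation (walk n) (\<lambda>x. \<bar>F n x\<bar>) + real n * \<bar>?\<mu>\<bar>" .
      have "measure_pmf.expectation (walk n) (\<lambda>x. real n * \<bar>?\<mu>\<bar>)
          \<le> measure_pmf.expectation (walk n) (\<lambda>x. \<bar>F n x\<bar> + \<bar>f x\<bar>)"
      proof (rule integral_pmf_mono)
        show "real n * \<bar>?\<mu>\<bar> \<le> \<bar>F n x\<bar> + \<bar>f x\<bar>" for x
          using abs_triangle_ineq4[of "f x" "F n x"] by (simp add: F_def abs_mult)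
      qed (use ints iF in auto)
      also have "\<dots> = measure_pmf.expectation (walk n) (\<lambda>x. \<bar>F n x\<bar>)
          + measure_pmf.expectation (walk n) (\<lambda>x. \<bar>f x\<bar>)"
        using iF ints by simp
      finally have 2: "real n * \<bar>?\<mu>\<bar> \<le> measure_pmf.expectation (walk n) (\<lambda>x. \<bar>F n x\<bar>)
          + measure_pmf.expectation (walk n) (\<lambda>x. \<bar>f x\<bar>)" by simp
      have "\<bar>measure_pmf.expectation (walk n) (\<lambda>x. \<bar>f x\<bar>) - real n * \<bar>?\<mu>\<bar>\<bar>
          \<le> measure_pmf.expectation (walk n) (\<lambda>x. \<bar>F n x\<bar>)" using 1 2 by linarith
      hence "\<bar>measure_pmf.expectation (walk n) (\<lambda>x. \<bar>f x\<bar>) - real n * \<bar>?\<mu>\<bar>\<bar> / real n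
          \<le> measure_pmf.expectation (walk n) (\<lambda>x. \<bar>F n x\<bar>) / real n"
        using n by (simp add: divide_right_mono)
      moreover have "measure_pmf.expectation (walk n) (\<lambda>x. \<bar>f x\<bar>) / real n - \<bar>?\<mu>\<bar>
          = (measure_pmf.expectation (walk n) (\<lambda>x. \<bar>f x\<bar>) - real n * \<bar>?\<mu>\<bar>) / real n"
        using n by (simp add: field_simps)
      ultimately show ?thesis using n by (simp add: abs_divide)
    qed
    have "(\<lambda>n. measure_pmf.expectation (walk n) (\<lambda>x. \<bar>f x\<bar>) / real n - \<bar>?\<mu>\<bar>) \<longlonglongrightarrow> 0"
      by (rule Lim_null_comparison[OF eventually_sequentiallyI[of 1, OF bound] lim])
    thus ?thesis using True by (simp add: LIM_zero_iff)
  next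
    case False
    then obtain y0 where y0: "y0 \<in> set_pmf m" "\<epsilon> y0 \<noteq> 1" by auto
    have bd: "0 \<le> 1 - \<epsilon> x" "1 - \<epsilon> x \<le> 2" if "x \<in> carrier G" for x
      using \<epsilon>[OF that] by auto
    have ie: "integrable (measure_pmf m) (\<lambda>x. 1 - \<epsilon> x)"
      by (rule integrable_pmf_bound[where g = "\<lambda>_. 2"]) (use bd in_step in auto)
    \<comment> \<open>Twice the probability of a step of sign -1, hence nonzero; this allows the
      equation for the coboundary constant \<open>c\<close> to be solved.\<close>
    define q where "q = measure_pmf.expectation m (\<lambda>x. 1 - \<epsilon> x)"
    have "q \<noteq> 0"
    proof
      assume "q = 0"
      moreover have "AE x in measure_pmf m. 0 \<le> 1 - \<epsilon> x"
        using bd in_step by (auto simp: AE_measure_pmf_iff)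
      ultimately have "AE x in measure_pmf m. 1 - \<epsilon> x = 0"
        using integral_nonneg_eq_0_iff_AE[OF ie] unfolding q_def by simp
      thus False using y0 by (auto simp: AE_measure_pmf_iff)
    qed
    define c where "c = ?\<mu> / q"
    \<comment> \<open>Subtracting the coboundary \<open>c (1 - \<epsilon>)\<close> centers the cocycle.\<close>
    define F where "F x = f x - c * (1 - \<epsilon> x)" for x
    have FF: "integrable (measure_pmf m) F" "measure_pmf.expectation m F = 0"
      using int ie \<open>q \<noteq> 0\<close> unfolding F_def by (auto simp: q_def[symmetric] c_def)
    have F1: "F \<one> = 0" unfolding F_def using f1 \<epsilon>1 by simp
    have Fm: "F (x \<otimes> y) = F x + \<epsilon> x * F y" if "x \<in> set_pmf (walk n)" "y \<in> set_pmf m" for n x y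
      using that in_walk[of x n] in_step[of y] by (simp add: F_def f_mult \<epsilon>_mult algebra_simps)
    have \<epsilon>abs: "\<bar>\<epsilon> x\<bar> = 1" if "x \<in> carrier G" for x using \<epsilon>[OF that] by auto
    have diffF: "\<bar>\<bar>F x\<bar> - \<bar>f x\<bar>\<bar> \<le> \<bar>c\<bar> * 2" if x: "x \<in> carrier G" for x
    proof -
      have "\<bar>\<bar>F x\<bar> - \<bar>f x\<bar>\<bar> \<le> \<bar>c * (1 - \<epsilon> x)\<bar>" unfolding F_def by linarith
      also have "\<dots> \<le> \<bar>c\<bar> * 2" unfolding abs_mult using bd[OF x] by (intro mult_left_mono) auto
      finally show ?thesis .
    qed
    have "(\<lambda>n. measure_pmf.expectation (walk n) (\<lambda>x. \<bar>f x\<bar>) / real n) \<longlonglongrightarrow> 0"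
    proof (rule growth_bounded_difference[where u = "\<lambda>x. \<bar>F x\<bar>" and c = "2 * \<bar>c\<bar>"])
      show "(\<lambda>n. measure_pmf.expectation (walk n) (\<lambda>x. \<bar>F x\<bar>) / real n) \<longlonglongrightarrow> 0"
        using FF(1) FF(2) F1 Fm \<epsilon>abs by (rule centered_growth_zero(2))
      show "integrable (measure_pmf (walk n)) (\<lambda>x. \<bar>F x\<bar>)" for n
      proof (rule integrable_pmf_bound)
        show "integrable (measure_pmf (walk n)) (\<lambda>x. \<bar>f x\<bar> + \<bar>c\<bar> * 2)" using ints[of n] by simp
        show "\<bar>\<bar>F x\<bar>\<bar> \<le> \<bar>f x\<bar> + \<bar>c\<bar> * 2" if "x \<in> set_pmf (walk n)" for x
          using diffF[OF in_walk[OF that]] by linarith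
      qed
    qed (use diffF in \<open>simp add: mult.commute\<close>)
    thus ?thesis by (simp only: if_not_P[OF False])
  qed
qed

end

section \<open>Absolute values and spans of ordered products\<close>

text \<open>The constant \<open>\<kappa>\<close> is 2 for the modulus on \<open>\<complex>\<close> and 1 for an ultrametric absolute value, so
  that the same estimates serve the fibers \<open>\<rho>\<^sub>t\<close> and the non-archimedean representation; those
  growing like \<open>\<kappa>\<^sup>n\<close> degenerate to uniform bounds in the latter case.\<close>

locale quasi_abs =
  fixes av :: "'k::field \<Rightarrow> real" and \<kappa> :: real
  assumes kappa_ge_1: "1 \<le> \<kappa>"
    and av_nonneg [simp]: "0 \<le> av x"
    and av_eq_0_iff [simp]: "av x = 0 \<longleftrightarrow> x = 0"
    and av_mult: "av (x * y) = av x * av y"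
    and av_add_le: "av (x + y) \<le> \<kappa> * max (av x) (av y)"
begin

lemma av_0 [simp]: "av 0 = 0" by simp

lemma av_1 [simp]: "av 1 = 1"
proof -
  have "av 1 * av 1 = av 1" using av_mult[of 1 1] by simp
  thus ?thesis by simp
qed

lemma av_pos: "x \<noteq> 0 \<Longrightarrow> 0 < av x"
  using av_nonneg[of x] av_eq_0_iff[of x] by linarith

lemma av_minus [simp]: "av (- x) = av x"
proof -
  have "av (-1) * av (-1) = 1" using av_mult[of "-1" "-1"] by simp
  hence "av (-1) = 1 \<or> av (-1) = -1" by (simp add: square_eq_1_iff)
  hence "av (-1) = 1" using av_nonneg[of "-1"] by linarith
  thus ?thesis using av_mult[of "-1" x] by simp
qed

lemma av_diff_le: "av (x - y) \<le> \<kappa> * max (av x) (av y)"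
  using av_add_le[of x "- y"] by simp

lemma kappa_pos: "0 < \<kappa>" using kappa_ge_1 by linarith

lemma av_add_bound:
  assumes "av x \<le> c" "av y \<le> c" shows "av (x + y) \<le> \<kappa> * c"
  by (rule order_trans[OF av_add_le mult_left_mono]) (use assms kappa_pos in auto)

lemma av_diff_bound:
  assumes "av x \<le> c" "av y \<le> c" shows "av (x - y) \<le> \<kappa> * c"
  by (rule order_trans[OF av_diff_le mult_left_mono]) (use assms kappa_pos in auto)

lemma ln_av_mult: "x \<noteq> 0 \<Longrightarrow> y \<noteq> 0 \<Longrightarrow> ln (av (x * y)) = ln (av x) + ln (av y)"
  by (simp add: av_mult ln_mult av_pos)

lemma ln_av_of_mult_eq_1: "x * y = 1 \<Longrightarrow> ln (av y) = - ln (av x)"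
  using ln_av_mult[of x y] by (cases "x = 0"; cases "y = 0") auto

definition mnorm :: "'k^2^2 \<Rightarrow> real" where
  "mnorm A = Max ((\<lambda>(i, j). av (A $ i $ j)) ` UNIV)"

lemma av_entry_le_mnorm: "av (A $ i $ j) \<le> mnorm A"
  unfolding mnorm_def by (rule Max_ge) (auto intro: image_eqI[of _ _ "(i, j)"])

lemma mnorm_le: "(\<And>i j. av (A $ i $ j) \<le> c) \<Longrightarrow> mnorm A \<le> c"
  unfolding mnorm_def by (subst Max_le_iff) auto

lemma mnorm_nonneg: "0 \<le> mnorm A"
  using av_nonneg av_entry_le_mnorm order_trans by blast

lemma mnorm_mult: "mnorm (A ** B) \<le> \<kappa> * (mnorm A * mnorm B)"
proof (rule mnorm_le)
  fix i j
  have "av (A $ i $ k * B $ k $ j) \<le> mnorm A * mnorm B" for k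
    unfolding av_mult by (intro mult_mono av_entry_le_mnorm av_nonneg mnorm_nonneg)
  thus "av ((A ** B) $ i $ j) \<le> \<kappa> * (mnorm A * mnorm B)"
    by (simp add: matrix_matrix_mult_def sum_2 av_add_bound)
qed

lemma mnorm_add_bound: "mnorm A \<le> c \<Longrightarrow> mnorm B \<le> c \<Longrightarrow> mnorm (A + B) \<le> \<kappa> * c"
  by (rule mnorm_le) (auto intro!: av_add_bound intro: order_trans[OF av_entry_le_mnorm])

text \<open>The determinant is a difference of two products of entries, so
  \<open>1 \<le> \<kappa> * (mnorm A * mnorm A)\<close>. The resulting lower bound
  \<open>- ln \<kappa> / 2\<close> is weakened to \<open>- ln \<kappa>\<close> so that one constant
  governs both this bound and the submultiplicativity defect.\<close>

lemma mnorm_det_1: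
  assumes "det A = 1"
  shows "0 < mnorm A" "- ln \<kappa> \<le> ln (mnorm A)"
proof -
  let ?m = "mnorm A"
  have e: "av (A $ i $ j * A $ k $ l) \<le> ?m * ?m" for i j k l
    unfolding av_mult by (intro mult_mono av_entry_le_mnorm av_nonneg mnorm_nonneg)
  have "1 = av (A$1$1 * A$2$2 - A$1$2 * A$2$1)" using assms by (simp add: det_2)
  also have "\<dots> \<le> \<kappa> * (?m * ?m)" by (intro av_diff_bound e)
  finally have 1: "1 \<le> \<kappa> * (?m * ?m)" .
  hence "?m \<noteq> 0" by auto
  thus pos: "0 < ?m" using mnorm_nonneg[of A] by linarith
  have "ln 1 \<le> ln (\<kappa> * (?m * ?m))" using 1 by (subst ln_le_cancel_iff) auto
  also have "\<dots> = ln \<kappa> + 2 * ln ?m" using pos kappa_pos by (simp add: ln_mult)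
  finally show "- ln \<kappa> \<le> ln ?m" using ln_ge_zero[OF kappa_ge_1] by simp
qed

end

section \<open>Trace identities and spans of ordered products\<close>

definition trace2 :: "'k::field^2^2 \<Rightarrow> 'k" where
  "trace2 A = A $ 1 $ 1 + A $ 2 $ 2"

lemma cayley_hamilton_2:
  fixes A :: "'k::field^2^2"
  assumes "det A = 1"
  shows "A ** A = mat (trace2 A) ** A - mat 1"
proof -
  have "A$1$2 * A$2$1 = A$1$1 * A$2$2 - 1" "A$2$1 * A$1$2 = A$1$1 * A$2$2 - 1"
    using assms by (auto simp: det_2 algebra_simps)
  thus ?thesis
    by (simp add: vec_eq_iff forall_2 matrix_matrix_mult_def sum_2 trace2_def mat_def algebra_simps)
qed

text \<open>Cayley-Hamilton linearized in the matrix; the scalar term is minus the polar form of the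
  determinant. Read from left to right it sorts a product: \<open>A\<close> moves to the front of
  \<open>B\<close>, at the price of terms with fewer factors.\<close>

lemma cayley_hamilton_2_polarized:
  fixes A B :: "'k::field^2^2"
  shows "B ** A = mat (trace2 A) ** B + mat (trace2 B) ** A
    + mat (trace2 (B ** A) - trace2 A * trace2 B) - A ** B"
  by (simp add: vec_eq_iff forall_2 matrix_matrix_mult_def sum_2 trace2_def mat_def algebra_simps)

lemma matrix_add_ldistrib_field:
  fixes A B C :: "'k::field^2^2" shows "C ** (A + B) = C ** A + C ** B"
  by (simp add: vec_eq_iff forall_2 matrix_matrix_mult_def sum_2 algebra_simps)

lemma mat_mult_commute_2:
  fixes A :: "'k::field^2^2" shows "A ** mat x = mat x ** A"
  by (simp add: vec_eq_iff forall_2 matrix_matrix_mult_def sum_2 mat_def algebra_simps)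

context quasi_abs
begin

text \<open>\<open>spans As X c\<close>: the matrix \<open>X\<close> is a combination of the ordered products of the sublists of \<open>As\<close>
  with coefficients of absolute value at most \<open>c\<close>.\<close>

fun spans :: "('k^2^2) list \<Rightarrow> 'k^2^2 \<Rightarrow> real \<Rightarrow> bool" where
  "spans [] X c \<longleftrightarrow> (\<exists>z. X = mat z \<and> av z \<le> c)"
| "spans (A # As) X c \<longleftrightarrow> (\<exists>Y Z. X = Y + A ** Z \<and> spans As Y c \<and> spans As Z c)"

lemma spans_mono: "spans As X c \<Longrightarrow> c \<le> d \<Longrightarrow> spans As X d"
proof (induction As arbitrary: X)
  case (Cons A As)
  then obtain Y Z where "X = Y + A ** Z" "spans As Y c" "spans As Z c" by auto
  thus ?case using Cons.IH Cons.prems(2) by (simp, blast)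
qed (auto intro: order_trans)

lemma spans_scale: "spans As X c \<Longrightarrow> spans As (mat z ** X) (av z * c)"
proof (induction As arbitrary: X)
  case Nil
  then obtain w where "X = mat w" "av w \<le> c" by auto
  moreover have "mat z ** mat w = (mat (z * w) :: 'k^2^2)"
    by (simp add: vec_eq_iff forall_2 matrix_matrix_mult_def sum_2 mat_def)
  ultimately show ?case by (auto intro!: exI[of _ "z * w"] simp: av_mult mult_left_mono)
next
  case (Cons A As)
  then obtain Y Z where "X = Y + A ** Z" "spans As Y c" "spans As Z c" by auto
  moreover have "mat z ** (Y + A ** Z) = mat z ** Y + A ** (mat z ** Z)"
    unfolding matrix_add_ldistrib_field matrix_mul_assoc mat_mult_commute_2[of A z] ..
  ultimately show ?case using Cons.IH by auto
qed

lemma spans_uminus: "spans As X c \<Longrightarrow> spans As (- X) c"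
proof -
  have "- X = mat (-1) ** X"
    by (simp add: vec_eq_iff forall_2 matrix_matrix_mult_def sum_2 mat_def)
  thus "spans As X c \<Longrightarrow> spans As (- X) c" using spans_scale[of As X c "-1"] by simp
qed

lemma spans_add: "spans As X c \<Longrightarrow> spans As Y c \<Longrightarrow> spans As (X + Y) (\<kappa> * c)"
proof (induction As arbitrary: X Y)
  case Nil
  then obtain z w where "X = mat z" "av z \<le> c" "Y = mat w" "av w \<le> c" by auto
  moreover have "mat z + mat w = (mat (z + w) :: 'k^2^2)"
    by (simp add: vec_eq_iff forall_2 mat_def)
  ultimately show ?case by (auto intro!: exI[of _ "z + w"] av_add_bound)
next
  case (Cons A As)
  then obtain Y1 Z1 Y2 Z2 where "X = Y1 + A ** Z1" "spans As Y1 c" "spans As Z1 c"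
    "Y = Y2 + A ** Z2" "spans As Y2 c" "spans As Z2 c" by auto
  moreover have "(Y1 + A ** Z1) + (Y2 + A ** Z2) = (Y1 + Y2) + A ** (Z1 + Z2)"
    by (simp add: matrix_add_ldistrib_field)
  ultimately show ?case using Cons.IH by (simp only: spans.simps, blast)
qed

lemma spans_0: "0 \<le> c \<Longrightarrow> spans As 0 c"
proof (induction As)
  case Nil
  have "(0 :: 'k^2^2) = mat 0" by (simp add: vec_eq_iff mat_def)
  thus ?case using Nil by (simp only: spans.simps, intro exI[of _ 0]) simp
next
  case (Cons A As)
  have "(0 :: 'k^2^2) = 0 + A ** 0"
    by (simp add: vec_eq_iff forall_2 matrix_matrix_mult_def)
  thus ?case using Cons by (simp only: spans.simps, blast)
qed

lemma spans_1: "spans As (mat 1) 1"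
proof (induction As)
  case (Cons A As)
  have "mat 1 = mat 1 + A ** (0 :: 'k^2^2)"
    by (simp add: vec_eq_iff forall_2 matrix_matrix_mult_def)
  thus ?case using Cons spans_0[of 1 As] zero_le_one by (simp only: spans.simps, blast)
qed (auto intro: exI[of _ 1])

lemma spans_nonneg: "spans As X c \<Longrightarrow> 0 \<le> c"
proof (induction As arbitrary: X)
  case Nil
  then obtain z where "av z \<le> c" by auto
  thus ?case using av_nonneg[of z] by linarith
qed auto

text \<open>Left multiplication by a generator is put back into sorted form by induction on the
  list. If \<open>B\<close> is the head \<open>A\<close>, Cayley-Hamilton removes the square:
  \<open>A ** X\<close> becomes \<open>- Z + A ** (Y + mat (trace2 A) ** Z)\<close>. Otherwise the
  polarized identity moves \<open>A\<close> in front of \<open>B\<close>, and the products of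
  \<open>B\<close> with \<open>Y\<close> and \<open>Z\<close> are handled by the induction
  hypothesis for the tail. The factor lost depends on \<open>\<kappa>\<close>, \<open>K\<close> and
  the number of generators, but not on the matrices themselves.\<close>

lemma spans_mult:
  assumes "\<And>A. A \<in> set As \<Longrightarrow> det A = 1"
    and "\<And>A. A \<in> set As \<Longrightarrow> av (trace2 A) \<le> K"
    and "\<And>A B. A \<in> set As \<Longrightarrow> B \<in> set As \<Longrightarrow> av (trace2 (A ** B)) \<le> K"
    and K: "1 \<le> K" and "B \<in> set As" "spans As X c"
  shows "spans As (B ** X) ((\<kappa>^3 * K^2) ^ length As * c)"
  using assms
proof (induction As arbitrary: B X c)
  case (Cons A As)
  define D where "D = (\<kappa>^3 * K^2) ^ length As"
  have \<kappa>K: "1 \<le> \<kappa>^n * K^k" for n k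
    using mult_mono[of 1 "\<kappa>^n" 1 "K^k"] kappa_ge_1 K by (simp add: one_le_power)
  have D1: "1 \<le> D" unfolding D_def by (intro one_le_power \<kappa>K)
  have D': "(\<kappa>^3 * K^2) ^ length (A # As) = \<kappa>^3 * K^2 * D" by (simp add: D_def)
  obtain Y Z where X: "X = Y + A ** Z" and Y: "spans As Y c" and Z: "spans As Z c"
    using Cons.prems(6) by auto
  have c: "0 \<le> c" using spans_nonneg[OF Y] .
  have KD: "1 \<le> K^2 * D" using mult_mono[of 1 "K^2" 1 D] D1 K by (simp add: one_le_power)
  have KK: "K \<le> K^2" using K self_le_power[of K 2] by simp
  have \<kappa>3: "\<kappa> \<le> \<kappa>^3" "1 \<le> \<kappa>^3" using kappa_ge_1 self_le_power[of \<kappa> 3] by (auto simp: one_le_power)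
  have \<kappa>2: "\<kappa>^2 \<le> \<kappa>^3" using kappa_ge_1 by (simp add: power_increasing)
  have tA: "av (trace2 A) \<le> K" using Cons.prems(2) by simp
  \<comment> \<open>The worst case is a sum of three terms: two additions cost
    \<open>\<kappa>\<^sup>2\<close>, the scalar \<open>q\<close> below costs
    \<open>\<kappa> * K\<^sup>2\<close>, and \<open>D\<close> comes from the induction
    hypothesis.\<close>
  define D3 where "D3 = \<kappa>^3 * (K^2 * D) * c"
  have le: "x * y * c \<le> D3" if "0 \<le> x" "x \<le> \<kappa>^3" "0 \<le> y" "y \<le> K^2 * D" for x y
    unfolding D3_def using that c kappa_pos by (intro mult_right_mono mult_mono) auto
  have "spans (A # As) (B ** X) D3"
  proof (cases "B = A")
    case True
    have "A ** X = - Z + A ** (Y + mat (trace2 A) ** Z)"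
    proof -
      have "A ** X = A ** Y + (A ** A) ** Z"
        by (simp add: X matrix_add_ldistrib_field matrix_mul_assoc)
      also have "(A ** A) ** Z = mat (trace2 A) ** A ** Z - Z"
      proof -
        have "(mat (trace2 A) ** A - mat 1) ** Z = mat (trace2 A) ** A ** Z - Z"
          by (simp add: vec_eq_iff forall_2 matrix_matrix_mult_def sum_2 mat_def algebra_simps)
        thus ?thesis using cayley_hamilton_2[of A] Cons.prems(1) by simp
      qed
      also have "mat (trace2 A) ** A ** Z = A ** (mat (trace2 A) ** Z)"
        by (metis mat_mult_commute_2 matrix_mul_assoc)
      finally show ?thesis by (simp add: matrix_add_ldistrib_field algebra_simps)
    qed
    moreover have "spans As (- Z) D3"
      by (rule spans_mono[OF spans_uminus[OF Z]]) (use le[of 1 1] \<kappa>3 KD in simp)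
    moreover have "spans As (Y + mat (trace2 A) ** Z) (\<kappa> * (K * c))"
    proof (rule spans_add)
      show "spans As Y (K * c)" by (rule spans_mono[OF Y]) (use mult_right_mono[OF K c] in simp)
      show "spans As (mat (trace2 A) ** Z) (K * c)"
        by (rule spans_mono[OF spans_scale[OF Z]]) (use mult_right_mono[OF tA c] in simp)
    qed
    moreover have "\<kappa> * (K * c) \<le> D3"
    proof -
      have "K \<le> K^2 * D" using KK mult_left_mono[OF D1, of "K^2"] by simp
      thus ?thesis using le[of \<kappa> K] \<kappa>3 kappa_pos K by (simp add: mult.assoc)
    qed
    ultimately show ?thesis using True spans_mono by (simp only: spans.simps, blast)
  next
    case False
    hence B: "B \<in> set As" using Cons.prems(5) by simp
    have IH: "spans As (B ** W) (D * c)" if "spans As W c" for W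
      unfolding D_def by (rule Cons.IH) (use Cons.prems(1-4) B that in auto)
    have tB: "av (trace2 B) \<le> K" using Cons.prems(2) B by simp
    \<comment> \<open>The coefficient of the identity in the polarized identity. It is the only one
      quadratic in the traces, and being a difference it costs one more
      \<open>\<kappa>\<close>.\<close>
    define q where "q = trace2 (B ** A) - trace2 A * trace2 B"
    have q: "av q \<le> \<kappa> * K^2" unfolding q_def
    proof (rule av_diff_bound)
      show "av (trace2 (B ** A)) \<le> K^2"
        using Cons.prems(3)[of B A] B KK by auto
      show "av (trace2 A * trace2 B) \<le> K^2"
        unfolding av_mult power2_eq_square using tA tB K by (intro mult_mono) auto
    qed
    have "B ** X = (B ** Y + (mat (trace2 A) ** (B ** Z) + mat q ** Z))
        + A ** (mat (trace2 B) ** Z + - (B ** Z))"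
    proof -
      have "B ** X = B ** Y + (B ** A) ** Z"
        by (simp add: X matrix_add_ldistrib_field matrix_mul_assoc)
      also have "(B ** A) ** Z = mat (trace2 A) ** (B ** Z) + (mat (trace2 B) ** A) ** Z
          + mat q ** Z - A ** (B ** Z)"
      proof -
        have "(U + V + W - T) ** Z = U ** Z + V ** Z + W ** Z - T ** Z" for U V W T :: "'k^2^2"
          by (simp add: vec_eq_iff forall_2 matrix_matrix_mult_def sum_2 algebra_simps)
        moreover have "B ** A = mat (trace2 A) ** B + mat (trace2 B) ** A + mat q - A ** B"
          unfolding q_def by (rule cayley_hamilton_2_polarized)
        hence "B ** A ** Z = (mat (trace2 A) ** B + mat (trace2 B) ** A + mat q - A ** B) ** Z"
          by (rule arg_cong)
        ultimately show ?thesis by (simp only: matrix_mul_assoc)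
      qed
      also have "(mat (trace2 B) ** A) ** Z = A ** (mat (trace2 B) ** Z)"
        by (metis mat_mult_commute_2 matrix_mul_assoc)
      finally have e1: "B ** X = B ** Y + (mat (trace2 A) ** (B ** Z) + A ** (mat (trace2 B) ** Z)
          + mat q ** Z - A ** (B ** Z))" .
      have e2: "A ** (mat (trace2 B) ** Z + - (B ** Z)) = A ** (mat (trace2 B) ** Z) - A ** (B ** Z)"
        using matrix_add_ldistrib_field[of A "mat (trace2 B) ** Z - B ** Z" "B ** Z"] by simp
      show ?thesis unfolding e1 e2 by (simp only: algebra_simps)
    qed
    moreover have "spans As (B ** Y + (mat (trace2 A) ** (B ** Z) + mat q ** Z)) D3"
    proof -
      have s1: "spans As (mat (trace2 A) ** (B ** Z)) (\<kappa> * (K^2 * D) * c)"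
      proof (rule spans_mono[OF spans_scale[OF IH[OF Z]]])
        have "av (trace2 A) * (D * c) \<le> K^2 * (D * c)"
          using tA KK D1 c by (intro mult_right_mono) auto
        also have "\<dots> \<le> \<kappa> * (K^2 * (D * c))"
          using mult_right_mono[OF kappa_ge_1, of "K^2 * (D * c)"] D1 c by simp
        finally show "av (trace2 A) * (D * c) \<le> \<kappa> * (K^2 * D) * c" by (simp add: mult.assoc)
      qed
      have s2: "spans As (mat q ** Z) (\<kappa> * (K^2 * D) * c)"
      proof (rule spans_mono[OF spans_scale[OF Z]])
        have "av q * c \<le> \<kappa> * K^2 * c" using q c by (intro mult_right_mono)
        also have "\<dots> \<le> \<kappa> * K^2 * (D * c)"
          using mult_right_mono[OF D1 c] kappa_pos by (intro mult_left_mono) auto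
        finally show "av q * c \<le> \<kappa> * (K^2 * D) * c" by (simp add: mult.assoc)
      qed
      have s3: "spans As (mat (trace2 A) ** (B ** Z) + mat q ** Z) (\<kappa>^2 * (K^2 * D) * c)"
        using spans_add[OF s1 s2] by (simp add: power2_eq_square mult.assoc)
      have s4: "spans As (B ** Y) (\<kappa>^2 * (K^2 * D) * c)"
      proof (rule spans_mono[OF IH[OF Y]])
        have "1 \<le> \<kappa>^2 * K^2" by (rule \<kappa>K)
        from mult_right_mono[OF this, of "D * c"] show "D * c \<le> \<kappa>^2 * (K^2 * D) * c"
          using D1 c by (simp add: mult.assoc)
      qed
      show ?thesis using spans_add[OF s4 s3] by (simp add: D3_def power2_eq_square power3_eq_cube mult.assoc)
    qed
    moreover have "spans As (mat (trace2 B) ** Z + - (B ** Z)) D3"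
    proof -
      have "spans As (mat (trace2 B) ** Z + - (B ** Z)) (\<kappa> * (K * D * c))"
      proof (rule spans_add)
        have "av (trace2 B) * c \<le> K * (D * c)"
          using tB mult_right_mono[OF D1 c] c K by (intro mult_mono) auto
        thus "spans As (mat (trace2 B) ** Z) (K * D * c)"
          using spans_mono[OF spans_scale[OF Z]] by (simp add: mult.assoc)
        have "D * c \<le> K * (D * c)" using mult_right_mono[OF K, of "D * c"] D1 c by simp
        thus "spans As (- (B ** Z)) (K * D * c)"
          using spans_mono[OF spans_uminus[OF IH[OF Z]]] by (simp add: mult.assoc)
      qed
      moreover have "\<kappa> * (K * D * c) \<le> D3"
      proof -
        have "K * D \<le> K^2 * D" using KK D1 by (intro mult_right_mono) auto
        thus ?thesis using le[of \<kappa> "K * D"] \<kappa>3 kappa_pos K D1 by (simp add: mult.assoc)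
      qed
      ultimately show ?thesis using spans_mono by blast
    qed
    ultimately show ?thesis by auto
  qed
  thus ?case by (simp only: D' D3_def mult.assoc)
qed simp

text \<open>The constant depends on the matrices in the list, hence on \<open>t\<close> in a fiber.
  It multiplies the norm once, not once per letter, so it does not enter the growth rate.\<close>

lemma spans_mnorm: "\<exists>C>0. \<forall>X c. spans As X c \<longrightarrow> mnorm X \<le> C * c"
proof (induction As)
  case Nil
  have "mnorm (mat z :: 'k^2^2) \<le> av z" for z by (rule mnorm_le) (simp add: mat_def)
  thus ?case by (intro exI[of _ 1]) (auto intro: order_trans)
next
  case (Cons A As)
  then obtain C where C: "C > 0" "\<And>X c. spans As X c \<Longrightarrow> mnorm X \<le> C * c" by blast
  define M where "M = max 1 (\<kappa> * mnorm A)"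
  show ?case
  proof (intro exI[of _ "\<kappa> * (M * C)"] conjI allI impI)
    show "\<kappa> * (M * C) > 0" using kappa_pos C by (simp add: M_def)
    fix X c assume "spans (A # As) X c"
    then obtain Y Z where X: "X = Y + A ** Z" "spans As Y c" "spans As Z c" by auto
    have c: "0 \<le> c" using spans_nonneg[OF X(2)] .
    have "mnorm X \<le> \<kappa> * (M * (C * c))" unfolding X(1)
    proof (rule mnorm_add_bound)
      have "1 * (C * c) \<le> M * (C * c)" unfolding M_def using C c by (intro mult_right_mono) auto
      thus "mnorm Y \<le> M * (C * c)" using C(2)[OF X(2)] by simp
      have "mnorm (A ** Z) \<le> \<kappa> * mnorm A * mnorm Z" using mnorm_mult[of A Z] by (simp add: mult.assoc)
      also have "\<dots> \<le> M * (C * c)" unfolding M_def using C(2)[OF X(3)] C c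
        by (intro mult_mono) (auto simp: mnorm_nonneg)
      finally show "mnorm (A ** Z) \<le> M * (C * c)" .
    qed
    thus "mnorm X \<le> \<kappa> * (M * C) * c" by (simp add: mult.assoc)
  qed
qed

end

section \<open>Growth of matrix representations\<close>

locale fg_walk = group G for G (structure) +
  fixes S :: "'a set" and m :: "'a pmf"
  assumes finite_gens: "finite S" and gens_carrier: "S \<subseteq> carrier G"
    and generates: "generate G S = carrier G"
    and gens_inv: "s \<in> S \<Longrightarrow> inv s \<in> S"
    and set_step': "set_pmf m \<subseteq> carrier G"
    and integrable_word_length: "integrable (measure_pmf m) (\<lambda>g. real (word_length G S g))"
begin

abbreviation wlen :: "'a \<Rightarrow> nat" where "wlen \<equiv> word_length G S"

abbreviation word :: "'a list \<Rightarrow> 'a" where "word xs \<equiv> foldr (\<otimes>) xs \<one>"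

lemma word_closed: "set xs \<subseteq> S \<Longrightarrow> word xs \<in> carrier G"
  using gens_carrier by (induction xs) auto

lemma word_append:
  "set xs \<subseteq> S \<Longrightarrow> set ys \<subseteq> S \<Longrightarrow> word (xs @ ys) = word xs \<otimes> word ys"
proof (induction xs)
  case (Cons x xs)
  thus ?case using gens_carrier word_closed[of xs] word_closed[of ys] by (auto simp: m_assoc)
qed (simp add: word_closed)

lemma exists_word:
  assumes "g \<in> carrier G" shows "\<exists>xs. set xs \<subseteq> S \<and> word xs = g"
proof -
  have "g \<in> generate G S" using assms generates by simp
  thus ?thesis
  proof (induction rule: generate.induct)
    case one
    show ?case by (rule exI[of _ "[]"]) simp
  next
    case (incl h)
    thus ?case using gens_carrier by (intro exI[of _ "[h]"]) auto
  next
    case (inv h)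
    thus ?case using gens_carrier gens_inv by (intro exI[of _ "[inv h]"]) auto
  next
    case (eng h1 h2)
    then obtain xs ys where "set xs \<subseteq> S" "word xs = h1" "set ys \<subseteq> S" "word ys = h2" by auto
    thus ?case using word_append[of xs ys] by (intro exI[of _ "xs @ ys"]) simp
  qed
qed

lemma shortest_word:
  assumes "g \<in> carrier G"
  obtains xs where "length xs = wlen g" "set xs \<subseteq> S" "word xs = g"
proof -
  have "\<exists>n xs. length xs = n \<and> set xs \<subseteq> S \<and> word xs = g" using exists_word[OF assms] by blast
  from LeastI_ex[OF this] show thesis using that unfolding word_length_def by blast
qed

lemma wlen_le: "set xs \<subseteq> S \<Longrightarrow> wlen (word xs) \<le> length xs"
  unfolding word_length_def by (rule Least_le) blast

text \<open>Induction along a shortest word. Words are right folds, so letters are prepended and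
  every step is a left multiplication by a generator.\<close>

lemma wlen_induct:
  assumes "g \<in> carrier G" and "P 0 \<one>"
    and step: "\<And>n s g. s \<in> S \<Longrightarrow> g \<in> carrier G \<Longrightarrow> P n g \<Longrightarrow> P (Suc n) (s \<otimes> g)"
  shows "P (wlen g) g"
proof -
  obtain xs where xs: "length xs = wlen g" "set xs \<subseteq> S" "word xs = g"
    using shortest_word[OF assms(1)] .
  have "P (length xs) (word xs)" using xs(2)
    by (induction xs) (auto simp: assms(2) intro!: step word_closed)
  thus ?thesis using xs by simp
qed

lemma wlen_linear_bound:
  fixes u :: "'a \<Rightarrow> real"
  assumes "g \<in> carrier G" and "\<And>s g. s \<in> S \<Longrightarrow> g \<in> carrier G \<Longrightarrow> u (s \<otimes> g) \<le> C + u g"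
  shows "u g \<le> u \<one> + C * real (wlen g)"
proof (rule wlen_induct[OF assms(1), of "\<lambda>n g. u g \<le> u \<one> + C * real n"])
  fix n s g assume "s \<in> S" "g \<in> carrier G" "u g \<le> u \<one> + C * real n"
  thus "u (s \<otimes> g) \<le> u \<one> + C * real (Suc n)" using assms(2)[of s g] by (simp add: algebra_simps)
qed simp

sublocale random_walk G m "\<lambda>g. real (wlen g)"
proof
  show "real (wlen \<one>) = 0" using wlen_le[of "[]"] by simp
  fix x y assume xy: "x \<in> carrier G" "y \<in> carrier G"
  obtain xs where xs: "length xs = wlen x" "set xs \<subseteq> S" "word xs = x" using shortest_word[OF xy(1)] .
  obtain ys where ys: "length ys = wlen y" "set ys \<subseteq> S" "word ys = y" using shortest_word[OF xy(2)] .
  have "wlen (x \<otimes> y) \<le> wlen x + wlen y"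
    using wlen_le[of "xs @ ys"] word_append[of xs ys] xs ys by simp
  thus "real (wlen (x \<otimes> y)) \<le> real (wlen x) + real (wlen y)" by linarith
qed (use set_step' integrable_word_length in auto)

end

section \<open>Growth rates in SL(2) over a field with an absolute value\<close>

locale sl2_walk = fg_walk G S m + quasi_abs av \<kappa>
  for G :: "('g, 'b) monoid_scheme" (structure) and S m and av :: "'k::field \<Rightarrow> real" and \<kappa> +
  fixes \<rho> :: "'g \<Rightarrow> 'k^2^2"
  assumes rho_det: "g \<in> carrier G \<Longrightarrow> det (\<rho> g) = 1"
    and rho_mult: "g \<in> carrier G \<Longrightarrow> h \<in> carrier G \<Longrightarrow> \<rho> (g \<otimes> h) = \<rho> g ** \<rho> h"
begin

text \<open>An invertible idempotent is the identity.\<close>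

lemma rho_one: "\<rho> \<one> = mat 1"
proof -
  have "invertible (\<rho> \<one>)" using rho_det[of \<one>] by (simp add: invertible_det_nz)
  then obtain B where "B ** \<rho> \<one> = mat 1" by (auto simp: invertible_def)
  moreover have "\<rho> \<one> ** \<rho> \<one> = \<rho> \<one>" using rho_mult[of \<one> \<one>] by simp
  ultimately show ?thesis by (metis matrix_mul_assoc matrix_mul_lid)
qed

definition lognorm :: "'g \<Rightarrow> real" where "lognorm g = ln (mnorm (\<rho> g))"

lemma lognorm_ge: "g \<in> carrier G \<Longrightarrow> - ln \<kappa> \<le> lognorm g"
  unfolding lognorm_def by (simp add: mnorm_det_1 rho_det)

lemma mnorm_rho_pos: "g \<in> carrier G \<Longrightarrow> 0 < mnorm (\<rho> g)"
  by (simp add: mnorm_det_1 rho_det)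

lemma lognorm_mult:
  assumes "g \<in> carrier G" "h \<in> carrier G"
  shows "lognorm (g \<otimes> h) \<le> lognorm g + lognorm h + ln \<kappa>"
proof -
  have pos: "0 < mnorm (\<rho> g)" "0 < mnorm (\<rho> h)" "0 < mnorm (\<rho> (g \<otimes> h))"
    using assms mnorm_rho_pos by auto
  have "lognorm (g \<otimes> h) \<le> ln (\<kappa> * (mnorm (\<rho> g) * mnorm (\<rho> h)))"
    unfolding lognorm_def using mnorm_mult[of "\<rho> g" "\<rho> h"] pos kappa_pos
    by (subst ln_le_cancel_iff) (auto simp: rho_mult[OF assms])
  thus ?thesis using pos kappa_pos by (simp add: lognorm_def ln_mult)
qed

lemma integrable_lognorm: "integrable (measure_pmf (walk n)) lognorm"
proof -
  define C where "C = ln \<kappa> + (\<Sum>s\<in>S. \<bar>lognorm s\<bar>)"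
  have C: "ln \<kappa> + lognorm s \<le> C" if "s \<in> S" for s
    using member_le_sum[of s S "\<lambda>s. \<bar>lognorm s\<bar>"] finite_gens that by (auto simp: C_def)
  have "C \<ge> 0" unfolding C_def using kappa_ge_1 by (simp add: sum_nonneg)
  have up: "lognorm g \<le> lognorm \<one> + C * real (wlen g)" if "g \<in> carrier G" for g
    using that
  proof (rule wlen_linear_bound)
    fix s h assume sh: "s \<in> S" "h \<in> carrier G"
    thus "lognorm (s \<otimes> h) \<le> C + lognorm h"
      using C[of s] lognorm_mult[of s h] gens_carrier by auto
  qed
  show ?thesis
  proof (rule integrable_linear_bound[of _ "ln \<kappa> + \<bar>lognorm \<one>\<bar>" C])
    fix g assume g: "g \<in> carrier G"
    have "0 \<le> C * real (wlen g)" using \<open>C \<ge> 0\<close> by simp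
    thus "\<bar>lognorm g\<bar> \<le> ln \<kappa> + \<bar>lognorm \<one>\<bar> + C * real (wlen g)"
      using up[OF g] lognorm_ge[OF g] ln_ge_zero[OF kappa_ge_1] by linarith
  qed
qed

definition has_growth :: "real \<Rightarrow> bool" where
  "has_growth l \<longleftrightarrow> (\<lambda>n. measure_pmf.expectation (walk n) lognorm / real n) \<longlonglongrightarrow> l"

lemma has_growth_unique: "has_growth l \<Longrightarrow> has_growth l' \<Longrightarrow> l = l'"
  unfolding has_growth_def using LIMSEQ_unique by blast

lemma has_growth_exists: obtains l where "has_growth l"
  using subadditive_growth_converges[of lognorm "ln \<kappa>"] integrable_lognorm lognorm_mult lognorm_ge
  unfolding has_growth_def by (metis add.commute add.right_inverse add_left_mono)

lemma has_growth_nonneg: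
  assumes "has_growth l" shows "0 \<le> l"
proof (rule LIMSEQ_le)
  show "(\<lambda>n. - ln \<kappa> / real n) \<longlonglongrightarrow> 0" by (rule lim_const_over_n)
  show "(\<lambda>n. measure_pmf.expectation (walk n) lognorm / real n) \<longlonglongrightarrow> l"
    using assms by (simp add: has_growth_def)
  have "- ln \<kappa> \<le> measure_pmf.expectation (walk n) lognorm" for n
    using integral_pmf_mono[of "walk n" "\<lambda>_. - ln \<kappa>" lognorm] integrable_lognorm lognorm_ge in_walk
    by simp
  thus "\<exists>N. \<forall>n\<ge>N. - ln \<kappa> / real n \<le> measure_pmf.expectation (walk n) lognorm / real n"
    by (intro exI[of _ 0] allI impI divide_right_mono) auto
qed

text \<open>By \<open>spans_mult\<close> each letter multiplies the coefficients by at most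
  \<open>D\<close>, so those of \<open>\<rho> g\<close> are at most \<open>D ^ wlen g\<close>. The
  bound depends only on \<open>\<kappa>\<close>, \<open>K\<close>, the number of generators and the
  mean word length: for \<open>\<kappa> = K = 1\<close> it is 0, and for the fibers it is the same
  for all \<open>t\<close> sharing the trace bound \<open>K\<close>.\<close>

lemma has_growth_bounded_traces:
  assumes K: "1 \<le> K" and t1: "\<And>s. s \<in> S \<Longrightarrow> av (trace2 (\<rho> s)) \<le> K"
    and t2: "\<And>s s'. s \<in> S \<Longrightarrow> s' \<in> S \<Longrightarrow> av (trace2 (\<rho> s ** \<rho> s')) \<le> K"
    and l: "has_growth l"
  shows "l \<le> ln ((\<kappa>^3 * K^2) ^ card S) * measure_pmf.expectation m (\<lambda>g. real (wlen g))"
proof -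
  obtain xs where xs: "set xs = S" "distinct xs" using finite_distinct_list[OF finite_gens] by blast
  define As where "As = map \<rho> xs"
  define D where "D = (\<kappa>^3 * K^2) ^ card S"
  have lenAs: "length As = card S" using xs distinct_card[of xs] by (simp add: As_def)
  have setAs: "set As = \<rho> ` S" using xs by (simp add: As_def)
  have "1 \<le> \<kappa>^3 * K^2" using mult_mono[of 1 "\<kappa>^3" 1 "K^2"] kappa_ge_1 K by (simp add: one_le_power)
  hence D: "1 \<le> D" unfolding D_def by (rule one_le_power)
  have sp: "spans As (\<rho> g) (D ^ wlen g)" if "g \<in> carrier G" for g
    using that
  proof (rule wlen_induct[of _ "\<lambda>n g. spans As (\<rho> g) (D ^ n)"])
    show "spans As (\<rho> \<one>) (D ^ 0)" by (simp add: rho_one spans_1)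
    fix n s g assume sg: "s \<in> S" "g \<in> carrier G" "spans As (\<rho> g) (D ^ n)"
    have "spans As (\<rho> s ** \<rho> g) ((\<kappa>^3 * K^2) ^ length As * D ^ n)"
      by (rule spans_mult[OF _ _ _ K]) (use setAs t1 t2 rho_det gens_carrier sg in auto)
    moreover have "\<rho> (s \<otimes> g) = \<rho> s ** \<rho> g" using rho_mult sg gens_carrier by auto
    ultimately show "spans As (\<rho> (s \<otimes> g)) (D ^ Suc n)" by (simp add: lenAs D_def)
  qed
  obtain C where C: "C > 0" "\<And>X c. spans As X c \<Longrightarrow> mnorm X \<le> C * c" using spans_mnorm by blast
  have up: "lognorm g \<le> ln C + ln D * real (wlen g)" if g: "g \<in> carrier G" for g
  proof -
    have "lognorm g \<le> ln (C * D ^ wlen g)" unfolding lognorm_def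
      using C(2)[OF sp[OF g]] mnorm_rho_pos[OF g] C(1) D by (subst ln_le_cancel_iff) auto
    also have "\<dots> = ln C + ln D * real (wlen g)" using C(1) D by (simp add: ln_mult ln_realpow)
    finally show ?thesis .
  qed
  have E: "measure_pmf.expectation (walk n) lognorm
      \<le> ln C + real n * (ln D * measure_pmf.expectation m (\<lambda>g. real (wlen g)))" for n
  proof -
    have "measure_pmf.expectation (walk n) lognorm
        \<le> measure_pmf.expectation (walk n) (\<lambda>g. ln C + ln D * real (wlen g))"
      by (rule integral_pmf_mono) (use integrable_lognorm integrable_len up in_walk in auto)
    also have "\<dots> = ln C + ln D * measure_pmf.expectation (walk n) (\<lambda>g. real (wlen g))"
      using integrable_len by simp
    also have "\<dots> \<le> ln C + ln D * (real n * measure_pmf.expectation m (\<lambda>g. real (wlen g)))"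
      using expectation_len_le D by (intro add_left_mono mult_left_mono) auto
    finally show ?thesis by (simp add: algebra_simps)
  qed
  define M where "M = ln D * measure_pmf.expectation m (\<lambda>g. real (wlen g))"
  have "l \<le> 0 + M"
  proof (rule LIMSEQ_le)
    show "(\<lambda>n. measure_pmf.expectation (walk n) lognorm / real n) \<longlonglongrightarrow> l"
      using l by (simp add: has_growth_def)
    show "(\<lambda>n. ln C / real n + M) \<longlonglongrightarrow> 0 + M"
      by (intro tendsto_intros lim_const_over_n)
    show "\<exists>N. \<forall>n\<ge>N. measure_pmf.expectation (walk n) lognorm / real n \<le> ln C / real n + M"
    proof (intro exI[of _ 1] allI impI)
      fix n :: nat assume "1 \<le> n"
      thus "measure_pmf.expectation (walk n) lognorm / real n \<le> ln C / real n + M"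
        using E[of n] unfolding M_def[symmetric] by (simp add: field_simps)
    qed
  qed
  thus ?thesis by (simp add: M_def D_def)
qed

lemma sl2_walk_conj:
  assumes "A ** B = mat 1" "B ** A = mat 1"
  shows "sl2_walk G S m av \<kappa> (\<lambda>g. B ** \<rho> g ** A)"
proof unfold_locales
  fix g h assume gh: "g \<in> carrier G"
  have "det B * det A = 1" using assms(2) det_mul[of B A] by simp
  thus "det (B ** \<rho> g ** A) = 1" using rho_det[OF gh] by (simp add: det_mul)
  assume h: "h \<in> carrier G"
  have "B ** \<rho> g ** A ** (B ** \<rho> h ** A) = B ** \<rho> g ** (A ** B) ** \<rho> h ** A"
    by (simp only: matrix_mul_assoc)
  thus "B ** \<rho> (g \<otimes> h) ** A = B ** \<rho> g ** A ** (B ** \<rho> h ** A)"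
    using rho_mult[OF gh h] assms(1) by (simp only: matrix_mul_rid matrix_mul_assoc)
qed

text \<open>Conjugation changes the norm by at most the factor \<open>M\<close> in either direction.
  \<open>M\<close> depends on the conjugating matrices and need not be bounded as they vary with
  \<open>t\<close>; the limit for a fixed \<open>t\<close> does not see it.\<close>

lemma has_growth_conj:
  assumes AB: "A ** B = mat 1" "B ** A = mat 1"
    and l: "sl2_walk.has_growth G m av (\<lambda>g. B ** \<rho> g ** A) l"
  shows "has_growth l"
proof -
  interpret c: sl2_walk G S m av \<kappa> "\<lambda>g. B ** \<rho> g ** A" by (rule sl2_walk_conj[OF AB])
  define M where "M = \<kappa> * (\<kappa> * (mnorm A * mnorm B))"
  have pos: "mnorm A > 0" "mnorm B > 0"
  proof -
    have "mnorm (mat 1 :: 'k^2^2) > 0" by (rule mnorm_det_1) simp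
    hence "0 < \<kappa> * (mnorm A * mnorm B)" using mnorm_mult[of A B] AB by simp
    hence "mnorm A \<noteq> 0" "mnorm B \<noteq> 0" by auto
    thus "mnorm A > 0" "mnorm B > 0" using mnorm_nonneg[of A] mnorm_nonneg[of B] by linarith+
  qed
  have M: "M > 0" unfolding M_def using pos kappa_pos by simp
  have triple: "mnorm (P ** X ** Q) \<le> \<kappa> * (\<kappa> * (mnorm P * mnorm Q)) * mnorm X" for P X Q
  proof -
    have "mnorm (P ** X ** Q) \<le> \<kappa> * (mnorm (P ** X) * mnorm Q)" by (rule mnorm_mult)
    also have "\<dots> \<le> \<kappa> * (\<kappa> * (mnorm P * mnorm X) * mnorm Q)"
      using mnorm_mult[of P X] kappa_pos mnorm_nonneg by (intro mult_left_mono mult_right_mono) auto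
    finally show ?thesis by (simp add: mult_ac)
  qed
  have log: "ln x \<le> ln M + ln y" if "0 < x" "0 < y" "x \<le> M * y" for x y
    using that M ln_le_cancel_iff[of x "M * y"] by (simp add: ln_mult)
  show ?thesis unfolding has_growth_def
  proof (rule growth_bounded_difference[OF c.integrable_lognorm _ l[unfolded c.has_growth_def]])
    fix g assume g: "g \<in> carrier G"
    have "A ** (B ** \<rho> g ** A) ** B = (A ** B) ** \<rho> g ** (A ** B)" by (simp only: matrix_mul_assoc)
    hence "mnorm (\<rho> g) \<le> M * mnorm (B ** \<rho> g ** A)"
      using triple[of A "B ** \<rho> g ** A" B] AB by (simp add: M_def)
    moreover have "mnorm (B ** \<rho> g ** A) \<le> M * mnorm (\<rho> g)"
      using triple[of B "\<rho> g" A] by (simp add: M_def mult.commute[of "mnorm A"])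
    ultimately show "\<bar>c.lognorm g - lognorm g\<bar> \<le> ln M"
      using log[of "mnorm (\<rho> g)" "mnorm (B ** \<rho> g ** A)"] log[of "mnorm (B ** \<rho> g ** A)" "mnorm (\<rho> g)"]
        mnorm_rho_pos[OF g] c.mnorm_rho_pos[OF g]
      unfolding c.lognorm_def lognorm_def by linarith
  qed
qed

end

section \<open>Triangular and monomial representations\<close>

text \<open>\<open>axial True\<close> describes the upper triangular matrices, i.e. a fixed point on the projective line;
  \<open>axial False\<close> the monomial ones, i.e. an invariant pair, on which \<open>e = -1\<close> records a swap.\<close>

definition axial :: "bool \<Rightarrow> real \<Rightarrow> 'k::field^2^2 \<Rightarrow> bool" where
  "axial tri e A \<longleftrightarrow> (if tri then e = 1 \<and> A $ 2 $ 1 = 0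
     else e = 1 \<and> A $ 1 $ 2 = 0 \<and> A $ 2 $ 1 = 0 \<or> e = -1 \<and> A $ 1 $ 1 = 0 \<and> A $ 2 $ 2 = 0)"

text \<open>The first-row entry through which the first coordinate is scaled: on the diagonal if the
  axes are kept, off it if they are swapped. The logarithm of its absolute value is the cocycle that
  governs growth.\<close>

definition multiplier :: "real \<Rightarrow> 'k::field^2^2 \<Rightarrow> 'k" where
  "multiplier e A = (if e = 1 then A $ 1 $ 1 else A $ 1 $ 2)"

lemma axial_sign: "axial tri e A \<Longrightarrow> e = 1 \<or> e = -1"
  by (auto simp: axial_def split: if_splits)

lemma axial_mult: "axial tri e A \<Longrightarrow> axial tri e' B \<Longrightarrow> axial tri (e * e') (A ** B)"
  by (auto simp: axial_def matrix_matrix_mult_def sum_2 split: if_splits)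

lemma axial_unique: "axial tri e A \<Longrightarrow> axial tri e' A \<Longrightarrow> det A = 1 \<Longrightarrow> e = e'"
  by (auto simp: axial_def det_2 split: if_splits)

lemma multiplier_nonzero: "axial tri e A \<Longrightarrow> det A = 1 \<Longrightarrow> multiplier e A \<noteq> 0"
  by (auto simp: axial_def multiplier_def det_2 split: if_splits)

text \<open>If \<open>A\<close> swaps the axes, the first row of the product sees the second row of
  \<open>B\<close>. Since \<open>det B = 1\<close>, the entry found there is, up to sign, the
  inverse of the multiplier of \<open>B\<close>; this is the origin of the twist by
  \<open>e\<close>.\<close>

lemma (in quasi_abs) ln_av_multiplier_mult:
  assumes "axial tri e A" "axial tri e' B" "det A = 1" "det B = 1"
  shows "ln (av (multiplier (e * e') (A ** B))) = ln (av (multiplier e A)) + e * ln (av (multiplier e' B))"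
proof -
  note nz = multiplier_nonzero[OF assms(1,3)] multiplier_nonzero[OF assms(2,4)]
  consider "e = 1" "e' = 1" | "e = 1" "e' = -1" | "e = -1" "e' = 1" | "e = -1" "e' = -1"
    using axial_sign assms(1,2) by blast
  thus ?thesis
  proof cases
    case 1
    hence "multiplier (e * e') (A ** B) = multiplier e A * multiplier e' B"
      using assms by (auto simp: axial_def multiplier_def matrix_matrix_mult_def sum_2 split: if_splits)
    thus ?thesis using nz 1 by (simp add: ln_av_mult)
  next
    case 2
    hence "multiplier (e * e') (A ** B) = multiplier e A * multiplier e' B"
      using assms by (auto simp: axial_def multiplier_def matrix_matrix_mult_def sum_2 split: if_splits)
    thus ?thesis using nz 2 by (simp add: ln_av_mult)
  next
    case 3
    have B: "multiplier e' B * B $ 2 $ 2 = 1"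
      using assms 3 by (auto simp: axial_def multiplier_def det_2 split: if_splits)
    have "multiplier (e * e') (A ** B) = multiplier e A * B $ 2 $ 2"
      using assms 3 by (auto simp: axial_def multiplier_def matrix_matrix_mult_def sum_2 split: if_splits)
    moreover have "B $ 2 $ 2 \<noteq> 0" using B by auto
    ultimately show ?thesis using nz 3 ln_av_of_mult_eq_1[OF B] by (simp add: ln_av_mult)
  next
    case 4
    have B: "multiplier e' B * - B $ 2 $ 1 = 1"
      using assms 4 by (auto simp: axial_def multiplier_def det_2 split: if_splits)
    have "multiplier (e * e') (A ** B) = - (multiplier e A * - B $ 2 $ 1)"
      using assms 4 by (auto simp: axial_def multiplier_def matrix_matrix_mult_def sum_2 split: if_splits)
    moreover have "- B $ 2 $ 1 \<noteq> 0" using B by auto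
    ultimately show ?thesis using nz 4 ln_av_of_mult_eq_1[OF B] by (simp add: ln_av_mult)
  qed
qed

lemma ln_max_inverse:
  fixes p q :: real
  assumes "p > 0" "p * q = 1" shows "ln (max p q) = \<bar>ln p\<bar>"
proof -
  have q: "q = inverse p" using assms by (simp add: field_simps)
  show ?thesis
  proof (cases "p \<ge> 1")
    case True
    hence "q \<le> 1" using q by (simp add: inverse_le_1_iff)
    thus ?thesis using True by (simp add: max_def)
  next
    case False
    hence "q \<ge> 1" using q assms by (simp add: one_le_inverse)
    thus ?thesis using False assms q by (simp add: max_def ln_inverse)
  qed
qed

locale axial_walk = sl2_walk +
  fixes tri :: bool and \<epsilon> :: "'a \<Rightarrow> real"
  assumes rho_axial: "g \<in> carrier G \<Longrightarrow> axial tri (\<epsilon> g) (\<rho> g)"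
begin

definition drift :: "'a \<Rightarrow> real" where "drift g = ln (av (multiplier (\<epsilon> g) (\<rho> g)))"

lemma eps_sign: "g \<in> carrier G \<Longrightarrow> \<epsilon> g = 1 \<or> \<epsilon> g = -1"
  using rho_axial axial_sign by blast

text \<open>A matrix of determinant 1 has only one sign, so the multiplicativity of
  \<open>axial\<close> forces that of \<open>\<epsilon>\<close>.\<close>

lemma eps_mult:
  assumes "g \<in> carrier G" "h \<in> carrier G" shows "\<epsilon> (g \<otimes> h) = \<epsilon> g * \<epsilon> h"
  using axial_unique[OF rho_axial[of "g \<otimes> h"], of "\<epsilon> g * \<epsilon> h"] rho_mult rho_det assms
    axial_mult[OF rho_axial rho_axial] by (simp add: det_mul)

lemma drift_mult:
  assumes "g \<in> carrier G" "h \<in> carrier G" shows "drift (g \<otimes> h) = drift g + \<epsilon> g * drift h"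
  unfolding drift_def eps_mult[OF assms] rho_mult[OF assms]
  by (rule ln_av_multiplier_mult) (use rho_axial rho_det assms in auto)

lemma drift_one: "drift \<one> = 0"
proof -
  have "\<epsilon> \<one> * \<epsilon> \<one> = \<epsilon> \<one>" using eps_mult[of \<one> \<one>] by simp
  hence "\<epsilon> \<one> = 1" using eps_sign[of \<one>] by auto
  thus ?thesis using drift_mult[of \<one> \<one>] by simp
qed

lemma integrable_drift: "integrable (measure_pmf m) drift"
proof -
  define C where "C = (\<Sum>s\<in>S. \<bar>drift s\<bar>)"
  have C: "\<bar>drift s\<bar> \<le> C" if "s \<in> S" for s
    using member_le_sum[of s S "\<lambda>s. \<bar>drift s\<bar>"] finite_gens that by (auto simp: C_def)
  have "\<bar>drift g\<bar> \<le> C * real (wlen g)" if g: "g \<in> carrier G" for g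
  proof -
    have "\<bar>drift g\<bar> \<le> \<bar>drift \<one>\<bar> + C * real (wlen g)" using g
    proof (rule wlen_linear_bound)
      fix s h assume sh: "s \<in> S" "h \<in> carrier G"
      hence s: "s \<in> carrier G" using gens_carrier by auto
      show "\<bar>drift (s \<otimes> h)\<bar> \<le> C + \<bar>drift h\<bar>"
        using C[OF sh(1)] drift_mult[OF s sh(2)] eps_sign[OF s] by auto
    qed
    thus ?thesis by (simp add: drift_one)
  qed
  thus ?thesis
    by (intro integrable_pmf_bound[of m "\<lambda>g. C * real (wlen g)" drift])
       (use integrable_word_length in_step in auto)
qed

text \<open>The limit provided by \<open>cocycle_growth\<close>. Only signs of elements charged by
  \<open>m\<close> count; a swap elsewhere in the group does not make the rate vanish.\<close>

definition drift_growth :: real where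
  "drift_growth = (if \<forall>g\<in>set_pmf m. \<epsilon> g = 1 then \<bar>measure_pmf.expectation m drift\<bar> else 0)"

lemma integrable_drift_walk: "integrable (measure_pmf (walk n)) drift"
  by (rule cocycle_growth(1)[OF eps_sign eps_mult drift_mult integrable_drift])

lemma drift_growth_tendsto:
  "(\<lambda>n. measure_pmf.expectation (walk n) (\<lambda>g. \<bar>drift g\<bar>) / real n) \<longlonglongrightarrow> drift_growth"
  unfolding drift_growth_def
  by (rule cocycle_growth(2)[OF eps_sign eps_mult drift_mult integrable_drift])

text \<open>The two nonzero entries are inverse to each other up to sign, so the logarithm of the
  larger absolute value is exactly \<open>\<bar>drift g\<bar>\<close>.\<close>

lemma has_growth_monomial:
  assumes "\<not> tri" shows "has_growth drift_growth"
proof -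
  have "lognorm g = \<bar>drift g\<bar>" if g: "g \<in> carrier G" for g
  proof -
    let ?A = "\<rho> g"
    have max4: "mnorm ?A = max (max (av (?A$1$1)) (av (?A$1$2))) (max (av (?A$2$1)) (av (?A$2$2)))"
    proof (rule antisym)
      show "mnorm ?A \<le> max (max (av (?A$1$1)) (av (?A$1$2))) (max (av (?A$2$1)) (av (?A$2$2)))"
      proof (rule mnorm_le)
        fix i j :: 2
        show "av (?A$i$j) \<le> max (max (av (?A$1$1)) (av (?A$1$2))) (max (av (?A$2$1)) (av (?A$2$2)))"
          using exhaust_2[of i] exhaust_2[of j] by auto
      qed
    qed (auto intro: av_entry_le_mnorm)
    from rho_axial[OF g] assms consider
        "\<epsilon> g = 1" "?A $ 1 $ 2 = 0" "?A $ 2 $ 1 = 0" | "\<epsilon> g = -1" "?A $ 1 $ 1 = 0" "?A $ 2 $ 2 = 0"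
      by (auto simp: axial_def)
    thus ?thesis
    proof cases
      case 1
      have "?A$1$1 * ?A$2$2 = 1" using rho_det[OF g] 1 by (simp add: det_2)
      hence "av (?A$1$1) > 0" "av (?A$1$1) * av (?A$2$2) = 1" by (auto simp: av_mult[symmetric] intro: av_pos)
      from ln_max_inverse[OF this] show ?thesis
        unfolding lognorm_def max4 drift_def multiplier_def using 1 by simp
    next
      case 2
      have "?A$1$2 * - ?A$2$1 = 1" using rho_det[OF g] 2 by (simp add: det_2)
      hence "av (?A$1$2) > 0" "av (?A$1$2) * av (- ?A$2$1) = 1"
        unfolding av_mult[symmetric] by (auto intro: av_pos)
      hence "ln (max (av (?A$1$2)) (av (?A$2$1))) = \<bar>ln (av (?A$1$2))\<bar>"
        using ln_max_inverse by simp
      thus ?thesis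
        unfolding lognorm_def max4 drift_def multiplier_def using 2 by simp
    qed
  qed
  hence "measure_pmf.expectation (walk n) lognorm = measure_pmf.expectation (walk n) (\<lambda>g. \<bar>drift g\<bar>)" for n
    by (intro integral_pmf_cong) (use in_walk in auto)
  thus ?thesis using drift_growth_tendsto by (simp add: has_growth_def)
qed

text \<open>Conjugating by \<open>diag(R, 1)\<close> divides the off-diagonal entry by \<open>R\<close> without changing the growth rate,
  so as \<open>R \<rightarrow> \<infinity>\<close> only the diagonal contributes.\<close>

lemma has_growth_triangular:
  assumes tri shows "has_growth drift_growth"
proof -
  define a where "a g = av (\<rho> g $ 1 $ 1)" for g
  define b where "b g = av (\<rho> g $ 1 $ 2)" for g
  define d where "d g = av (\<rho> g $ 2 $ 2)" for g
  \<comment> \<open>The norm of \<open>\<rho> g\<close> after the conjugation by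
    \<open>diag(R, 1)\<close>, written out in the three entries that can be nonzero.\<close>
  define N where "N R g = max (max (a g) (d g)) (b g / R)" for R g
  define \<eta> where "\<eta> R g = ln (N R g)" for R g
  have nn: "0 \<le> a g" "0 \<le> b g" "0 \<le> d g" for g by (auto simp: a_def b_def d_def)
  have eps: "\<epsilon> g = 1" "\<rho> g $ 2 $ 1 = 0" if "g \<in> carrier G" for g
    using rho_axial[OF that] assms by (auto simp: axial_def)
  have ad: "a g > 0" "a g * d g = 1" if g: "g \<in> carrier G" for g
  proof -
    have "\<rho> g $ 1 $ 1 * \<rho> g $ 2 $ 2 = 1" using rho_det[OF g] eps[OF g] by (simp add: det_2)
    thus "a g > 0" "a g * d g = 1" by (auto simp: a_def d_def av_mult[symmetric] intro: av_pos)
  qed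
  have drift: "\<bar>drift g\<bar> = ln (max (a g) (d g))" if g: "g \<in> carrier G" for g
    using ln_max_inverse[OF ad[OF g]] eps[OF g] by (simp add: drift_def multiplier_def a_def)
  have Npos: "0 < max (a g) (d g)" "0 < N R g" if "g \<in> carrier G" for g R
    using ad[OF that] by (auto simp: N_def)
  have \<eta>_ge: "\<bar>drift g\<bar> \<le> \<eta> R g" if g: "g \<in> carrier G" for g R
    unfolding drift[OF g] \<eta>_def using Npos[OF g] by (subst ln_le_cancel_iff) (auto simp: N_def)
  have mn: "mnorm (\<rho> g) = N 1 g" if g: "g \<in> carrier G" for g
  proof (rule antisym)
    show "mnorm (\<rho> g) \<le> N 1 g"
    proof (rule mnorm_le)
      fix i j :: 2
      show "av (\<rho> g $ i $ j) \<le> N 1 g"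
        using exhaust_2[of i] exhaust_2[of j] eps[OF g] nn[of g] by (auto simp: N_def a_def b_def d_def le_max_iff_disj)
    qed
  qed (auto simp: N_def a_def b_def d_def intro: av_entry_le_mnorm)
  \<comment> \<open>The first two bounds show that \<open>\<eta> R\<close> and
    \<open>lognorm\<close> differ by at most \<open>ln R\<close> and so have the same rate. The
    third confines the excess over the drift to elements with
    \<open>lognorm g > ln R\<close>.\<close>
  have \<eta>1: "\<eta> R g \<le> lognorm g" "lognorm g \<le> \<eta> R g + ln R"
    "\<eta> R g \<le> \<bar>drift g\<bar> + max 0 (lognorm g - ln R)" if g: "g \<in> carrier G" and R: "1 \<le> R" for g R
  proof -
    have "b g / R \<le> b g" using R nn[of g] by (simp add: divide_le_eq mult_le_cancel_left1)
    hence "N R g \<le> N 1 g" by (auto simp: N_def)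
    thus "\<eta> R g \<le> lognorm g" unfolding \<eta>_def lognorm_def mn[OF g] using Npos[OF g]
      by (subst ln_le_cancel_iff) auto
    have "N 1 g \<le> N R g * R"
    proof -
      have "a g * 1 \<le> N R g * R" "d g * 1 \<le> N R g * R" "b g / R * R \<le> N R g * R"
        using R nn[of g] by (intro mult_mono; force simp: N_def)+
      thus ?thesis using R by (simp add: N_def[of 1])
    qed
    hence "ln (N 1 g) \<le> ln (N R g * R)" using Npos[OF g] R by (subst ln_le_cancel_iff) auto
    also have "\<dots> = ln (N R g) + ln R" using Npos(2)[OF g, of R] R by (subst ln_mult) auto
    finally show "lognorm g \<le> \<eta> R g + ln R"
      unfolding \<eta>_def lognorm_def mn[OF g] .
    show "\<eta> R g \<le> \<bar>drift g\<bar> + max 0 (lognorm g - ln R)"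
    proof (cases "b g / R \<le> max (a g) (d g)")
      case True
      hence "\<eta> R g = \<bar>drift g\<bar>" by (simp add: \<eta>_def N_def drift[OF g] max_def)
      thus ?thesis by simp
    next
      case False
      hence N: "N R g = b g / R" by (simp add: N_def)
      hence b: "b g > 0" using Npos(2)[OF g, of R] R by (simp add: zero_less_divide_iff)
      have "ln (b g) \<le> lognorm g"
        unfolding lognorm_def mn[OF g] using b Npos[OF g] by (subst ln_le_cancel_iff) (auto simp: N_def)
      hence "\<eta> R g \<le> lognorm g - ln R" unfolding \<eta>_def N using b R by (simp add: ln_div)
      thus ?thesis by linarith
    qed
  qed
  \<comment> \<open>The defect \<open>ln \<kappa>\<close> does not depend on \<open>R\<close>, which
    later permits sending \<open>R\<close> to infinity at a fixed time.\<close>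
  have \<eta>_sub: "\<eta> R (g \<otimes> h) \<le> \<eta> R g + \<eta> R h + ln \<kappa>"
    if g: "g \<in> carrier G" and h: "h \<in> carrier G" and R: "1 \<le> R" for g h R
  proof -
    have gh: "g \<otimes> h \<in> carrier G" using g h by simp
    have le: "x * y \<le> N R g * N R h" if "0 \<le> x" "x \<le> N R g" "0 \<le> y" "y \<le> N R h" for x y
      using that by (intro mult_mono) auto
    have leN: "a g' \<le> N R g'" "d g' \<le> N R g'" "b g' / R \<le> N R g'" for g' by (auto simp: N_def)
    have eq: "a (g \<otimes> h) = a g * a h" "d (g \<otimes> h) = d g * d h"
      using eps[OF g] eps[OF h]
      by (auto simp: a_def d_def rho_mult[OF g h] matrix_matrix_mult_def sum_2 av_mult)
    have "0 < N R g * N R h" using Npos(2)[OF g] Npos(2)[OF h] by simp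
    hence "1 * (N R g * N R h) \<le> \<kappa> * (N R g * N R h)"
      using kappa_ge_1 by (intro mult_right_mono) auto
    hence 1: "a (g \<otimes> h) \<le> \<kappa> * (N R g * N R h)" "d (g \<otimes> h) \<le> \<kappa> * (N R g * N R h)"
      using le[OF nn(1) leN(1) nn(1) leN(1)] le[OF nn(3) leN(2) nn(3) leN(2)] unfolding eq by linarith+
    have "b (g \<otimes> h) \<le> \<kappa> * max (a g * b h) (b g * d h)"
      using av_add_le[of "\<rho> g $ 1 $ 1 * \<rho> h $ 1 $ 2" "\<rho> g $ 1 $ 2 * \<rho> h $ 2 $ 2"]
      by (simp add: a_def b_def d_def rho_mult[OF g h] matrix_matrix_mult_def sum_2 av_mult)
    hence "b (g \<otimes> h) / R \<le> \<kappa> * max (a g * b h) (b g * d h) / R"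
      using R by (intro divide_right_mono) auto
    also have "\<dots> = \<kappa> * max (a g * (b h / R)) (b g / R * d h)" using R by (auto simp: max_def divide_simps)
    also have "\<dots> \<le> \<kappa> * (N R g * N R h)"
      using le[of "a g" "b h / R"] le[of "b g / R" "d h"] nn leN R kappa_pos
      by (intro mult_left_mono) auto
    finally have "N R (g \<otimes> h) \<le> \<kappa> * (N R g * N R h)" using 1 by (simp add: N_def[of R "g \<otimes> h"])
    hence "ln (N R (g \<otimes> h)) \<le> ln (\<kappa> * (N R g * N R h))"
      using Npos(2)[OF gh] Npos(2)[OF g] Npos(2)[OF h] kappa_pos by (subst ln_le_cancel_iff) auto
    also have "\<dots> = \<eta> R g + \<eta> R h + ln \<kappa>"
      using Npos(2)[OF g, of R] Npos(2)[OF h, of R] kappa_pos by (simp add: \<eta>_def ln_mult)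
    finally show ?thesis by (simp add: \<eta>_def)
  qed
  obtain l where l: "has_growth l" using has_growth_exists .
  have absd_int: "integrable (measure_pmf (walk n)) (\<lambda>g. \<bar>drift g\<bar>)" for n
    using integrable_drift_walk by simp
  have \<eta>_int: "integrable (measure_pmf (walk n)) (\<eta> R)" if R: "1 \<le> R" for n R
  proof (rule integrable_pmf_bound)
    show "integrable (measure_pmf (walk n)) (\<lambda>g. \<bar>lognorm g\<bar>)" using integrable_lognorm by simp
    fix g assume "g \<in> set_pmf (walk n)"
    hence g: "g \<in> carrier G" by (rule in_walk)
    show "\<bar>\<eta> R g\<bar> \<le> \<bar>lognorm g\<bar>" using \<eta>_ge[OF g, of R] \<eta>1(1)[OF g R] by linarith
  qed
  \<comment> \<open>Fekete's bound at the fixed time \<open>k\<close>; the rate on the left is that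
    of \<open>lognorm\<close>, for every \<open>R\<close>.\<close>
  have bound_R: "l \<le> (measure_pmf.expectation (walk k) (\<eta> R) + ln \<kappa>) / real k"
    if R: "1 \<le> R" and k: "k > 0" for R k
  proof -
    obtain l' where l': "(\<lambda>n. measure_pmf.expectation (walk n) (\<eta> R) / real n) \<longlonglongrightarrow> l'"
      "\<And>k. k > 0 \<Longrightarrow> l' \<le> (measure_pmf.expectation (walk k) (\<eta> R) + ln \<kappa>) / real k"
    proof (rule subadditive_growth_converges[of "\<eta> R" "ln \<kappa>"])
      fix x assume "x \<in> carrier G"
      from \<eta>_ge[OF this, of R] show "0 \<le> \<eta> R x + ln \<kappa>"
        using ln_ge_zero[OF kappa_ge_1] by linarith
    qed (use \<eta>_int[OF R] \<eta>_sub R in auto)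
    have "has_growth l'" unfolding has_growth_def
    proof (rule growth_bounded_difference[OF \<eta>_int[OF R] _ l'(1)])
      fix g assume g: "g \<in> carrier G"
      show "\<bar>\<eta> R g - lognorm g\<bar> \<le> ln R" using \<eta>1[OF g R] by linarith
    qed
    hence "l' = l" using has_growth_unique l by blast
    thus ?thesis using l'(2)[OF k] by simp
  qed
  have bound: "l \<le> (measure_pmf.expectation (walk k) (\<lambda>g. \<bar>drift g\<bar>) + ln \<kappa>) / real k"
    if k: "k > 0" for k
  proof -
    \<comment> \<open>The choice \<open>R = exp j\<close> makes \<open>ln R = j\<close>. For fixed
      \<open>k\<close> the mean excess tends to 0 by dominated convergence with
      \<open>\<bar>lognorm g\<bar>\<close> as majorant.\<close>
    define e where "e j = measure_pmf.expectation (walk k) (\<lambda>g. max 0 (lognorm g - real j))" for j :: nat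
    have e0: "e \<longlonglongrightarrow> measure_pmf.expectation (walk k) (\<lambda>_. 0)" unfolding e_def
    proof (rule integral_dominated_convergence[where w = "\<lambda>g. \<bar>lognorm g\<bar>"])
      show "AE g in measure_pmf (walk k). (\<lambda>j. max 0 (lognorm g - real j)) \<longlonglongrightarrow> 0"
      proof (rule AE_I2)
        fix g
        obtain j0 :: nat where j0: "lognorm g \<le> real j0" using real_arch_simple by blast
        have "\<forall>\<^sub>F j in sequentially. max 0 (lognorm g - real j) = 0"
          by (rule eventually_sequentiallyI[of j0]) (use j0 in auto)
        thus "(\<lambda>j. max 0 (lognorm g - real j)) \<longlonglongrightarrow> 0" by (rule tendsto_eventually)
      qed
    qed (use integrable_lognorm in auto)
    let ?E = "measure_pmf.expectation (walk k) (\<lambda>g. \<bar>drift g\<bar>)"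
    have le: "l * real k - ln \<kappa> - ?E \<le> e j" for j
    proof -
      have R: "1 \<le> exp (real j)" by simp
      have i: "integrable (measure_pmf (walk k)) (\<lambda>g. max 0 (lognorm g - real j))"
        using integrable_lognorm by simp
      have "measure_pmf.expectation (walk k) (\<eta> (exp (real j)))
          \<le> measure_pmf.expectation (walk k) (\<lambda>g. \<bar>drift g\<bar> + max 0 (lognorm g - real j))"
      proof (rule integral_pmf_mono[OF \<eta>_int[OF R]])
        fix g assume "g \<in> set_pmf (walk k)"
        from \<eta>1(3)[OF in_walk[OF this] R]
        show "\<eta> (exp (real j)) g \<le> \<bar>drift g\<bar> + max 0 (lognorm g - real j)" by simp
      qed (use i absd_int in simp)
      also have "\<dots> = ?E + e j" unfolding e_def using i absd_int by simp
      finally have *: "measure_pmf.expectation (walk k) (\<eta> (exp (real j))) \<le> ?E + e j" .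
      have "l * real k \<le> measure_pmf.expectation (walk k) (\<eta> (exp (real j))) + ln \<kappa>"
        using bound_R[OF R k] k by (simp add: pos_le_divide_eq)
      with * show ?thesis by linarith
    qed
    have "l * real k - ln \<kappa> - ?E \<le> 0"
    proof (rule LIMSEQ_le_const)
      show "e \<longlonglongrightarrow> 0" using e0 by simp
    qed (use le in blast)
    thus ?thesis using k by (simp add: pos_le_divide_eq)
  qed
  \<comment> \<open>Only after \<open>R\<close> has been removed does \<open>k\<close> tend to
    infinity, so that \<open>ln \<kappa> / real k\<close> disappears as well.\<close>
  have "l \<le> drift_growth + 0"
  proof (rule LIMSEQ_le_const)
    show "(\<lambda>k. measure_pmf.expectation (walk k) (\<lambda>g. \<bar>drift g\<bar>) / real k + ln \<kappa> / real k)
        \<longlonglongrightarrow> drift_growth + 0"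
      by (intro tendsto_add drift_growth_tendsto lim_const_over_n)
    show "\<exists>N. \<forall>k\<ge>N. l \<le> measure_pmf.expectation (walk k) (\<lambda>g. \<bar>drift g\<bar>) / real k + ln \<kappa> / real k"
      using bound by (intro exI[of _ 1]) (auto simp: add_divide_distrib)
  qed
  moreover have "drift_growth \<le> l"
  proof (rule LIMSEQ_le[OF drift_growth_tendsto l[unfolded has_growth_def]])
    have "measure_pmf.expectation (walk n) (\<lambda>g. \<bar>drift g\<bar>) \<le> measure_pmf.expectation (walk n) lognorm" for n
    proof (rule integral_pmf_mono[OF absd_int integrable_lognorm])
      fix g assume "g \<in> set_pmf (walk n)"
      hence g: "g \<in> carrier G" by (rule in_walk)
      show "\<bar>drift g\<bar> \<le> lognorm g" using \<eta>_ge[OF g, of 1] \<eta>1(1)[OF g, of 1] by simp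
    qed
    thus "\<exists>N. \<forall>n\<ge>N. measure_pmf.expectation (walk n) (\<lambda>g. \<bar>drift g\<bar>) / real n
        \<le> measure_pmf.expectation (walk n) lognorm / real n"
      by (intro exI[of _ 0] allI impI divide_right_mono) auto
  qed
  ultimately have "l = drift_growth" by simp
  thus ?thesis using l by simp
qed

lemma has_growth_axial: "has_growth drift_growth"
  using has_growth_monomial has_growth_triangular by blast

text \<open>Inversion preserves \<open>m\<close>. If all steps have sign 1 it also negates the
  drift, so the mean drift is 0; otherwise the rate is 0 by definition.\<close>

lemma drift_growth_symmetric:
  assumes "\<forall>g\<in>carrier G. pmf m g = pmf m (inv g)"
  shows "drift_growth = 0"
proof (cases "\<forall>g\<in>set_pmf m. \<epsilon> g = 1")
  case True
  have "map_pmf (\<lambda>g. inv g) m = m"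
  proof (rule pmf_eqI)
    fix g
    \<comment> \<open>Inversion is controlled only on the carrier. Outside it both masses are 0,
      because \<open>m\<close> and its image live on the carrier.\<close>
    show "pmf (map_pmf (\<lambda>g. inv g) m) g = pmf m g"
    proof (cases "g \<in> carrier G")
      case gc: True
      have "pmf (map_pmf (\<lambda>g. inv g) m) g = measure (measure_pmf m) ((\<lambda>g. inv g) -` {g})"
        by (simp add: pmf_map)
      also have "\<dots> = measure (measure_pmf m) {inv g}"
      proof (rule measure_eq_AE)
        show "AE x in measure_pmf m. (x \<in> (\<lambda>g. inv g) -` {g}) = (x \<in> {inv g})"
          using gc in_step by (auto simp: AE_measure_pmf_iff)
      qed auto
      also have "\<dots> = pmf m g" using assms[rule_format, OF gc] by (simp add: measure_pmf_single)
      finally show ?thesis .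
    next
      case False
      hence "pmf m g = 0" using in_step by (auto simp: pmf_eq_0_set_pmf)
      moreover have "g \<notin> (\<lambda>g. inv g) ` set_pmf m" using False in_step by auto
      ultimately show ?thesis by (simp add: pmf_map_outside)
    qed
  qed
  hence "measure_pmf.expectation m drift = measure_pmf.expectation (map_pmf (\<lambda>g. inv g) m) drift"
    by simp
  also have "\<dots> = measure_pmf.expectation m (\<lambda>g. drift (inv g))" by simp
  also have "\<dots> = measure_pmf.expectation m (\<lambda>g. - drift g)"
  proof (rule integral_pmf_cong)
    fix g assume g: "g \<in> set_pmf m"
    hence "g \<in> carrier G" by (rule in_step)
    thus "drift (inv g) = - drift g" using drift_mult[of g "inv g"] True g drift_one by simp
  qed
  finally show ?thesis by (simp add: drift_growth_def)
qed (auto simp: drift_growth_def)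

end

section \<open>Convergent Laurent series\<close>

lemma quasi_abs_cmod: "quasi_abs cmod 2"
proof
  show "cmod (x + y) \<le> 2 * max (cmod x) (cmod y)" for x y
    using norm_triangle_ineq[of x y] by linarith
qed (auto simp: norm_mult)

lemma quasi_abs_na_abs: "quasi_abs na_abs 1"
proof
  show "na_abs (x * y) = na_abs x * na_abs y" for x y
    by (auto simp: na_abs_def exp_add[symmetric])
  show "na_abs (x + y) \<le> 1 * max (na_abs x) (na_abs y)" for x y
  proof (cases "x = 0 \<or> y = 0 \<or> x + y = 0")
    case False
    hence "fls_subdegree (x + y) \<ge> min (fls_subdegree x) (fls_subdegree y)"
      using fls_plus_subdegree by blast
    thus ?thesis using False by (auto simp: na_abs_def min_def max_def split: if_splits)
  qed (auto simp: na_abs_def le_max_iff_disj)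
qed (auto simp: na_abs_def)

interpretation cv: quasi_abs cmod 2 by (rule quasi_abs_cmod)
interpretation nv: quasi_abs na_abs 1 by (rule quasi_abs_na_abs)

lemma na_norm_eq: "na_norm A = nv.mnorm A"
  by (simp add: na_norm_def nv.mnorm_def)

lemma norm_bounds_mnorm:
  fixes A :: "complex^2^2"
  shows "cv.mnorm A \<le> norm A" "norm A \<le> 4 * cv.mnorm A"
proof -
  show "cv.mnorm A \<le> norm A"
    by (rule cv.mnorm_le) (meson Finite_Cartesian_Product.norm_nth_le order_trans)
  have "norm A \<le> (\<Sum>i\<in>UNIV. norm (A $ i))" unfolding norm_vec_def[of A] by (rule L2_set_le_sum) simp
  also have "\<dots> \<le> (\<Sum>i\<in>UNIV. \<Sum>j\<in>UNIV. cmod (A $ i $ j))"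
  proof (rule sum_mono)
    fix i show "norm (A $ i) \<le> (\<Sum>j\<in>UNIV. cmod (A $ i $ j))"
      unfolding norm_vec_def[of "A $ i"] by (rule L2_set_le_sum) simp
  qed
  also have "\<dots> \<le> (\<Sum>i\<in>(UNIV::2 set). \<Sum>j\<in>(UNIV::2 set). cv.mnorm A)"
    by (intro sum_mono cv.av_entry_le_mnorm)
  finally show "norm A \<le> 4 * cv.mnorm A" by simp
qed

text \<open>If the leading term is \<open>c * t powi n\<close>, then \<open>ln (cmod (f t))\<close>
  is \<open>n * ln (cmod t)\<close> up to a bounded error, while \<open>ln (na_abs F) = - n\<close>.
  The bound obtained is \<open>\<bar>ln (cmod c)\<bar>\<close> plus 1 for the ratio to the leading
  term, which tends to 1.\<close>

lemma laurent_expansion_ln_asymp: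
  assumes F: "f has_laurent_expansion F" "F \<noteq> 0"
  shows "\<exists>C. \<forall>\<^sub>F t in at 0. \<bar>ln (cmod (f t)) - ln (1 / cmod t) * ln (na_abs F)\<bar> \<le> C"
proof -
  define n where "n = fls_subdegree F"
  define c where "c = fls_nth F n"
  have c: "c \<noteq> 0" using F by (simp add: c_def n_def)
  have nz: "\<forall>\<^sub>F t in at 0. c * t powi n \<noteq> 0"
    using c unfolding eventually_at_filter by simp
  have "f \<sim>[at 0] (\<lambda>t. c * t powi n)"
    unfolding c_def n_def by (rule has_laurent_expansion_imp_asymp_equiv_0[OF F(1)])
  moreover have "\<forall>\<^sub>F t in at 0. f t \<noteq> 0 \<or> c * t powi n \<noteq> 0" using nz by eventually_elim blast
  ultimately have "(\<lambda>t. f t / (c * t powi n)) \<midarrow>0\<rightarrow> 1" by (rule asymp_equivD_strong)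
  hence "(\<lambda>t. ln (cmod (f t / (c * t powi n)))) \<midarrow>0\<rightarrow> ln (cmod 1)"
    by (intro tendsto_ln tendsto_norm) auto
  hence "(\<lambda>t. ln (cmod (f t / (c * t powi n)))) \<midarrow>0\<rightarrow> 0" by simp
  from order_tendstoD[OF this] have
    "\<forall>\<^sub>F t in at 0. ln (cmod (f t / (c * t powi n))) > -1" "\<forall>\<^sub>F t in at 0. ln (cmod (f t / (c * t powi n))) < 1"
    by auto
  moreover have "\<forall>\<^sub>F t in at 0. f t \<noteq> 0"
    by (rule has_laurent_expansion_nonzero_imp_eventually_nonzero[OF F])
  moreover have "\<forall>\<^sub>F t in at (0::complex). t \<noteq> 0" by (simp add: eventually_at_filter)
  ultimately have "\<forall>\<^sub>F t in at 0.
      \<bar>ln (cmod (f t)) - ln (1 / cmod t) * ln (na_abs F)\<bar> \<le> 1 + \<bar>ln (cmod c)\<bar>"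
  proof eventually_elim
    case (elim t)
    have "ln (cmod (f t / (c * t powi n))) = ln (cmod (f t)) - ln (cmod c) - ln (cmod t powi n)"
      using elim c by (simp add: norm_divide norm_mult norm_power_int ln_div ln_mult)
    also have "ln (cmod t powi n) = real_of_int n * ln (cmod t)"
      using elim by (simp add: ln_powr powr_real_of_int'[symmetric])
    finally have "ln (cmod (f t)) - real_of_int n * ln (cmod t)
        = ln (cmod (f t / (c * t powi n))) + ln (cmod c)" by simp
    moreover have "ln (1 / cmod t) * ln (na_abs F) = real_of_int n * ln (cmod t)"
      using elim F by (simp add: na_abs_def n_def ln_div)
    ultimately show ?case using elim by linarith
  qed
  thus ?thesis by blast
qed

lemma laurent_expansion_bounded:
  assumes F: "f has_laurent_expansion F" "na_abs F \<le> 1"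
  shows "\<exists>K. \<forall>\<^sub>F t in at 0. cmod (f t) \<le> K"
proof -
  have "fls_subdegree F \<ge> 0" using F(2) by (auto simp: na_abs_def split: if_splits)
  hence "f \<midarrow>0\<rightarrow> fls_nth F 0" by (rule has_laurent_expansion_imp_tendsto_0[OF F(1)])
  hence "(\<lambda>t. cmod (f t)) \<midarrow>0\<rightarrow> cmod (fls_nth F 0)" by (rule tendsto_norm)
  from order_tendstoD(2)[OF this, of "cmod (fls_nth F 0) + 1"]
  have "\<forall>\<^sub>F t in at 0. cmod (f t) \<le> cmod (fls_nth F 0) + 1" by (auto elim: eventually_mono)
  thus ?thesis by blast
qed

lemma laurent_expansion_eventually_eq:
  assumes "f has_laurent_expansion F" "g has_laurent_expansion F"
  shows "\<forall>\<^sub>F t in at 0. f t = g t"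
proof -
  have "(\<lambda>t. f t - g t) has_laurent_expansion F - F" using assms by (intro laurent_expansion_intros)
  hence "\<forall>\<^sub>F t in at 0. f t - g t = 0"
    using has_laurent_expansion_eventually_zero_iff[of "\<lambda>t. f t - g t" 0] by simp
  thus ?thesis by eventually_elim simp
qed

text \<open>Formal Laurent series may diverge and then have no values at any \<open>t\<close>. A
  change of basis found over the Laurent series field can be evaluated in the fibers only if its
  entries converge, so convergence is tracked through the field operations.\<close>

definition convergent_fls :: "complex fls \<Rightarrow> bool" where
  "convergent_fls F \<longleftrightarrow> (\<exists>f. f has_laurent_expansion F)"

lemma convergent_fls_intros:
  "convergent_fls 0" "convergent_fls 1"
  "convergent_fls F \<Longrightarrow> convergent_fls G \<Longrightarrow> convergent_fls (F + G)"
  "convergent_fls F \<Longrightarrow> convergent_fls G \<Longrightarrow> convergent_fls (F - G)"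
  "convergent_fls F \<Longrightarrow> convergent_fls (- F)"
  "convergent_fls F \<Longrightarrow> convergent_fls G \<Longrightarrow> convergent_fls (F * G)"
  "convergent_fls F \<Longrightarrow> convergent_fls G \<Longrightarrow> convergent_fls (F / G)"
  "convergent_fls F \<Longrightarrow> convergent_fls (inverse F)"
  unfolding convergent_fls_def
  by (blast intro: has_laurent_expansion_0 has_laurent_expansion_1 has_laurent_expansion_add
      has_laurent_expansion_diff has_laurent_expansion_minus has_laurent_expansion_mult
      has_laurent_expansion_divide has_laurent_expansion_inverse)+

text \<open>The discriminant is \<open>F\<^sup>2 - 4 = F\<^sup>2 * (1 - 4 / F\<^sup>2)\<close>. As
  \<open>F\<close> has a pole, the second factor is analytic with value 1 at 0 and has an analytic
  square root there, so the eigenvalues converge and no quadratic extension is required.\<close>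

lemma convergent_eigenvalue:
  assumes F: "convergent_fls F" "na_abs F > 1"
  obtains \<Lambda> where "convergent_fls \<Lambda>" "\<Lambda> \<noteq> 0" "\<Lambda> + inverse \<Lambda> = F"
proof -
  obtain f where f: "f has_laurent_expansion F" using F by (auto simp: convergent_fls_def)
  have F0: "F \<noteq> 0" and sub: "fls_subdegree F < 0"
    using F(2) by (auto simp: na_abs_def split: if_splits)
  define P where "P = fls_regpart (inverse F)"
  have sub': "fls_subdegree (inverse F) > 0" using sub F0 by (simp add: fls_inverse_subdegree)
  have P: "fps_to_fls P = inverse F" unfolding P_def by (rule fls_regpart_to_fls_trivial) (use sub' in simp)
  \<comment> \<open>The value of \<open>f\<close> at 0 is arbitrary; setting \<open>U 0 = 0\<close>,
    the limit of the reciprocal at the pole, makes \<open>U\<close> analytic there.\<close>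
  define U where "U z = (if z = 0 then 0 else inverse (f z))" for z
  have "(\<lambda>z. inverse (f z)) has_laurent_expansion inverse F" by (rule has_laurent_expansion_inverse[OF f])
  hence U: "U has_laurent_expansion inverse F"
    by (subst has_laurent_expansion_cong[where g = "\<lambda>z. inverse (f z)"]) (auto simp: U_def eventually_at_filter)
  have "fps_nth P 0 = 0" using sub' by (simp add: P_def)
  hence "U has_fps_expansion P"
    using U by (subst has_fps_expansion_to_laurent) (auto simp: P U_def)
  hence "U analytic_on {0}" by (rule has_fps_expansion_imp_analytic_0)
  \<comment> \<open>At 0 the radicand equals 1, away from the branch cut of the principal
    root.\<close>
  define V where "V z = csqrt (1 - 4 * U z ^ 2)" for z
  have "V analytic_on {0}" unfolding V_def
    by (intro analytic_intros \<open>U analytic_on {0}\<close>) (auto simp: U_def)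
  then obtain W' where "V has_fps_expansion W'"
    using analytic_at_imp_has_fps_expansion_0 by blast
  then obtain W where W: "V has_laurent_expansion W" by (auto simp: has_fps_expansion_to_laurent)
  have "(\<lambda>z. V z ^ 2) has_laurent_expansion W ^ 2" by (intro laurent_expansion_intros W)
  moreover have "(\<lambda>z. 1 - 4 * U z ^ 2) has_laurent_expansion 1 - 4 * inverse F ^ 2"
    by (intro laurent_expansion_intros U)
  moreover have "(\<lambda>z. V z ^ 2) = (\<lambda>z. 1 - 4 * U z ^ 2)" by (simp add: V_def)
  ultimately have W2: "W ^ 2 = 1 - 4 * inverse F ^ 2" using has_laurent_expansion_unique by metis
  define \<Lambda> where "\<Lambda> = (1 + W) * F / 2"
  have "\<Lambda> * (F - \<Lambda>) = (1 - W ^ 2) * F ^ 2 / 4"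
    by (simp add: \<Lambda>_def field_simps power2_eq_square)
  also have "\<dots> = 1" using F0 by (simp add: W2 power_inverse)
  finally have L: "\<Lambda> * (F - \<Lambda>) = 1" .
  hence "\<Lambda> \<noteq> 0" "F - \<Lambda> = inverse \<Lambda>" by (auto simp: inverse_unique)
  moreover have "convergent_fls \<Lambda>" unfolding convergent_fls_def \<Lambda>_def
    by (intro exI[of _ "\<lambda>z. (1 + V z) * f z / 2"] laurent_expansion_intros W f)
  ultimately show thesis using that[of \<Lambda>] by (simp add: algebra_simps)
qed

section \<open>Matrix families and their entrywise expansions\<close>

definition mat_expansion :: "(complex \<Rightarrow> complex^2^2) \<Rightarrow> complex fls^2^2 \<Rightarrow> bool" where
  "mat_expansion F A \<longleftrightarrow> (\<forall>i j. (\<lambda>t. F t $ i $ j) has_laurent_expansion A $ i $ j)"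

lemma mat_expansion_exists:
  assumes "\<And>i j. convergent_fls (A $ i $ j)" obtains F where "mat_expansion F A"
proof -
  obtain f where f: "\<And>i j. f i j has_laurent_expansion A $ i $ j"
    using assms unfolding convergent_fls_def by metis
  show thesis by (rule that[of "\<lambda>t. \<chi> i j. f i j t"]) (simp add: mat_expansion_def f)
qed

lemma mat_expansion_mult:
  "mat_expansion F A \<Longrightarrow> mat_expansion H B \<Longrightarrow> mat_expansion (\<lambda>t. F t ** H t) (A ** B)"
  unfolding mat_expansion_def
  by (simp add: matrix_matrix_mult_def sum_2 has_laurent_expansion_add has_laurent_expansion_mult)

lemma mat_expansion_trace2:
  "mat_expansion F A \<Longrightarrow> (\<lambda>t. trace2 (F t)) has_laurent_expansion trace2 A"
  by (simp add: mat_expansion_def trace2_def has_laurent_expansion_add)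

lemma mat_expansion_det:
  "mat_expansion F A \<Longrightarrow> (\<lambda>t. det (F t)) has_laurent_expansion det A"
  by (simp add: mat_expansion_def det_2 has_laurent_expansion_diff has_laurent_expansion_mult)

lemma mat_expansion_eventually_eq:
  assumes "mat_expansion F A" "mat_expansion H A"
  shows "\<forall>\<^sub>F t in at 0. F t = H t"
proof -
  have "\<forall>\<^sub>F t in at 0. \<forall>i j. F t $ i $ j = H t $ i $ j"
  proof (intro eventually_all_finite)
    show "\<forall>\<^sub>F t in at 0. F t $ i $ j = H t $ i $ j" for i j
      by (rule laurent_expansion_eventually_eq[of _ "A $ i $ j"])
         (use assms in \<open>auto simp: mat_expansion_def\<close>)
  qed
  thus ?thesis by eventually_elim (simp add: vec_eq_iff)
qed

lemma mat_expansion_unique: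
  assumes "mat_expansion F A" "mat_expansion H B" "\<forall>\<^sub>F t in at 0. F t = H t"
  shows "A = B"
proof -
  have "A $ i $ j = B $ i $ j" for i j
  proof -
    have "\<forall>\<^sub>F t in at 0. F t $ i $ j = H t $ i $ j" using assms(3) by eventually_elim simp
    hence "(\<lambda>t. F t $ i $ j) has_laurent_expansion B $ i $ j"
      using assms(2) has_laurent_expansion_cong[of "\<lambda>t. F t $ i $ j" "\<lambda>t. H t $ i $ j" "B $ i $ j" "B $ i $ j"]
      unfolding mat_expansion_def by simp
    thus ?thesis using assms(1) has_laurent_expansion_unique unfolding mat_expansion_def by blast
  qed
  thus ?thesis by (simp add: vec_eq_iff)
qed

lemma mat_expansion_mat_1: "mat_expansion (\<lambda>t. mat 1) (mat 1)"
  by (auto simp: mat_expansion_def mat_def)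

text \<open>An entry whose expansion is 0 vanishes identically on a punctured neighborhood, so the
  shape found formally is inherited by the nearby fibers. The neighborhood depends on the
  matrix.\<close>

lemma axial_eventually:
  assumes "mat_expansion F A" "axial tri e A"
  shows "\<forall>\<^sub>F t in at 0. axial tri e (F t)"
proof -
  have z: "\<forall>\<^sub>F t in at 0. F t $ i $ j = 0" if "A $ i $ j = 0" for i j
  proof -
    have "(\<lambda>t. F t $ i $ j) has_laurent_expansion A $ i $ j" using assms(1) by (simp add: mat_expansion_def)
    hence "(\<lambda>t. F t $ i $ j) has_laurent_expansion 0" by (simp add: that)
    thus ?thesis by (rule laurent_expansion_eventually_eq) simp
  qed
  have "\<forall>\<^sub>F t in at 0. \<forall>i j. A $ i $ j = 0 \<longrightarrow> F t $ i $ j = 0"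
  proof (intro eventually_all_finite)
    show "\<forall>\<^sub>F t in at 0. A $ i $ j = 0 \<longrightarrow> F t $ i $ j = 0" for i j
      by (cases "A $ i $ j = 0") (simp_all add: z)
  qed
  thus ?thesis by eventually_elim (use assms(2) in \<open>auto simp: axial_def split: if_splits\<close>)
qed

lemma mat_expansion_multiplier:
  "mat_expansion F A \<Longrightarrow> (\<lambda>t. multiplier e (F t)) has_laurent_expansion multiplier e A"
  by (auto simp: mat_expansion_def multiplier_def)

section \<open>Finite orbits on the projective line\<close>

definition mat2 :: "'k \<Rightarrow> 'k \<Rightarrow> 'k \<Rightarrow> 'k \<Rightarrow> 'k^2^2" where
  "mat2 a b c d = (\<chi> i j. if i = 1 then (if j = 1 then a else b) else (if j = 1 then c else d))"

lemma mat2_nth [simp]: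
  "mat2 a b c d $ 1 $ 1 = a" "mat2 a b c d $ 1 $ 2 = b"
  "mat2 a b c d $ 2 $ 1 = c" "mat2 a b c d $ 2 $ 2 = d"
  by (simp_all add: mat2_def)

lemma mat2_inverse:
  fixes A :: "'k::field^2^2"
  assumes "det A \<noteq> 0"
  defines "B \<equiv> mat2 (A$2$2 / det A) (- A$1$2 / det A) (- A$2$1 / det A) (A$1$1 / det A)"
  shows "A ** B = mat 1" "B ** A = mat 1"
proof -
  have d: "(A$1$1 * A$2$2 - A$1$2 * A$2$1) / det A = 1" using assms(1) by (simp add: det_2)
  show "A ** B = mat 1" "B ** A = mat 1" using d
    by (auto simp: B_def vec_eq_iff forall_2 matrix_matrix_mult_def sum_2 mat_def
        diff_divide_distrib mult.commute)
qed

text \<open>The predicate \<open>P\<close> plays the role of the convergent series: the eigenvectors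
  are written with differences of entries and eigenvalues only, so they stay inside
  \<open>P\<close>. They are \<open>(b, x - a)\<close> if \<open>b\<close> is nonzero,
  \<open>(x - d, c)\<close> if \<open>c\<close> is nonzero, and standard basis vectors, possibly in
  swapped order, if \<open>g\<close> is diagonal.\<close>

lemma eigenbasis:
  fixes g :: "'k::field^2^2"
  assumes det: "det g = 1" and tr: "x + y = trace2 g" and xy: "x * y = 1" and ne: "x \<noteq> y"
    and P: "\<And>i j. P (g$i$j)" "P x" "P y" "P 0" "P 1" "\<And>u v. P u \<Longrightarrow> P v \<Longrightarrow> P (u - v)"
  obtains A where "\<And>i j. P (A$i$j)" "det A \<noteq> 0" "g ** A = A ** mat2 x 0 0 y"
proof -
  note result = that
  define a b c d where abcd: "a = g$1$1" "b = g$1$2" "c = g$2$1" "d = g$2$2"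
  have ad: "a * d - b * c = 1" using det by (simp add: det_2 abcd)
  have tr': "x + y = a + d" using tr by (simp add: trace2_def abcd)
  have Pg: "P a" "P b" "P c" "P d" using P(1) by (auto simp: abcd)
  have charpoly: "(z - a) * (z - d) = b * c" if "z = x \<or> z = y" for z
  proof -
    have "(z - x) * (z - y) = 0" using that by auto
    hence "z * z - (x + y) * z + x * y = 0" by (simp add: algebra_simps)
    thus ?thesis using ad tr' xy by (simp add: algebra_simps)
  qed
  note cx = charpoly[of x, simplified] and cy = charpoly[of y, simplified]
  \<comment> \<open>The columns \<open>(p, r)\<close> and \<open>(q, s)\<close> are the eigenvectors
    for \<open>x\<close> and \<open>y\<close>.\<close>
  have *: thesis if "P p" "P q" "P r" "P s" "p * s - q * r \<noteq> 0"
    "a * p + b * r = p * x" "a * q + b * s = q * y" "c * p + d * r = r * x" "c * q + d * s = s * y"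
    for p q r s
  proof (rule result[of "mat2 p q r s"])
    show "P (mat2 p q r s $ i $ j)" for i j
      using exhaust_2[of i] exhaust_2[of j] that(1-4) by (auto simp: mat2_nth)
    show "det (mat2 p q r s) \<noteq> 0" using that(5) by (simp add: det_2)
    show "g ** mat2 p q r s = mat2 p q r s ** mat2 x 0 0 y"
      using that(6-9) by (simp add: vec_eq_iff forall_2 matrix_matrix_mult_def sum_2 abcd)
  qed
  show thesis
  proof (cases "b = 0")
    case False
    show thesis
    proof (rule *[of b b "x - a" "y - a"])
      have "b * (y - a) - b * (x - a) = b * (y - x)" by (simp add: algebra_simps)
      thus "b * (y - a) - b * (x - a) \<noteq> 0" using False ne by simp
      show "c * b + d * (x - a) = (x - a) * x" using cx by (simp add: algebra_simps)
      show "c * b + d * (y - a) = (y - a) * y" using cy by (simp add: algebra_simps)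
    qed (use Pg P in \<open>auto simp: algebra_simps\<close>)
  next
    case b: True
    show thesis
    proof (cases "c = 0")
      case False
      show thesis
      proof (rule *[of "x - d" "y - d" c c])
        have "(x - d) * c - (y - d) * c = (x - y) * c" by (simp add: algebra_simps)
        thus "(x - d) * c - (y - d) * c \<noteq> 0" using False ne by simp
        show "a * (x - d) + b * c = (x - d) * x" using cx by (simp add: algebra_simps)
        show "a * (y - d) + b * c = (y - d) * y" using cy by (simp add: algebra_simps)
      qed (use Pg P in \<open>auto simp: algebra_simps\<close>)
    next
      case c: True
      have "x = a \<or> x = d" using cx b by auto
      thus thesis
      proof
        assume "x = a"
        hence "y = d" using tr' by simp
        show thesis by (rule *[of 1 0 0 1]) (use P b c \<open>x = a\<close> \<open>y = d\<close> in auto)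
      next
        assume "x = d"
        hence "y = a" using tr' by (simp add: add.commute)
        show thesis by (rule *[of 0 1 1 0]) (use P b c \<open>x = d\<close> \<open>y = a\<close> in auto)
      qed
    qed
  qed
qed

lemma convergent_diagonalization:
  fixes g :: "complex fls^2^2"
  assumes conv: "\<And>i j. convergent_fls (g$i$j)" and det: "det g = 1" and hyp: "na_abs (trace2 g) > 1"
  obtains A B :: "complex fls^2^2" where "\<forall>i j. convergent_fls (A$i$j)" "\<forall>i j. convergent_fls (B$i$j)"
    "A ** B = mat 1" "B ** A = mat 1"
    "(B ** g ** A)$1$2 = 0" "(B ** g ** A)$2$1 = 0"
    "na_abs ((B ** g ** A)$1$1) \<noteq> na_abs ((B ** g ** A)$2$2)"
proof -
  have "convergent_fls (trace2 g)" unfolding trace2_def by (intro convergent_fls_intros conv)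
  then obtain x where x: "convergent_fls x" "x \<noteq> 0" "x + inverse x = trace2 g"
    using convergent_eigenvalue hyp by blast
  define y where "y = inverse x"
  have xy: "x * y = 1" using x by (simp add: y_def)
  \<comment> \<open>As \<open>x * y = 1\<close>, equal absolute values would both be 1, and then the
    ultrametric inequality would bound the trace by 1.\<close>
  have ne: "na_abs x \<noteq> na_abs y"
  proof
    assume "na_abs x = na_abs y"
    hence "na_abs x * na_abs x = 1" using nv.av_mult[of x y] xy by simp
    hence "na_abs x = 1 \<or> na_abs x = -1" by (simp add: square_eq_1_iff)
    hence "na_abs x = 1" using nv.av_nonneg[of x] by linarith
    hence "na_abs (x + y) \<le> 1" using nv.av_add_le[of x y] \<open>na_abs x = na_abs y\<close> by simp
    thus False using hyp x by (simp add: y_def)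
  qed
  obtain A where A: "\<And>i j. convergent_fls (A$i$j)" "det A \<noteq> 0" "g ** A = A ** mat2 x 0 0 y"
  proof (rule eigenbasis[of g x y convergent_fls])
    show "x + y = trace2 g" using x by (simp add: y_def)
    show "convergent_fls y" unfolding y_def by (intro convergent_fls_intros x)
    show "x \<noteq> y" using ne by auto
  qed (use det xy x conv convergent_fls_intros in auto)
  define B where "B = mat2 (A$2$2 / det A) (- A$1$2 / det A) (- A$2$1 / det A) (A$1$1 / det A)"
  have AB: "A ** B = mat 1" "B ** A = mat 1" using mat2_inverse[OF A(2)] by (auto simp: B_def)
  have cd: "convergent_fls (det A)" unfolding det_2 by (intro convergent_fls_intros A)
  have "convergent_fls (B$i$j)" for i j
    using exhaust_2[of i] exhaust_2[of j] unfolding B_def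
    by (elim disjE; simp only: mat2_nth; intro convergent_fls_intros A cd)
  moreover have "B ** g ** A = mat2 x 0 0 y"
    using A(3) AB by (metis matrix_mul_assoc matrix_mul_lid)
  ultimately show thesis using that[of A B] A AB ne by simp
qed

lemma proj_pt_eqD:
  assumes "proj_pt u = proj_pt v" obtains c where "c \<noteq> 0" "u = c *s v"
proof -
  have "u \<in> proj_pt u" unfolding proj_pt_def by (rule CollectI, rule exI[of _ 1]) simp
  hence "u \<in> proj_pt v" using assms by simp
  thus thesis using that unfolding proj_pt_def by auto
qed

lemma proj_pt_mult: "proj_pt (B *v u) = (*v) B ` proj_pt u"
  unfolding proj_pt_def by (auto simp: vector_scalar_commute image_def)

text \<open>A normalization: the hyperbolic element is diagonal, so its fixed points on the
  projective line are the two coordinate axes.\<close>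

locale na_walk = sl2_walk G S m na_abs 1 \<sigma> for G :: "('g, 'b) monoid_scheme" (structure) and S m \<sigma> +
  fixes g0 :: 'g
  assumes g0: "g0 \<in> carrier G"
    and diag: "\<sigma> g0 $ 1 $ 2 = 0" "\<sigma> g0 $ 2 $ 1 = 0"
    and hyperbolic: "na_abs (\<sigma> g0 $ 1 $ 1) \<noteq> na_abs (\<sigma> g0 $ 2 $ 2)"
begin

definition finite_orbit :: "complex fls^2 \<Rightarrow> bool" where
  "finite_orbit v \<longleftrightarrow> finite ((\<lambda>g. proj_pt (\<sigma> g *v v)) ` carrier G)"

text \<open>On a vector with two nonzero coordinates, powers of \<open>g0\<close> multiply the ratio
  of the coordinates by powers of \<open>p / q\<close>. A repetition among these points gives
  \<open>p ^ (k - n) = q ^ (k - n)\<close>, against the different absolute values of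
  \<open>p\<close> and \<open>q\<close>.\<close>

lemma finite_orbit_axis:
  assumes fin: "finite_orbit v" shows "v$1 = 0 \<or> v$2 = 0"
proof (rule ccontr)
  assume "\<not> (v$1 = 0 \<or> v$2 = 0)"
  hence v: "v$1 \<noteq> 0" "v$2 \<noteq> 0" by auto
  define p q where pq: "p = \<sigma> g0 $ 1 $ 1" "q = \<sigma> g0 $ 2 $ 2"
  have "p * q = 1" using rho_det[OF g0] diag by (simp add: det_2 pq)
  hence pq0: "p \<noteq> 0" "q \<noteq> 0" by auto
  have pow: "\<sigma> (g0 [^] n) = mat2 (p^n) 0 0 (q^n)" for n :: nat
  proof (induction n)
    case 0
    show ?case by (simp add: rho_one vec_eq_iff forall_2 mat_def)
  next
    case (Suc n)
    have "\<sigma> (g0 [^] Suc n) = mat2 (p^n) 0 0 (q^n) ** \<sigma> g0"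
      using rho_mult[of "g0 [^] n" g0] g0 Suc by simp
    thus ?case using diag
      by (simp add: vec_eq_iff forall_2 matrix_matrix_mult_def sum_2 pq mult.commute)
  qed
  define f where "f n = proj_pt (\<sigma> (g0 [^] n) *v v)" for n :: nat
  have "range f \<subseteq> (\<lambda>g. proj_pt (\<sigma> g *v v)) ` carrier G" using g0 by (auto simp: f_def)
  hence "finite (range f)" using fin finite_subset unfolding finite_orbit_def by blast
  hence "\<not> inj f" using range_inj_infinite by blast
  then obtain n k where nk: "n < k" "f n = f k"
    unfolding inj_def by (metis linorder_neqE_nat)
  obtain c where c: "c \<noteq> 0" "\<sigma> (g0 [^] k) *v v = c *s (\<sigma> (g0 [^] n) *v v)"
    using proj_pt_eqD nk(2) unfolding f_def by metis
  have "p^k * v$1 = c * (p^n * v$1)" "q^k * v$2 = c * (q^n * v$2)"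
    using c(2) by (simp_all add: vec_eq_iff forall_2 pow matrix_vector_mult_def sum_2)
  hence "p^k = c * p^n" "q^k = c * q^n" using v by auto
  moreover have "p^k = p^(k-n) * p^n" "q^k = q^(k-n) * q^n" using nk by (simp_all add: power_add[symmetric])
  ultimately have "p^(k-n) = c" "q^(k-n) = c" using pq0 by auto
  moreover have "na_abs (z^j) = na_abs z ^ j" for z j by (induction j) (auto simp: nv.av_mult)
  ultimately have "na_abs p ^ (k-n) = na_abs q ^ (k-n)" by metis
  hence "na_abs p = na_abs q" by (rule power_eq_imp_eq_base) (use nk nv.av_nonneg in auto)
  thus False using hyperbolic by (simp add: pq)
qed

lemma finite_orbit_translate:
  assumes "finite_orbit v" "h \<in> carrier G" shows "finite_orbit (\<sigma> h *v v)"
proof -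
  have "(\<lambda>g. proj_pt (\<sigma> g *v (\<sigma> h *v v))) ` carrier G \<subseteq> (\<lambda>g. proj_pt (\<sigma> g *v v)) ` carrier G"
  proof
    fix x assume "x \<in> (\<lambda>g. proj_pt (\<sigma> g *v (\<sigma> h *v v))) ` carrier G"
    then obtain g where g: "g \<in> carrier G" "x = proj_pt (\<sigma> g *v (\<sigma> h *v v))" by auto
    hence "x = proj_pt (\<sigma> (g \<otimes> h) *v v)"
      using assms rho_mult by (simp add: matrix_vector_mul_assoc)
    thus "x \<in> (\<lambda>g. proj_pt (\<sigma> g *v v)) ` carrier G" using g assms by auto
  qed
  thus ?thesis using assms(1) finite_subset unfolding finite_orbit_def by blast
qed

text \<open>All translates of \<open>v\<close> have finite orbits and so lie on the two axes. If the
  first axis is never moved, the group is upper triangular. If some \<open>h0\<close> moves it, then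
  the second axis has a finite orbit too, so every element permutes the two axes and is
  monomial.\<close>

lemma finite_orbit_axial:
  assumes fin: "finite_orbit v" and v: "v$1 \<noteq> 0" "v$2 = 0"
  obtains tri \<epsilon> where "\<And>g. g \<in> carrier G \<Longrightarrow> axial tri (\<epsilon> g) (\<sigma> g)"
proof -
  have col1: "\<sigma> h $ 1 $ 1 = 0 \<or> \<sigma> h $ 2 $ 1 = 0" if "h \<in> carrier G" for h
    using finite_orbit_axis[OF finite_orbit_translate[OF fin that]] v
    by (simp add: matrix_vector_mult_def sum_2)
  show thesis
  proof (cases "\<forall>h\<in>carrier G. \<sigma> h $ 2 $ 1 = 0")
    case True
    thus thesis using that[of True "\<lambda>_. 1"] by (simp add: axial_def)
  next
    case False
    then obtain h0 where h0: "h0 \<in> carrier G" "\<sigma> h0 $ 2 $ 1 \<noteq> 0" by auto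
    define w where "w = \<sigma> h0 *v v"
    have "finite_orbit w" unfolding w_def by (rule finite_orbit_translate[OF fin h0(1)])
    moreover have w: "w$1 = 0" "w$2 \<noteq> 0"
      using col1[OF h0(1)] h0 v by (auto simp: w_def matrix_vector_mult_def sum_2)
    ultimately have col2: "\<sigma> h $ 1 $ 2 = 0 \<or> \<sigma> h $ 2 $ 2 = 0" if "h \<in> carrier G" for h
      using finite_orbit_axis[OF finite_orbit_translate[of w, OF _ that]] w
      by (simp add: matrix_vector_mult_def sum_2)
    show thesis
    \<comment> \<open>Each column has exactly one nonzero entry, so the first diagonal entry decides
      between keeping and swapping the axes.\<close>
    proof (rule that[of False "\<lambda>h. if \<sigma> h $ 1 $ 1 \<noteq> 0 then 1 else -1"])
      fix h assume h: "h \<in> carrier G"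
      thus "axial False (if \<sigma> h $ 1 $ 1 \<noteq> 0 then 1 else -1) (\<sigma> h)"
        using col1[OF h] col2[OF h] rho_det[OF h] by (auto simp: axial_def det_2)
    qed
  qed
qed

end

text \<open>In the eigenbasis of the hyperbolic element the finite orbit meets an axis by
  \<open>finite_orbit_axis\<close>. The change of basis has convergent entries because those of
  \<open>\<rho> g0\<close> converge; the other elements of the group need not enter its
  construction.\<close>

lemma axial_form_of_finite_orbit:
  assumes "sl2_walk G S m na_abs 1 \<rho>" and g0: "g0 \<in> carrier G" "na_abs (trace2 (\<rho> g0)) > 1"
    and conv: "\<And>i j. convergent_fls (\<rho> g0 $ i $ j)"
    and fin: "has_finite_orbit (\<rho> ` carrier G)"
  obtains A B :: "complex fls^2^2" and tri \<epsilon> where "\<And>i j. convergent_fls (A$i$j)" "\<And>i j. convergent_fls (B$i$j)"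
    "A ** B = mat 1" "B ** A = mat 1"
    "\<And>g. g \<in> carrier G \<Longrightarrow> axial tri (\<epsilon> g) (B ** \<rho> g ** A)"
proof -
  interpret sl2_walk G S m na_abs 1 \<rho> by fact
  have walkI: "na_walk G S m (\<lambda>g. B ** \<rho> g ** A) g0"
    if "A ** B = mat 1" "B ** A = mat 1" "(B ** \<rho> g0 ** A)$1$2 = 0" "(B ** \<rho> g0 ** A)$2$1 = 0"
    "na_abs ((B ** \<rho> g0 ** A)$1$1) \<noteq> na_abs ((B ** \<rho> g0 ** A)$2$2)" for A B :: "complex fls^2^2"
    unfolding na_walk_def na_walk_axioms_def using sl2_walk_conj[OF that(1,2)] g0 that by auto
  obtain v where v: "v \<noteq> 0" "finite ((\<lambda>g. proj_pt (\<rho> g *v v)) ` carrier G)"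
    using fin unfolding has_finite_orbit_def image_image by blast
  have orbit: "finite ((\<lambda>g. proj_pt ((B ** \<rho> g ** A) *v (B *v v))) ` carrier G)" if "A ** B = mat 1" for A B :: "complex fls^2^2"
  proof -
    have "(B ** \<rho> g ** A) *v (B *v v) = B *v (\<rho> g *v v)" for g
    proof -
      have "(B ** \<rho> g ** A) *v (B *v v) = (B ** \<rho> g ** (A ** B)) *v v"
        by (simp only: matrix_vector_mul_assoc matrix_mul_assoc)
      thus ?thesis by (simp add: that matrix_vector_mul_assoc)
    qed
    hence "(\<lambda>g. proj_pt ((B ** \<rho> g ** A) *v (B *v v))) ` carrier G
        = image ((*v) B) ` ((\<lambda>g. proj_pt (\<rho> g *v v)) ` carrier G)"
      by (simp add: proj_pt_mult image_image)
    thus ?thesis using v(2) by simp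
  qed
  obtain A B :: "complex fls^2^2" where AB: "\<forall>i j. convergent_fls (A$i$j)" "\<forall>i j. convergent_fls (B$i$j)"
    "A ** B = mat 1" "B ** A = mat 1"
    "(B ** \<rho> g0 ** A)$1$2 = 0" "(B ** \<rho> g0 ** A)$2$1 = 0"
    "na_abs ((B ** \<rho> g0 ** A)$1$1) \<noteq> na_abs ((B ** \<rho> g0 ** A)$2$2)"
    using convergent_diagonalization[OF conv rho_det[OF g0(1)] g0(2)] .
  interpret c: na_walk G S m "\<lambda>g. B ** \<rho> g ** A" g0 by (rule walkI) (use AB in auto)
  define w where "w = B *v v"
  have "A *v w = v" by (simp add: w_def matrix_vector_mul_assoc AB)
  hence w0: "w \<noteq> 0" using v(1) by auto
  have fw: "c.finite_orbit w" unfolding c.finite_orbit_def w_def by (rule orbit[OF AB(3)])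
  from c.finite_orbit_axis[OF fw] w0 consider "w$1 \<noteq> 0" "w$2 = 0" | "w$1 = 0" "w$2 \<noteq> 0"
    by (auto simp: vec_eq_iff forall_2)
  thus thesis
  proof cases
    case 1
    from c.finite_orbit_axial[OF fw this] show thesis using that AB by metis
  next
    case 2
    \<comment> \<open>The matrix \<open>J\<close> exchanges the two basis vectors, so that the axis
      with finite orbit becomes the first one, as the upper triangular normal form requires.\<close>
    define J :: "complex fls^2^2" where "J = mat2 0 1 1 0"
    have JJ: "J ** J = mat 1" by (simp add: J_def vec_eq_iff forall_2 matrix_matrix_mult_def sum_2 mat_def)
    define A' B' where A'B': "A' = A ** J" "B' = J ** B"
    have conv': "convergent_fls (A'$i$j)" "convergent_fls (B'$i$j)" for i j
      using exhaust_2[of i] exhaust_2[of j] AB(1,2)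
      by (auto simp: A'B' J_def matrix_matrix_mult_def sum_2)
    have "A' ** B' = A ** (J ** J) ** B" "B' ** A' = J ** (B ** A) ** J"
      by (simp_all only: A'B' matrix_mul_assoc)
    hence inv': "A' ** B' = mat 1" "B' ** A' = mat 1" using AB JJ by simp_all
    have conj': "B' ** X ** A' = J ** (B ** X ** A) ** J" for X by (simp only: A'B' matrix_mul_assoc)
    have J_nth: "(J ** X ** J)$1$1 = X$2$2" "(J ** X ** J)$2$2 = X$1$1"
      "(J ** X ** J)$1$2 = X$2$1" "(J ** X ** J)$2$1 = X$1$2" for X
      by (simp_all add: J_def matrix_matrix_mult_def sum_2)
    interpret c': na_walk G S m "\<lambda>g. B' ** \<rho> g ** A'" g0
      by (rule walkI[OF inv']) (use AB(5-7) in \<open>simp_all add: conj' J_nth\<close>)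
    have "c'.finite_orbit (B' *v v)" unfolding c'.finite_orbit_def by (rule orbit[OF inv'(1)])
    moreover have "B' *v v = J *v w" by (simp add: A'B' w_def matrix_vector_mul_assoc)
    hence "(B' *v v)$1 \<noteq> 0" "(B' *v v)$2 = 0"
      using 2 by (simp_all add: J_def matrix_vector_mult_def sum_2)
    ultimately show thesis using c'.finite_orbit_axial that conv' inv' by metis
  qed
qed

text \<open>Both representations, possibly over different fields, share the sign character. Hence
  \<open>w.drift - L * w'.drift\<close> is again a cocycle with the same twist, and a bound
  \<open>C\<close> on generators becomes \<open>C\<close> times the word length on the whole
  group.\<close>

lemma drift_growth_comparison:
  assumes w: "axial_walk G S m av \<kappa> \<rho> tri \<epsilon>" and w': "axial_walk G S m av' \<kappa>' \<rho>' tri \<epsilon>"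
    and L: "0 \<le> L"
    and close: "\<And>s. s \<in> S \<Longrightarrow> \<bar>ln (av (multiplier (\<epsilon> s) (\<rho> s)))
        - L * ln (av' (multiplier (\<epsilon> s) (\<rho>' s)))\<bar> \<le> C"
    and C: "0 \<le> C"
  shows "\<bar>axial_walk.drift_growth m av \<rho> \<epsilon> - L * axial_walk.drift_growth m av' \<rho>' \<epsilon>\<bar>
    \<le> C * measure_pmf.expectation m (\<lambda>g. real (word_length G S g))"
proof -
  interpret w: axial_walk G S m av \<kappa> \<rho> tri \<epsilon> by fact
  interpret w': axial_walk G S m av' \<kappa>' \<rho>' tri \<epsilon> by fact
  define M where "M = measure_pmf.expectation m (\<lambda>g. real (word_length G S g))"
  have M: "0 \<le> C * M" using C by (simp add: M_def)
  have diff: "\<bar>w.drift g - L * w'.drift g\<bar> \<le> C * real (word_length G S g)" if g: "g \<in> carrier G" for g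
  proof -
    have "\<bar>w.drift g - L * w'.drift g\<bar> \<le> \<bar>w.drift \<one>\<^bsub>G\<^esub> - L * w'.drift \<one>\<^bsub>G\<^esub>\<bar> + C * real (word_length G S g)"
      using g
    proof (rule w.wlen_linear_bound)
      fix s h assume sh: "s \<in> S" "h \<in> carrier G"
      hence s: "s \<in> carrier G" using w.gens_carrier by auto
      have "w.drift (s \<otimes>\<^bsub>G\<^esub> h) - L * w'.drift (s \<otimes>\<^bsub>G\<^esub> h)
          = (w.drift s - L * w'.drift s) + \<epsilon> s * (w.drift h - L * w'.drift h)"
        using w.drift_mult[OF s sh(2)] w'.drift_mult[OF s sh(2)] by (simp add: algebra_simps)
      moreover have "\<bar>\<epsilon> s * (w.drift h - L * w'.drift h)\<bar> = \<bar>w.drift h - L * w'.drift h\<bar>"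
        using w.eps_sign[OF s] by auto
      moreover have "\<bar>w.drift s - L * w'.drift s\<bar> \<le> C"
        using close[OF sh(1)] by (simp add: w.drift_def w'.drift_def)
      ultimately show "\<bar>w.drift (s \<otimes>\<^bsub>G\<^esub> h) - L * w'.drift (s \<otimes>\<^bsub>G\<^esub> h)\<bar> \<le> C + \<bar>w.drift h - L * w'.drift h\<bar>"
        by linarith
    qed
    thus ?thesis by (simp add: w.drift_one w'.drift_one)
  qed
  let ?E = "measure_pmf.expectation m w.drift" and ?E' = "measure_pmf.expectation m w'.drift"
  have "\<bar>?E - L * ?E'\<bar> = \<bar>measure_pmf.expectation m (\<lambda>g. w.drift g - L * w'.drift g)\<bar>"
    using w.integrable_drift w'.integrable_drift by simp
  also have "\<dots> \<le> measure_pmf.expectation m (\<lambda>g. \<bar>w.drift g - L * w'.drift g\<bar>)"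
    by (rule integral_abs_bound)
  also have "\<dots> \<le> measure_pmf.expectation m (\<lambda>g. C * real (word_length G S g))"
    by (rule integral_pmf_mono)
       (use w.integrable_drift w'.integrable_drift w.integrable_word_length diff w.in_step in auto)
  also have "\<dots> = C * M" by (simp add: M_def)
  finally have "\<bar>?E - L * ?E'\<bar> \<le> C * M" .
  \<comment> \<open>Here \<open>0 \<le> L\<close> lets \<open>L\<close> leave the absolute value. If
    a charged element swaps the axes, both rates are 0 and there is nothing to compare.\<close>
  moreover have "\<bar>\<bar>?E\<bar> - L * \<bar>?E'\<bar>\<bar> \<le> \<bar>?E - L * ?E'\<bar>"
    using L abs_triangle_ineq3[of ?E "L * ?E'"] by (simp add: abs_mult)
  ultimately show ?thesis
    using M by (auto simp: w.drift_growth_def w'.drift_growth_def M_def)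
qed

text \<open>Finitely many punctured neighborhoods are intersected. The bound is taken at least 1 so
  that it can serve directly as the \<open>K\<close> of \<open>has_growth_bounded_traces\<close> and
  is nonnegative in the drift comparison.\<close>

lemma eventually_common_bound:
  fixes f :: "'i \<Rightarrow> 'a \<Rightarrow> real"
  assumes "finite I" "\<And>i. i \<in> I \<Longrightarrow> \<exists>K. eventually (\<lambda>t. f i t \<le> K) F"
  obtains K where "K \<ge> 1" "eventually (\<lambda>t. \<forall>i\<in>I. f i t \<le> K) F"
proof -
  obtain k where k: "\<And>i. i \<in> I \<Longrightarrow> eventually (\<lambda>t. f i t \<le> k i) F" using assms(2) by metis
  define K where "K = 1 + (\<Sum>i\<in>I. \<bar>k i\<bar>)"
  have kK: "k i \<le> K" if "i \<in> I" for i
    using member_le_sum[of i I "\<lambda>i. \<bar>k i\<bar>"] assms(1) that by (auto simp: K_def)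
  have "eventually (\<lambda>t. f i t \<le> K) F" if "i \<in> I" for i
    by (rule eventually_mono[OF k[OF that]]) (use kK[OF that] in linarith)
  hence "eventually (\<lambda>t. \<forall>i\<in>I. f i t \<le> K) F" by (intro eventually_ball_finite assms(1)) auto
  moreover have "K \<ge> 1" by (simp add: K_def sum_nonneg)
  ultimately show thesis using that by blast
qed

section \<open>Elementary representations\<close>

lemma integrable_word_length_of_moment:
  assumes "\<delta> > 0"
    "(\<integral>\<^sup>+ g. ennreal (real (word_length G S g) powr (1 + \<delta>)) \<partial>measure_pmf m) < \<infinity>"
  shows "integrable (measure_pmf m) (\<lambda>g. real (word_length G S g))"
proof (rule integrableI_bounded)
  have le: "real n \<le> real n powr (1 + \<delta>)" for n :: nat
    using powr_mono[of 1 "1 + \<delta>" "real n"] assms(1) by (cases "n = 0") auto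
  have "(\<integral>\<^sup>+ g. ennreal (norm (real (word_length G S g))) \<partial>measure_pmf m)
      \<le> (\<integral>\<^sup>+ g. ennreal (real (word_length G S g) powr (1 + \<delta>)) \<partial>measure_pmf m)"
    by (intro nn_integral_mono ennreal_leI) (use le in simp)
  thus "(\<integral>\<^sup>+ g. ennreal (norm (real (word_length G S g))) \<partial>measure_pmf m) < \<infinity>"
    using assms(2) by (rule le_less_trans)
qed simp

text \<open>The value of \<open>lim\<close> is known only once convergence is. The Euclidean norm of
  a matrix differs from the maximum of its entries by a factor at most 4, hence has the same growth
  rate.\<close>

lemma chi_eqI:
  assumes "sl2_walk G S m cmod 2 (\<lambda>g. \<rho> g t)" "sl2_walk.has_growth G m cmod (\<lambda>g. \<rho> g t) l"
  shows "chi G m \<rho> t = l"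
proof -
  interpret sl2_walk G S m cmod 2 "\<lambda>g. \<rho> g t" by fact
  have "(\<lambda>n. measure_pmf.expectation (conv_pow G m n) (\<lambda>g. ln (norm (\<rho> g t))) / real n) \<longlonglongrightarrow> l"
  proof (rule growth_bounded_difference[OF integrable_lognorm _ assms(2)[unfolded has_growth_def]])
    fix g assume g: "g \<in> carrier G"
    have pos: "0 < cv.mnorm (\<rho> g t)" using mnorm_rho_pos[OF g] .
    have "cv.mnorm (\<rho> g t) \<le> norm (\<rho> g t)" "norm (\<rho> g t) \<le> 4 * cv.mnorm (\<rho> g t)"
      by (rule norm_bounds_mnorm)+
    hence "ln (cv.mnorm (\<rho> g t)) \<le> ln (norm (\<rho> g t))" "ln (norm (\<rho> g t)) \<le> ln (4 * cv.mnorm (\<rho> g t))"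
      using pos by (auto intro!: ln_mono simp del: zero_less_norm_iff)
    moreover have "ln (4 * cv.mnorm (\<rho> g t)) = ln 4 + ln (cv.mnorm (\<rho> g t))" using pos by (simp add: ln_mult)
    ultimately show "\<bar>lognorm g - ln (norm (\<rho> g t))\<bar> \<le> ln 4" unfolding lognorm_def by linarith
  qed
  thus ?thesis unfolding chi_def by (rule limI)
qed

lemma chi_na_eqI:
  assumes "sl2_walk G S m na_abs 1 (rho_na \<rho>)" "sl2_walk.has_growth G m na_abs (rho_na \<rho>) l"
  shows "chi_na G m \<rho> = l"
proof -
  interpret sl2_walk G S m na_abs 1 "rho_na \<rho>" by fact
  have "(\<lambda>n. measure_pmf.expectation (conv_pow G m n) (\<lambda>g. ln (na_norm (rho_na \<rho> g))) / real n) \<longlonglongrightarrow> l"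
    using assms(2) unfolding has_growth_def lognorm_def na_norm_eq .
  thus ?thesis unfolding chi_na_def by (rule limI)
qed

lemma eventually_punct_disk: "\<forall>\<^sub>F t in at 0. t \<in> punct_disk"
proof -
  have "\<forall>\<^sub>F t in at (0::complex). t \<in> ball 0 1 - {0}"
    using eventually_at_in_open[of "ball 0 1" "0::complex"] by simp
  thus ?thesis by (simp add: punct_disk_def)
qed

theorem theorem5p1:
  fixes G :: "('g, 'b) monoid_scheme" and S :: "'g set" and m :: "'g pmf"
    and \<rho> :: "'g \<Rightarrow> complex \<Rightarrow> complex^2^2"
  assumes "group G"
    and "finite S" and "S \<subseteq> carrier G" and "generate G S = carrier G"
    and "\<forall>s\<in>S. inv\<^bsub>G\<^esub> s \<in> S"
    and "set_pmf m \<subseteq> carrier G"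
    and "\<exists>\<delta>>0. (\<integral>\<^sup>+ g. ennreal (real (word_length G S g) powr (1 + \<delta>)) \<partial>measure_pmf m) < \<infinity>"
    and "\<forall>g\<in>carrier G. \<forall>i j. in_M (\<lambda>t. \<rho> g t $ i $ j)"
    and "\<forall>g\<in>carrier G. \<forall>t\<in>punct_disk. det (\<rho> g t) = 1"
    and "\<forall>g\<in>carrier G. \<forall>h\<in>carrier G. \<forall>t\<in>punct_disk. \<rho> (g \<otimes>\<^bsub>G\<^esub> h) t = \<rho> g t ** \<rho> h t"
    and "\<not> nonelementary (rho_na \<rho> ` carrier G)"
  shows "(\<exists>C. eventually (\<lambda>t. \<bar>chi G m \<rho> t - ln (1 / cmod t) * chi_na G m \<rho>\<bar> \<le> C) (at 0))
         \<and> ((\<forall>g\<in>carrier G. pmf m g = pmf m (inv\<^bsub>G\<^esub> g)) \<longrightarrow> chi_na G m \<rho> = 0)"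
proof -
  have fg: "fg_walk G S m"
    unfolding fg_walk_def fg_walk_axioms_def
    using assms(1-6) assms(7) integrable_word_length_of_moment by blast
  interpret fg_walk G S m by (rule fg)
  have expan: "mat_expansion (\<rho> g) (rho_na \<rho> g)" if "g \<in> carrier G" for g
    unfolding mat_expansion_def
  proof (intro allI)
    fix i j
    have "(\<lambda>t. \<rho> g t $ i $ j) meromorphic_on {0}" using assms(8) that by (simp add: in_M_def)
    from meromorphic_on_imp_has_laurent_expansion[OF this, of 0]
    show "(\<lambda>t. \<rho> g t $ i $ j) has_laurent_expansion rho_na \<rho> g $ i $ j" by (simp add: rho_na_def)
  qed
  have na: "sl2_walk G S m na_abs 1 (rho_na \<rho>)"
  proof (intro sl2_walk.intro fg quasi_abs_na_abs sl2_walk_axioms.intro)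
    fix g h assume g: "g \<in> carrier G"
    have "(\<lambda>t. det (\<rho> g t)) has_laurent_expansion det (rho_na \<rho> g)"
      by (rule mat_expansion_det[OF expan[OF g]])
    moreover have "\<forall>\<^sub>F t in at 0. det (\<rho> g t) = 1"
      using eventually_punct_disk by eventually_elim (use assms(9) g in blast)
    hence "(\<lambda>t. det (\<rho> g t)) has_laurent_expansion 1"
      by (subst has_laurent_expansion_cong[where g = "\<lambda>_. 1"]) auto
    ultimately show "det (rho_na \<rho> g) = 1" by (rule has_laurent_expansion_unique)
    assume h: "h \<in> carrier G"
    show "rho_na \<rho> (g \<otimes>\<^bsub>G\<^esub> h) = rho_na \<rho> g ** rho_na \<rho> h"
    proof (rule mat_expansion_unique[OF expan mat_expansion_mult[OF expan[OF g] expan[OF h]]])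
      show "\<forall>\<^sub>F t in at 0. \<rho> (g \<otimes>\<^bsub>G\<^esub> h) t = \<rho> g t ** \<rho> h t"
        using eventually_punct_disk by eventually_elim (use assms(10) g h in blast)
    qed (use g h in simp)
  qed
  interpret na: sl2_walk G S m na_abs 1 "rho_na \<rho>" by (rule na)
  have fiber: "sl2_walk G S m cmod 2 (\<lambda>g. \<rho> g t)" if "t \<in> punct_disk" for t
    using assms(9,10) that by (intro sl2_walk.intro fg quasi_abs_cmod sl2_walk_axioms.intro) auto
  have tr: "mtrace2 X = trace2 X" for X by (simp add: mtrace2_def trace2_def sum_2)
  define M where "M = measure_pmf.expectation m (\<lambda>g. real (wlen g))"
  show ?thesis
  \<comment> \<open>Elementarity is a disjunction: either there is no trace of absolute value above
    1, or there is a finite orbit. The split is on the first alternative, so that in the other case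
    a hyperbolic element and a finite orbit are both available.\<close>
  proof (cases "\<forall>g\<in>carrier G. na_abs (trace2 (rho_na \<rho> g)) \<le> 1")
    case True
    have S2: "rho_na \<rho> s ** rho_na \<rho> s' = rho_na \<rho> (s \<otimes>\<^bsub>G\<^esub> s')" if "s \<in> S" "s' \<in> S" for s s'
      using na.rho_mult[of s s'] that gens_carrier by (metis subsetD)
    obtain l where l: "na.has_growth l" using na.has_growth_exists .
    \<comment> \<open>With \<open>\<kappa> = K = 1\<close> the logarithm is 0: the non-archimedean
      rate vanishes, and it remains to bound \<open>chi\<close> near 0.\<close>
    have "l \<le> ln ((1 ^ 3 * 1 ^ 2) ^ card S) * M" unfolding M_def
      by (rule na.has_growth_bounded_traces[OF _ _ _ l]) (use True gens_carrier S2 in auto)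
    hence "l = 0" using na.has_growth_nonneg[OF l] by simp
    hence chi_na: "chi_na G m \<rho> = 0" using chi_na_eqI[OF na l] by simp
    obtain K1 where K1: "K1 \<ge> 1" "\<forall>\<^sub>F t in at 0. \<forall>s\<in>S. cmod (trace2 (\<rho> s t)) \<le> K1"
    proof (rule eventually_common_bound[OF finite_gens, of "\<lambda>s t. cmod (trace2 (\<rho> s t))" "at 0"])
      fix s assume "s \<in> S"
      hence s: "s \<in> carrier G" using gens_carrier by auto
      show "\<exists>K. \<forall>\<^sub>F t in at 0. cmod (trace2 (\<rho> s t)) \<le> K"
        by (rule laurent_expansion_bounded[OF mat_expansion_trace2[OF expan[OF s]]]) (use True s in blast)
    qed
    obtain K2 where K2: "K2 \<ge> 1"
      "\<forall>\<^sub>F t in at 0. \<forall>p\<in>S \<times> S. cmod (trace2 (\<rho> (fst p) t ** \<rho> (snd p) t)) \<le> K2"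
    proof (rule eventually_common_bound[of "S \<times> S"
          "\<lambda>p t. cmod (trace2 (\<rho> (fst p) t ** \<rho> (snd p) t))" "at 0"])
      fix p assume p: "p \<in> S \<times> S"
      hence ps: "fst p \<in> carrier G" "snd p \<in> carrier G" using gens_carrier by auto
      have "na_abs (trace2 (rho_na \<rho> (fst p) ** rho_na \<rho> (snd p))) \<le> 1"
        using True ps na.rho_mult[OF ps] by (metis m_closed)
      thus "\<exists>K. \<forall>\<^sub>F t in at 0. cmod (trace2 (\<rho> (fst p) t ** \<rho> (snd p) t)) \<le> K"
        by (rule laurent_expansion_bounded[OF mat_expansion_trace2[OF
              mat_expansion_mult[OF expan[OF ps(1)] expan[OF ps(2)]]]])
    qed (use finite_gens in auto)
    define K where "K = max K1 K2"
    define C where "C = ln ((2 ^ 3 * K ^ 2) ^ card S) * M"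
    have "\<forall>\<^sub>F t in at 0. \<bar>chi G m \<rho> t - ln (1 / cmod t) * chi_na G m \<rho>\<bar> \<le> C"
      using K1(2) K2(2) eventually_punct_disk
    proof eventually_elim
      case (elim t)
      interpret t: sl2_walk G S m cmod 2 "\<lambda>g. \<rho> g t" by (rule fiber[OF elim(3)])
      obtain l where l: "t.has_growth l" using t.has_growth_exists .
      have "l \<le> C" unfolding C_def M_def
      proof (rule t.has_growth_bounded_traces[OF _ _ _ l])
        show "1 \<le> K" using K1(1) by (simp add: K_def)
        show "cmod (trace2 (\<rho> s t)) \<le> K" if "s \<in> S" for s using elim(1) that by (force simp: K_def)
        show "cmod (trace2 (\<rho> s t ** \<rho> s' t)) \<le> K" if "s \<in> S" "s' \<in> S" for s s'
          using elim(2) that by (force simp: K_def)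
      qed
      thus ?case using chi_eqI[where \<rho> = \<rho> and t = t, OF fiber[OF elim(3)] l] chi_na t.has_growth_nonneg[OF l] by simp
    qed
    thus ?thesis using chi_na by blast
  next
    case False
    then obtain g0 where g0: "g0 \<in> carrier G" "na_abs (trace2 (rho_na \<rho> g0)) > 1" by force
    hence "has_finite_orbit (rho_na \<rho> ` carrier G)"
      using assms(11) unfolding nonelementary_def tr by blast
    moreover have "convergent_fls (rho_na \<rho> g0 $ i $ j)" for i j
      using expan[OF g0(1)] unfolding mat_expansion_def convergent_fls_def by blast
    ultimately obtain A B tri \<epsilon> where
      AB: "\<And>i j. convergent_fls (A$i$j)" "\<And>i j. convergent_fls (B$i$j)" "A ** B = mat 1" "B ** A = mat 1"
      and ax: "\<And>g. g \<in> carrier G \<Longrightarrow> axial tri (\<epsilon> g) (B ** rho_na \<rho> g ** A)"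
      using axial_form_of_finite_orbit[OF na g0] by metis
    define \<sigma> where "\<sigma> g = B ** rho_na \<rho> g ** A" for g
    have \<sigma>: "axial_walk G S m na_abs 1 \<sigma> tri \<epsilon>"
      unfolding \<sigma>_def by (intro axial_walk.intro na.sl2_walk_conj AB axial_walk_axioms.intro ax)
    interpret \<sigma>: axial_walk G S m na_abs 1 \<sigma> tri \<epsilon> by (rule \<sigma>)
    have chi_na: "chi_na G m \<rho> = \<sigma>.drift_growth"
      by (rule chi_na_eqI[OF na na.has_growth_conj[OF AB(3,4)]])
         (use \<sigma>.has_growth_axial in \<open>simp add: \<sigma>_def[abs_def]\<close>)
    \<comment> \<open>The formal change of basis is realized by convergent families. They are
      inverse to each other only near 0, by uniqueness of expansions.\<close>
    obtain At where At: "mat_expansion At A" using mat_expansion_exists[of A] AB(1) by blast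
    obtain Bt where Bt: "mat_expansion Bt B" using mat_expansion_exists[of B] AB(2) by blast
    have \<sigma>t: "mat_expansion (\<lambda>t. Bt t ** \<rho> g t ** At t) (\<sigma> g)" if "g \<in> carrier G" for g
      unfolding \<sigma>_def by (intro mat_expansion_mult At Bt expan that)
    have inv1: "\<forall>\<^sub>F t in at 0. At t ** Bt t = mat 1"
      using mat_expansion_mult[OF At Bt] mat_expansion_mat_1 AB(3)
      by (intro mat_expansion_eventually_eq[of _ "mat 1"]) auto
    have inv2: "\<forall>\<^sub>F t in at 0. Bt t ** At t = mat 1"
      using mat_expansion_mult[OF Bt At] mat_expansion_mat_1 AB(4)
      by (intro mat_expansion_eventually_eq[of _ "mat 1"]) auto
    \<comment> \<open>The triangular or monomial shape is transferred for the finitely many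
      generators only, since the neighborhood depends on the element.\<close>
    have axs: "\<forall>\<^sub>F t in at 0. \<forall>s\<in>S. axial tri (\<epsilon> s) (Bt t ** \<rho> s t ** At t)"
      by (intro eventually_ball_finite finite_gens ballI axial_eventually[OF \<sigma>t \<sigma>.rho_axial])
         (use gens_carrier in auto)
    let ?L = "\<lambda>t. ln (1 / cmod t)"
    obtain C where C: "C \<ge> 1"
      "\<forall>\<^sub>F t in at 0. \<forall>s\<in>S. \<bar>ln (cmod (multiplier (\<epsilon> s) (Bt t ** \<rho> s t ** At t)))
          - ?L t * ln (na_abs (multiplier (\<epsilon> s) (\<sigma> s)))\<bar> \<le> C"
    proof (rule eventually_common_bound[OF finite_gens])
      fix s assume "s \<in> S"
      hence s: "s \<in> carrier G" using gens_carrier by auto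
      show "\<exists>K. \<forall>\<^sub>F t in at 0. \<bar>ln (cmod (multiplier (\<epsilon> s) (Bt t ** \<rho> s t ** At t)))
          - ?L t * ln (na_abs (multiplier (\<epsilon> s) (\<sigma> s)))\<bar> \<le> K"
        by (rule laurent_expansion_ln_asymp[OF mat_expansion_multiplier[OF \<sigma>t[OF s]]
              multiplier_nonzero[OF \<sigma>.rho_axial[OF s] \<sigma>.rho_det[OF s]]])
    qed
    have "\<forall>\<^sub>F t in at 0. \<bar>chi G m \<rho> t - ?L t * chi_na G m \<rho>\<bar> \<le> C * M"
      using inv1 inv2 axs C(2) eventually_punct_disk
    proof eventually_elim
      case (elim t)
      interpret t: sl2_walk G S m cmod 2 "\<lambda>g. \<rho> g t" by (rule fiber[OF elim(5)])
      interpret c: sl2_walk G S m cmod 2 "\<lambda>g. Bt t ** \<rho> g t ** At t"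
        by (rule t.sl2_walk_conj[OF elim(1,2)])
      have \<epsilon>1: "\<epsilon> \<one>\<^bsub>G\<^esub> = 1"
      proof -
        have "\<epsilon> \<one>\<^bsub>G\<^esub> * \<epsilon> \<one>\<^bsub>G\<^esub> = \<epsilon> \<one>\<^bsub>G\<^esub>" using \<sigma>.eps_mult[of "\<one>\<^bsub>G\<^esub>" "\<one>\<^bsub>G\<^esub>"] by simp
        thus ?thesis using \<sigma>.eps_sign[of "\<one>\<^bsub>G\<^esub>"] by auto
      qed
      \<comment> \<open>Within one fixed fiber the shape extends from generators to the group along
        words. The sign is still the non-archimedean \<open>\<epsilon>\<close>, which makes the two
        drifts comparable.\<close>
      have "axial tri (\<epsilon> g) (Bt t ** \<rho> g t ** At t)" if "g \<in> carrier G" for g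
      proof (rule wlen_induct[OF that, of "\<lambda>_ g. axial tri (\<epsilon> g) (Bt t ** \<rho> g t ** At t)"])
        show "axial tri (\<epsilon> \<one>\<^bsub>G\<^esub>) (Bt t ** \<rho> \<one>\<^bsub>G\<^esub> t ** At t)"
          using c.rho_one \<epsilon>1 by (simp add: axial_def mat_def)
        fix n :: nat and s h
        assume sh: "s \<in> S" "h \<in> carrier G" "axial tri (\<epsilon> h) (Bt t ** \<rho> h t ** At t)"
        hence s: "s \<in> carrier G" using gens_carrier by auto
        show "axial tri (\<epsilon> (s \<otimes>\<^bsub>G\<^esub> h)) (Bt t ** \<rho> (s \<otimes>\<^bsub>G\<^esub> h) t ** At t)"
          unfolding \<sigma>.eps_mult[OF s sh(2)] c.rho_mult[OF s sh(2)]
          using axial_mult elim(3) sh by blast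
      qed
      hence ct: "axial_walk G S m cmod 2 (\<lambda>g. Bt t ** \<rho> g t ** At t) tri \<epsilon>"
        by (intro axial_walk.intro c.sl2_walk_axioms axial_walk_axioms.intro)
      interpret c: axial_walk G S m cmod 2 "\<lambda>g. Bt t ** \<rho> g t ** At t" tri \<epsilon> by (rule ct)
      have "chi G m \<rho> t = c.drift_growth"
        by (rule chi_eqI[where \<rho> = \<rho> and t = t, OF fiber[OF elim(5)] t.has_growth_conj[OF elim(1,2) c.has_growth_axial]])
      moreover have "0 \<le> ?L t" using elim(5) by (auto simp: punct_disk_def)
      ultimately show ?case unfolding chi_na M_def
        using drift_growth_comparison[OF ct \<sigma>, of "?L t" C] elim(4) C(1) by auto
    qed
    moreover have "chi_na G m \<rho> = 0" if "\<forall>g\<in>carrier G. pmf m g = pmf m (inv\<^bsub>G\<^esub> g)"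
      unfolding chi_na by (rule \<sigma>.drift_growth_symmetric[OF that])
    ultimately show ?thesis by blast
  qed
qed

end
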